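(* There exists a (topologically) $2$-generated profinite group $G$ such that $e(G)=\infty$, but $e(G,g)\leq 5$ for some $g\in G$.
   Context: For a topologically finitely generated nontrivial profinite group $G$ with normalized Haar measure (total mass $1$) and a subset $Y\subseteq G$, let $(x_n)_{n\geq 1}$ be a sequence of independent $G$-valued random variables, each distributed according to the Haar measure, and let $\tau_{G,Y}=\min\{n\geq 1\mid \langle Y,x_1,\dots,x_n\rangle=G\}\in[0,+\infty]$, where generation is meant topologically (i.e. $\langle\cdot\rangle$ is the closed subgroup generated) and the minimum of the empty set is $+\infty$. Define $e(G,Y)\in[0,+\infty]$ to be the expectation of $\tau_{G,Y}$; equivalently $e(G,Y)=\sup_N e(G/N,YN/N)$ where $N$ runs over the open normal subgroups $N\neq G$ of $G$ and the same definition is used for finite groups with uniform distribution. Write $e(G)=e(G,\emptyset)$ and $e(G,g)=e(G,\{g\})$ for $g\in G$. *)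

theory Defs
  imports "HOL-Probability.Probability" "HOL-Algebra.Algebra"
begin

text \<open>A topological group is a group \<open>G\<close> together with a topology \<open>T\<close> on its carrier. Separation
  axioms are not part of the definition.\<close>

definition topological_group :: "('a, 'b) monoid_scheme \<Rightarrow> 'a topology \<Rightarrow> bool" where
  "topological_group G T \<longleftrightarrow>
     group G \<and> topspace T = carrier G \<and>
     continuous_map (prod_topology T T) T (\<lambda>(x, y). x \<otimes>\<^bsub>G\<^esub> y) \<and>
     continuous_map T T (\<lambda>x. inv\<^bsub>G\<^esub> x)"

definition totally_disconnected_space :: "'a topology \<Rightarrow> bool" where
  "totally_disconnected_space T \<longleftrightarrow>
     (\<forall>x\<in>topspace T. connected_component_of_set T x = {x})"

definition profinite_group :: "('a, 'b) monoid_scheme \<Rightarrow> 'a topology \<Rightarrow> bool" where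
  "profinite_group G T \<longleftrightarrow>
     topological_group G T \<and> compact_space T \<and> Hausdorff_space T \<and> totally_disconnected_space T"

definition top_generate :: "('a, 'b) monoid_scheme \<Rightarrow> 'a topology \<Rightarrow> 'a set \<Rightarrow> 'a set" where
  "top_generate G T Y = (\<lambda>H. subgroup H G \<and> closedin T H) hull Y"

text \<open>The normalized Haar measure of a compact Hausdorff group is its unique left-invariant Radon
  probability measure. The measure is a parameter here, so uniqueness is not needed to make sense
  of the definitions below. For finite Borel measures on a compact Hausdorff space, inner regularity
  on all Borel sets gives outer regularity by complementation.\<close>

definition normalized_haar_measure ::
    "('a, 'b) monoid_scheme \<Rightarrow> 'a topology \<Rightarrow> 'a measure \<Rightarrow> bool" where
  "normalized_haar_measure G T M \<longleftrightarrow>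
     space M = topspace T \<and> sets M = sigma_sets (topspace T) {U. openin T U} \<and>
     prob_space M \<and>
     (\<forall>g\<in>carrier G. \<forall>A\<in>sets M. emeasure M (g <#\<^bsub>G\<^esub> A) = emeasure M A) \<and>
     (\<forall>A\<in>sets M. emeasure M A = (SUP K\<in>{K. compactin T K \<and> K \<subseteq> A}. emeasure M K))"

text \<open>Sequences are indexed from \<open>0\<close>: the first \<open>n\<close> terms of \<open>x\<close> are \<open>x 0, \<dots>, x (n - 1)\<close>.
  The infimum of the empty set of extended naturals is \<open>\<infinity>\<close>.\<close>

definition generation_time ::
    "('a, 'b) monoid_scheme \<Rightarrow> 'a topology \<Rightarrow> 'a set \<Rightarrow> (nat \<Rightarrow> 'a) \<Rightarrow> enat" where
  "generation_time G T Y x =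
     Inf {enat n | n. n \<ge> 1 \<and> top_generate G T (Y \<union> x ` {..<n}) = carrier G}"

text \<open>The independent \<open>M\<close>-distributed random variables are realized as the coordinate functions
  on the infinite product of copies of \<open>M\<close>.\<close>

definition expected_generation_time ::
    "('a, 'b) monoid_scheme \<Rightarrow> 'a topology \<Rightarrow> 'a measure \<Rightarrow> 'a set \<Rightarrow> ennreal" where
  "expected_generation_time G T M Y =
     (\<integral>\<^sup>+ x. ennreal_of_enat (generation_time G T Y x) \<partial>(\<Pi>\<^sub>M i\<in>(UNIV :: nat set). M))"

end

theory Submission
  imports Defs "HOL-Analysis.Kronecker_Approximation_Theorem" "HOL-Number_Theory.Number_Theory"
begin

text \<open>
The group is a product of alternating groups in which the degree \<open>n = n\<^sub>m\<close> occurs \<open>n\<^sup>m\<close> times,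
for \<open>m = 0, 1, \<dots>\<close> and rapidly growing \<open>n\<^sub>m\<close>. In one factor \<open>d\<close> random elements all fix the point 1 with
probability at least \<open>1 / n\<^sup>d\<close>, so the probability that this happens in some factor of degree \<open>n\<^sub>m\<close>
tends to 1 as \<open>m\<close> grows, and almost surely no finite number of random elements generates.

Let \<open>g\<close> be, in every factor, the product of a \<open>p\<close>-cycle with support \<open>P\<close> and an \<open>(n - p)\<close>-cycle, where \<open>p\<close>
and \<open>n - p\<close> are primes with \<open>p\<close> tiny compared to \<open>n\<close>. If \<open>x\<close> maps at most \<open>r\<close> points of \<open>P\<close> into \<open>P\<close>, then
the conjugate by \<open>x\<close> of the \<open>p\<close>-cycle has a further conjugate under a power of \<open>g\<close> such that the two
supports meet in exactly one point. The commutator is a 3-cycle, and since \<open>g\<close> has only two orbits, both of prime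
length, \<open>g\<close> and \<open>x\<close> generate the alternating group. The exceptional \<open>x\<close> have probability of order
\<open>1 / n\<^sup>r\<^sup>+\<^sup>1\<close>, which for \<open>r = m + 1\<close> remains small after summation over the \<open>n\<^sup>m\<close> factors.
Two factors of equal degree can only be linked by a homomorphism that fixes \<open>g\<close>. It is determined by the
image of an involution that generates the alternating group together with \<open>g\<close>, so there are no more such
homomorphisms than involutions, at most \<open>n! / (n div 2)!\<close>. Hence a single random \<open>x\<close> generates the whole
group together with \<open>g\<close> with probability at least \<open>1 / 2\<close>.
\<close>

section \<open>Products of finite groups\<close>

text \<open>The multiplicities are forced from two sides. To defeat every fixed \<open>d\<close>, a
  degree \<open>n\<close> must occur more than \<open>n^d\<close> times, so the exponent
  \<open>m\<close> has to grow; but then \<open>g\<close> and one random \<open>x\<close> may fail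
  in a single factor only with probability well below \<open>n^-m\<close>. Since \<open>x\<close>
  preserves \<open>P\<close> with probability \<open>1 / binom(n, p)\<close>, and then generates
  only an intransitive group together with \<open>g\<close>, \<open>p\<close> has to grow with
  \<open>m\<close> too. Two cycles of coprime lengths give control over the powers of
  \<open>g\<close>: some power shifts the two cycles by any prescribed pair of amounts. In
  particular the \<open>p\<close>-cycle alone is a power of \<open>g\<close>, an element of small
  support. Primality moreover makes every nonzero shift generate all shifts of its cycle, and it
  permits the dilation of residues that produces the single common point. Both primes are odd, so
  \<open>g\<close> is even. For linkage a crude count of involutions is enough: it is smaller than
  the order of the alternating group by about the factor \<open>(n div 2)!\<close>, which outgrows
  the number of pairs of factors of equal degree, at most \<open>n^(2 m)\<close>.\<close>

lemma continuous_on_nat_pair: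
  fixes f :: "nat \<times> nat \<Rightarrow> 'a::topological_space"
  shows "continuous_on S f"
proof -
  have "open B" for B :: "(nat \<times> nat) set"
    unfolding open_prod_def
  proof
    fix x assume "x \<in> B"
    then show "\<exists>U V. open U \<and> open V \<and> x \<in> U \<times> V \<and> U \<times> V \<subseteq> B"
      by (intro exI[of _ "{fst x}"] exI[of _ "{snd x}"]) (auto simp: Topological_Spaces.open_discrete)
  qed
  then have "continuous_on UNIV f"
    by (auto simp: continuous_on_open_vimage)
  then show ?thesis
    by (rule continuous_on_subset) simp
qed

lemma eq_carrier_of_commutators:
  assumes "group K" "subgroup H K" "derived K (carrier K) = carrier K"
    and "\<And>a b. a \<in> carrier K \<Longrightarrow> b \<in> carrier K \<Longrightarrow>
      a \<otimes>\<^bsub>K\<^esub> b \<otimes>\<^bsub>K\<^esub> inv\<^bsub>K\<^esub> a \<otimes>\<^bsub>K\<^esub> inv\<^bsub>K\<^esub> b \<in> H"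
  shows "H = carrier K"
proof
  interpret group K by fact
  show "H \<subseteq> carrier K"
    using assms(2) by (rule subgroup.subset)
  have "generate K (derived_set K (carrier K)) \<subseteq> H"
    by (rule generate_subgroup_incl) (use assms in auto)
  then show "carrier K \<subseteq> H"
    using assms(3) by (simp add: derived_def)
qed

locale finite_groups =
  fixes F :: "nat \<Rightarrow> nat monoid"
  assumes group_F [simp]: "\<And>i. group (F i)" and finite_F [simp]: "\<And>i. finite (carrier (F i))"
begin

definition G where "G = product_group UNIV F"
definition T where "T = top_of_set (carrier G)"
definition M where "M = PiM UNIV (\<lambda>i. uniform_count_measure (carrier (F i)))"

lemma carrier_G: "x \<in> carrier G \<longleftrightarrow> (\<forall>i. x i \<in> carrier (F i))"
  by (auto simp: G_def)

lemma group_G [simp]: "group G"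
  by (simp add: G_def)

lemma mult_G [simp]: "(x \<otimes>\<^bsub>G\<^esub> y) i = x i \<otimes>\<^bsub>F i\<^esub> y i"
  by (simp add: G_def)

lemma one_G [simp]: "\<one>\<^bsub>G\<^esub> i = \<one>\<^bsub>F i\<^esub>"
  by (simp add: G_def)

lemma inv_G [simp]: "x \<in> carrier G \<Longrightarrow> (inv\<^bsub>G\<^esub> x) i = inv\<^bsub>F i\<^esub> (x i)"
  by (simp add: G_def)

lemma one_F [simp]: "\<one>\<^bsub>F i\<^esub> \<in> carrier (F i)"
  by (simp add: group.is_monoid)

lemma F_nonempty [simp]: "carrier (F i) \<noteq> {}"
  using one_F by blast

lemma compact_G: "compact (carrier G)"
proof -
  have "compactin (product_topology (\<lambda>i. euclidean) UNIV) (\<Pi>\<^sub>E i\<in>UNIV. carrier (F i))"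
    by (subst compactin_PiE) (auto intro: finite_imp_compact)
  then show ?thesis
    by (simp add: euclidean_product_topology G_def)
qed

lemma profinite_G: "profinite_group G T"
proof -
  have coord: "continuous_on UNIV (\<lambda>x::nat \<Rightarrow> nat. x i)" for i
    by (rule continuous_on_product_coordinates)
  have "continuous_on (carrier G \<times> carrier G) (\<lambda>(x, y). x \<otimes>\<^bsub>G\<^esub> y)"
  proof (rule continuous_on_coordinatewise_then_product)
    fix i
    have "continuous_on (carrier G \<times> carrier G)
        (\<lambda>z. (\<lambda>(a, b). a \<otimes>\<^bsub>F i\<^esub> b) (fst z i, snd z i))"
      by (rule continuous_on_compose2[OF continuous_on_nat_pair[of UNIV]])
        (intro continuous_on_Pair subset_UNIV continuous_on_compose2[OF coord continuous_on_fst[OF continuous_on_id]]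
          continuous_on_compose2[OF coord continuous_on_snd[OF continuous_on_id]])+
    then show "continuous_on (carrier G \<times> carrier G) (\<lambda>z. (case z of (x, y) \<Rightarrow> x \<otimes>\<^bsub>G\<^esub> y) i)"
      by (simp add: case_prod_beta)
  qed
  moreover have "(\<lambda>(x, y). x \<otimes>\<^bsub>G\<^esub> y) \<in> carrier G \<times> carrier G \<rightarrow> carrier G"
    by (auto intro: subgroup.m_closed[OF group.subgroup_self[OF group_G]])
  ultimately have m: "continuous_map (prod_topology T T) T (\<lambda>(x, y). x \<otimes>\<^bsub>G\<^esub> y)"
    by (simp add: T_def continuous_map_in_subtopology image_subset_iff_funcset)
  have "continuous_on (carrier G) (\<lambda>x. inv\<^bsub>G\<^esub> x)"
  proof (rule continuous_on_coordinatewise_then_product)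
    fix i
    \<comment> \<open>The constant second component only serves to reuse the continuity of all
      functions on pairs.\<close>
    have "continuous_on (carrier G) (\<lambda>x. (\<lambda>z. inv\<^bsub>F i\<^esub> (fst z)) (x i, 0::nat))"
      by (rule continuous_on_compose2[OF continuous_on_nat_pair[of UNIV]])
        (intro continuous_on_Pair continuous_on_const subset_UNIV continuous_on_subset[OF coord])+
    then show "continuous_on (carrier G) (\<lambda>x. (inv\<^bsub>G\<^esub> x) i)"
      by (rule continuous_on_eq) simp
  qed
  then have i: "continuous_map T T (\<lambda>x. inv\<^bsub>G\<^esub> x)"
    by (auto simp add: T_def continuous_map_in_subtopology)
  have "connected_component_of_set T x = {x}" if "x \<in> topspace T" for x
  proof -
    have "y = x" if "connected_component_of T x y" for y
    proof
      fix i
      from that obtain S where S: "connectedin T S" "x \<in> S" "y \<in> S"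
        by (auto simp: connected_component_of_def)
      then have "connected S"
        by (simp add: T_def connectedin_subtopology)
      then have "connected ((\<lambda>x. x i) ` S)"
        by (rule connected_continuous_image[rotated])
          (rule continuous_on_subset[OF coord], simp)
      then have "{x i} \<inter> (\<lambda>x. x i) ` S = {} \<or> - {x i} \<inter> (\<lambda>x. x i) ` S = {}"
        by (rule connectedD) (auto simp: Topological_Spaces.open_discrete)
      moreover have "x i \<in> {x i} \<inter> (\<lambda>x. x i) ` S" using S(2) by blast
      ultimately have "y i \<notin> - {x i}" using S(3) by blast
      then show "y i = x i" by simp
    qed
    moreover have "connected_component_of T x x"
      using that by (simp add: connected_component_of_refl)
    ultimately show ?thesis by auto
  qed
  moreover have "Hausdorff_space (euclidean :: (nat \<Rightarrow> nat) topology)"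
    unfolding Hausdorff_space_def disjnt_def
  proof (intro allI impI)
    fix x y :: "nat \<Rightarrow> nat" assume "x \<in> topspace euclidean \<and> y \<in> topspace euclidean \<and> x \<noteq> y"
    then obtain i where i: "x i \<noteq> y i" by blast
    have "open ((\<lambda>z::nat \<Rightarrow> nat. z i) -` U)" for U
      by (rule open_vimage[OF Topological_Spaces.open_discrete continuous_on_product_coordinates])
    from this[of "{x i}"] this[of "- {x i}"] show "\<exists>U V. openin euclidean U \<and> openin euclidean V \<and> x \<in> U \<and> y \<in> V \<and> U \<inter> V = {}"
      using i by (intro exI[of _ "(\<lambda>z. z i) -` {x i}"] exI[of _ "(\<lambda>z. z i) -` (- {x i})"])
        (auto simp: open_openin[symmetric])
  qed
  then have "Hausdorff_space T"
    unfolding T_def by (rule Hausdorff_space_subtopology)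
  moreover have "compact_space T" "topspace T = carrier G"
    by (simp_all add: T_def compact_space_subtopology compact_G)
  ultimately show ?thesis
    using m i by (simp add: profinite_group_def topological_group_def totally_disconnected_space_def)
qed

section \<open>Haar measure as a product of uniform measures\<close>

lemma space_M [simp]: "space M = carrier G"
  by (simp add: M_def space_PiM space_uniform_count_measure G_def)

lemma prob_space_F [simp]: "prob_space (uniform_count_measure (carrier (F i)))"
  by (rule prob_space_uniform_count_measure) auto

sublocale haar: prob_space M
  unfolding M_def by (rule prob_space_PiM) simp

text \<open>There are only countably many coordinates, each with countably many values, so the Borel
  sets and the product sigma-algebra coincide.\<close>

lemma sets_M: "sets M = sigma_sets (topspace T) {U. openin T U}"
proof
  have gen: "sets M = sigma_sets (carrier G)
      {{f \<in> carrier G. f i \<in> A} |i A. A \<subseteq> carrier (F i)}"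
    unfolding M_def sets_PiM_single
    by (simp add: space_uniform_count_measure sets_uniform_count_measure G_def PiE_UNIV_domain)
  show "sets M \<subseteq> sigma_sets (topspace T) {U. openin T U}"
    unfolding gen T_def topspace_subtopology topspace_euclidean Int_UNIV_left
  proof (rule sigma_sets_mono', safe)
    fix i A
    have "open ((\<lambda>x::nat \<Rightarrow> nat. x i) -` A)"
      by (rule open_vimage[OF Topological_Spaces.open_discrete continuous_on_product_coordinates])
    moreover have "{f \<in> carrier G. f i \<in> A} = carrier G \<inter> (\<lambda>x. x i) -` A" by auto
    ultimately show "openin (top_of_set (carrier G)) {f \<in> carrier G. f i \<in> A}"
      by (auto simp: openin_open)
  qed
  show "sigma_sets (topspace T) {U. openin T U} \<subseteq> sets M"
  proof -
    have "(\<lambda>x. x) \<in> measurable M (PiM UNIV (\<lambda>_. borel :: nat measure))"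
    proof (rule measurable_PiM_single)
      fix A :: "nat set" and i
      have "{f \<in> carrier G. f i \<in> A \<inter> carrier (F i)} \<in> sets M"
        unfolding gen by (rule sigma_sets.Basic) blast
      moreover have "{f \<in> carrier G. f i \<in> A \<inter> carrier (F i)} = {\<omega> \<in> space M. \<omega> i \<in> A}"
        by (auto simp: carrier_G)
      ultimately show "{\<omega> \<in> space M. \<omega> i \<in> A} \<in> sets M" by simp
    qed auto
    then have id: "(\<lambda>x. x) \<in> measurable M borel"
      using measurable_cong_sets[OF refl sets_PiM_equal_borel] by blast
    have "U \<in> sets M" if "openin T U" for U
    proof -
      from that obtain V where V: "open V" "U = carrier G \<inter> V"
        by (auto simp: T_def openin_open)
      then have "(\<lambda>x. x) -` V \<inter> space M \<in> sets M"
        by (intro measurable_sets[OF id]) auto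
      then show ?thesis using V by (simp add: Int_commute)
    qed
    then show ?thesis
      using sets.sigma_sets_subset[of "{U. openin T U}" M] by (auto simp: T_def)
  qed
qed


lemma cylinder_sets: "{x \<in> carrier G. x i \<in> A} \<in> sets M"
proof -
  have "{x \<in> carrier G. x i \<in> A} = (\<lambda>x. x i) -` (A \<inter> carrier (F i)) \<inter> space M"
    by (auto simp: carrier_G)
  also have "\<dots> \<in> sets M"
    unfolding M_def by (rule measurable_sets[OF measurable_component_singleton])
      (auto simp: sets_uniform_count_measure)
  finally show ?thesis .
qed

lemma prod_emb_cylinder:
  "prod_emb UNIV (\<lambda>i. uniform_count_measure (carrier (F i))) J (Pi\<^sub>E J A) =
     {x \<in> carrier G. \<forall>i\<in>J. x i \<in> A i}"
  by (auto simp: prod_emb_def carrier_G space_uniform_count_measure PiE_iff)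

lemma emeasure_cylinder:
  assumes "finite J" "\<And>i. i \<in> J \<Longrightarrow> A i \<subseteq> carrier (F i)"
  shows "emeasure M {x \<in> carrier G. \<forall>i\<in>J. x i \<in> A i} =
    (\<Prod>i\<in>J. ennreal (card (A i) / order (F i)))"
proof -
  have "emeasure M {x \<in> carrier G. \<forall>i\<in>J. x i \<in> A i} =
      (\<Prod>i\<in>J. emeasure (uniform_count_measure (carrier (F i))) (A i))"
    unfolding M_def prod_emb_cylinder[symmetric] by (rule emeasure_PiM_emb)
      (use assms in \<open>auto simp: sets_uniform_count_measure\<close>)
  also have "\<dots> = (\<Prod>i\<in>J. ennreal (card (A i) / order (F i)))"
    by (rule prod.cong) (use assms in \<open>auto simp: emeasure_uniform_count_measure order_def\<close>)
  finally show ?thesis by simp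
qed

lemma translation_measurable:
  assumes "g \<in> carrier G"
  shows "(\<lambda>x. g \<otimes>\<^bsub>G\<^esub> x) \<in> measurable M M"
proof -
  have cl: "g \<otimes>\<^bsub>G\<^esub> x \<in> carrier G" if "x \<in> carrier G" for x
    using that assms by (rule_tac subgroup.m_closed[OF group.subgroup_self[OF group_G]])
  have "(\<lambda>x. g \<otimes>\<^bsub>G\<^esub> x) \<in> measurable M (PiM UNIV (\<lambda>i. uniform_count_measure (carrier (F i))))"
  proof (rule measurable_PiM_single)
    show "(\<lambda>x. g \<otimes>\<^bsub>G\<^esub> x) \<in> space M \<rightarrow> (\<Pi>\<^sub>E i\<in>UNIV. space (uniform_count_measure (carrier (F i))))"
      using cl by (auto simp: carrier_G space_uniform_count_measure)
    fix A i
    show "{x \<in> space M. (g \<otimes>\<^bsub>G\<^esub> x) i \<in> A} \<in> sets M"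
      using cylinder_sets[of i "{a. g i \<otimes>\<^bsub>F i\<^esub> a \<in> A}"] by simp
  qed
  then show ?thesis by (simp add: M_def)
qed

text \<open>Finite measures that agree on cylinders over finitely many coordinates are equal. The
  preimage of such a cylinder under the translation has each side \<open>A i\<close> replaced by its
  translate by the inverse of \<open>g i\<close>, which has the same cardinality.\<close>

lemma distr_translation:
  assumes "g \<in> carrier G"
  shows "distr M M (\<lambda>x. g \<otimes>\<^bsub>G\<^esub> x) = M"
proof -
  let ?U = "\<lambda>i. uniform_count_measure (carrier (F i))"
  have "M = distr M M (\<lambda>x. g \<otimes>\<^bsub>G\<^esub> x)"
  proof (rule measure_eqI_PiM_infinite)
    show "sets M = sets (PiM UNIV ?U)" "sets (distr M M (\<lambda>x. g \<otimes>\<^bsub>G\<^esub> x)) = sets (PiM UNIV ?U)"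
      by (simp_all add: M_def)
    show "finite_measure M" by (rule haar.finite_measure_axioms)
    fix A :: "nat \<Rightarrow> nat set" and J :: "nat set"
    assume J: "finite J" and A: "\<And>i. i \<in> J \<Longrightarrow> A i \<in> sets (?U i)"
    then have A': "A i \<subseteq> carrier (F i)" if "i \<in> J" for i
      using that by (auto simp: sets_uniform_count_measure)
    define B where "B i = (\<lambda>a. inv\<^bsub>F i\<^esub> (g i) \<otimes>\<^bsub>F i\<^esub> a) ` A i" for i
    have gi: "g i \<in> carrier (F i)" for i
      using assms by (auto simp: carrier_G)
    have B: "card (B i) = card (A i)" "B i \<subseteq> carrier (F i)" if "i \<in> J" for i
    proof -
      interpret group "F i" by simp
      show "card (B i) = card (A i)"
        unfolding B_def using A'[OF that] gi[of i]
        by (intro card_image) (auto simp: inj_on_def subset_eq)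
      show "B i \<subseteq> carrier (F i)"
        unfolding B_def using A'[OF that] gi[of i] by auto
    qed
    have iff: "g i \<otimes>\<^bsub>F i\<^esub> a \<in> A i \<longleftrightarrow> a \<in> B i" if "i \<in> J" "a \<in> carrier (F i)" for i a
    proof -
      interpret group "F i" by simp
      show ?thesis
        unfolding B_def using A'[OF that(1)] gi[of i] that(2)
        by (auto simp: image_iff m_assoc[symmetric] subset_eq)
          (metis inv_closed inv_solve_left m_closed)
    qed
    have "emeasure (distr M M (\<lambda>x. g \<otimes>\<^bsub>G\<^esub> x)) {x \<in> carrier G. \<forall>i\<in>J. x i \<in> A i} =
        emeasure M ((\<lambda>x. g \<otimes>\<^bsub>G\<^esub> x) -` {x \<in> carrier G. \<forall>i\<in>J. x i \<in> A i} \<inter> space M)"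
    proof (rule emeasure_distr[OF translation_measurable[OF assms]])
      show "{x \<in> carrier G. \<forall>i\<in>J. x i \<in> A i} \<in> sets M"
        unfolding prod_emb_cylinder[symmetric] M_def
        by (rule sets_PiM_I) (use J A in auto)
    qed
    also have "(\<lambda>x. g \<otimes>\<^bsub>G\<^esub> x) -` {x \<in> carrier G. \<forall>i\<in>J. x i \<in> A i} \<inter> space M =
        {x \<in> carrier G. \<forall>i\<in>J. x i \<in> B i}"
      using measurable_space[OF translation_measurable[OF assms]] iff
      by (auto simp: carrier_G)
    also have "emeasure M \<dots> = emeasure M {x \<in> carrier G. \<forall>i\<in>J. x i \<in> A i}"
      using J A' B by (subst (1 2) emeasure_cylinder) auto
    finally show "emeasure M (prod_emb UNIV ?U J (Pi\<^sub>E J A)) =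
        emeasure (distr M M (\<lambda>x. g \<otimes>\<^bsub>G\<^esub> x)) (prod_emb UNIV ?U J (Pi\<^sub>E J A))"
      by (simp only: prod_emb_cylinder)
  qed
  then show ?thesis by simp
qed

lemma left_invariant:
  assumes "g \<in> carrier G" "A \<in> sets M"
  shows "emeasure M (g <#\<^bsub>G\<^esub> A) = emeasure M A"
proof -
  interpret group G by simp
  have sub: "A \<subseteq> carrier G"
    using sets.sets_into_space[OF assms(2)] by simp
  have ig: "inv\<^bsub>G\<^esub> g \<in> carrier G" using assms by simp
  have eq: "(\<lambda>x. inv\<^bsub>G\<^esub> g \<otimes>\<^bsub>G\<^esub> x) -` A \<inter> space M = g <#\<^bsub>G\<^esub> A"
    using sub assms(1)
    by (auto simp: l_coset_def subset_eq image_iff m_assoc[symmetric])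
  have "emeasure M A = emeasure (distr M M (\<lambda>x. inv\<^bsub>G\<^esub> g \<otimes>\<^bsub>G\<^esub> x)) A"
    by (simp add: distr_translation[OF ig])
  also have "\<dots> = emeasure M (g <#\<^bsub>G\<^esub> A)"
    by (subst emeasure_distr[OF translation_measurable[OF ig] assms(2)]) (simp only: eq)
  finally show ?thesis by simp
qed

text \<open>Regularity of finite Borel measures is available for Polish type classes only, so the measure
  is transported to sequences of reals.\<close>

lemma inner_regular_M:
  assumes "A \<in> sets M"
  shows "emeasure M A = (SUP K\<in>{K. compactin T K \<and> K \<subseteq> A}. emeasure M K)"
proof (rule antisym)
  define \<phi> :: "(nat \<Rightarrow> nat) \<Rightarrow> nat \<Rightarrow> real" where "\<phi> x i = real (x i)" for x i
  \<comment> \<open>Rounding inverts \<open>\<phi>\<close> on \<open>R\<close>. Its values off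
    \<open>R\<close> are arbitrary, so \<open>\<psi>\<close> is only used on the restriction to
    \<open>R\<close>.\<close>
  define \<psi> :: "(nat \<Rightarrow> real) \<Rightarrow> nat \<Rightarrow> nat" where "\<psi> y i = nat \<lfloor>y i\<rfloor>" for y i
  define R where "R = {y. \<forall>i. y i \<in> real ` carrier (F i)}"
  have \<psi>\<phi>: "\<psi> (\<phi> x) = x" for x by (auto simp: \<phi>_def \<psi>_def)
  have \<phi>\<psi>: "\<phi> (\<psi> y) = y" if "y \<in> R" for y
  proof
    fix i
    from that obtain a where "y i = real a" by (auto simp: R_def)
    then show "\<phi> (\<psi> y) i = y i" by (simp add: \<phi>_def \<psi>_def)
  qed
  have R1: "\<phi> x \<in> R" if "x \<in> carrier G" for x
    using that by (auto simp: R_def carrier_G \<phi>_def)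
  have R2: "\<psi> y \<in> carrier G" if "y \<in> R" for y
    unfolding carrier_G
  proof
    fix i
    from that obtain a where "y i = real a" "a \<in> carrier (F i)" by (auto simp: R_def)
    then show "\<psi> y i \<in> carrier (F i)" by (simp add: \<psi>_def)
  qed
  have "closed ((\<lambda>y::nat \<Rightarrow> real. y i) -` (real ` carrier (F i)))" for i
    by (rule closed_vimage) (auto intro: finite_imp_closed continuous_on_product_coordinates)
  then have "closed (\<Inter>i. (\<lambda>y. y i) -` (real ` carrier (F i)))"
    by auto
  also have "(\<Inter>i. (\<lambda>y. y i) -` (real ` carrier (F i))) = R"
    by (auto simp: R_def)
  finally have R: "R \<in> sets borel" by (rule borel_closed)
  have "\<phi> \<in> measurable M (PiM UNIV (\<lambda>_. borel))"
  proof (rule measurable_PiM_single)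
    fix B :: "real set" and i
    show "{x \<in> space M. \<phi> x i \<in> B} \<in> sets M"
      using cylinder_sets[of i "real -` B"] by (simp add: \<phi>_def)
  qed auto
  then have \<phi>: "\<phi> \<in> measurable M borel"
    using measurable_cong_sets[OF refl sets_PiM_equal_borel] by blast
  have "\<psi> \<in> measurable (restrict_space borel R) (PiM UNIV (\<lambda>i. uniform_count_measure (carrier (F i))))"
  proof (rule measurable_PiM_single)
    show "\<psi> \<in> space (restrict_space borel R) \<rightarrow> (\<Pi>\<^sub>E i\<in>UNIV. space (uniform_count_measure (carrier (F i))))"
      using R2 by (auto simp: carrier_G space_uniform_count_measure space_restrict_space)
    fix B :: "nat set" and i
    have "(\<lambda>y::nat \<Rightarrow> real. y i) -` (real ` (B \<inter> carrier (F i))) \<inter> R \<in> sets borel"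
      by (intro sets.Int R borel_closed closed_vimage)
        (auto intro: finite_imp_closed continuous_on_product_coordinates)
    moreover have "(\<lambda>y::nat \<Rightarrow> real. y i) -` (real ` (B \<inter> carrier (F i))) \<inter> R = {y \<in> R. \<psi> y i \<in> B}"
      by (force simp: R_def \<psi>_def)
    ultimately show "{y \<in> space (restrict_space borel R). \<psi> y i \<in> B} \<in> sets (restrict_space borel R)"
      using R by (simp add: sets_restrict_space_iff space_restrict_space)
  qed
  then have \<psi>: "\<psi> \<in> measurable (restrict_space borel R) M"
    by (simp add: M_def)
  define B where "B = \<psi> -` A \<inter> R"
  have "\<psi> -` A \<inter> space (restrict_space borel R) \<in> sets (restrict_space borel R)"
    by (rule measurable_sets[OF \<psi> assms])
  then have B: "B \<in> sets borel"
    using R by (simp add: sets_restrict_space_iff space_restrict_space B_def)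
  have Asub: "A \<subseteq> carrier G" using sets.sets_into_space[OF assms] by simp
  have "\<phi> -` B \<inter> space M = A"
    using Asub R1 by (auto simp: B_def \<psi>\<phi>)
  then have "emeasure M A = emeasure (distr M borel \<phi>) B"
    using B by (simp add: emeasure_distr[OF \<phi>])
  also have "\<dots> = (SUP K\<in>{K. K \<subseteq> B \<and> compact K}. emeasure (distr M borel \<phi>) K)"
  proof (rule inner_regular)
    show "emeasure (distr M borel \<phi>) (space (distr M borel \<phi>)) \<noteq> \<infinity>"
      using prob_space.emeasure_space_1[OF haar.prob_space_distr[OF \<phi>]] by simp
  qed (use B in auto)
  also have "\<dots> \<le> (SUP K\<in>{K. compactin T K \<and> K \<subseteq> A}. emeasure M K)"
  proof (rule SUP_mono)
    fix K assume "K \<in> {K. K \<subseteq> B \<and> compact K}"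
    then have K: "K \<subseteq> B" "compact K" by auto
    have "continuous_on K (\<lambda>y. \<psi> y i)" for i
    proof -
      have "continuous_on (real ` carrier (F i)) (\<lambda>r. nat \<lfloor>r\<rfloor>)"
        by (rule continuous_on_finite) simp
      moreover have "continuous_on K (\<lambda>y. y i)"
        by (rule continuous_on_subset[OF continuous_on_product_coordinates]) simp
      moreover have "(\<lambda>y. y i) ` K \<subseteq> real ` carrier (F i)"
        using K by (auto simp: B_def R_def)
      ultimately have "continuous_on K (\<lambda>y. nat \<lfloor>y i\<rfloor>)"
        by (rule continuous_on_compose2)
      then show ?thesis by (simp add: \<psi>_def)
    qed
    then have "continuous_on K \<psi>"
      by (rule continuous_on_coordinatewise_then_product)
    then have "compact (\<psi> ` K)"
      using K(2) by (rule compact_continuous_image)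
    moreover have sub: "\<psi> ` K \<subseteq> A" using K by (auto simp: B_def)
    ultimately have "compactin T (\<psi> ` K)"
      using Asub by (simp add: T_def compactin_subtopology)
    moreover have "\<phi> -` K \<inter> space M = \<psi> ` K"
      using K R2 by (force simp: B_def \<psi>\<phi> \<phi>\<psi> image_iff)
    then have "emeasure (distr M borel \<phi>) K = emeasure M (\<psi> ` K)"
      using K by (simp add: emeasure_distr[OF \<phi>] borel_compact)
    ultimately show "\<exists>K'\<in>{K. compactin T K \<and> K \<subseteq> A}. emeasure (distr M borel \<phi>) K \<le> emeasure M K'"
      using sub by auto
  qed
  finally show "emeasure M A \<le> (SUP K\<in>{K. compactin T K \<and> K \<subseteq> A}. emeasure M K)" .
  show "(SUP K\<in>{K. compactin T K \<and> K \<subseteq> A}. emeasure M K) \<le> emeasure M A"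
    using assms by (intro SUP_least emeasure_mono) auto
qed

lemma haar_M: "normalized_haar_measure G T M"
  using sets_M left_invariant inner_regular_M haar.prob_space_axioms
  by (auto simp: normalized_haar_measure_def T_def)


section \<open>Closed subgroups of a product of perfect groups\<close>

lemma subgroup_G_closure:
  assumes "subgroup H G" "closedin T H" "y \<in> carrier G"
    and "\<And>J. finite J \<Longrightarrow> \<exists>h\<in>H. \<forall>j\<in>J. h j = y j"
  shows "y \<in> H"
proof (rule ccontr)
  assume "y \<notin> H"
  have "openin T (carrier G - H)"
    using assms(2) by (simp add: closedin_def T_def)
  then obtain V where V: "open V" "carrier G - H = carrier G \<inter> V"
    by (auto simp: T_def openin_open)
  have "y \<in> V" using V(2) assms(3) \<open>y \<notin> H\<close> by auto
  then obtain W where W: "y \<in> Pi\<^sub>E UNIV W" "\<And>i. open (W i)" "finite {i. W i \<noteq> UNIV}" "Pi\<^sub>E UNIV W \<subseteq> V"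
    using product_topology_open_contains_basis[of "\<lambda>_. euclidean" UNIV V y] V(1)
    by (auto simp: open_fun_def)
  from assms(4)[OF W(3)] obtain h where h: "h \<in> H" "\<And>j. W j \<noteq> UNIV \<Longrightarrow> h j = y j"
    by auto
  have "h \<in> Pi\<^sub>E UNIV W"
    using W(1) h(2) by (force simp: PiE_iff)
  then have "h \<in> V" using W(4) by auto
  then show False
    using V(2) h(1) subgroup.subset[OF assms(1)] by auto
qed

text \<open>For perfect factors, surjectivity onto any two coordinates implies surjectivity onto any
  finite set of them: commutators combine triviality at one coordinate with triviality at others.
  Closedness then turns density into equality.\<close>

lemma eq_carrier_of_pairs:
  assumes H: "subgroup H G" "closedin T H"
    and perfect: "\<And>i. derived (F i) (carrier (F i)) = carrier (F i)"
    and pairs: "\<And>i j a b. i \<noteq> j \<Longrightarrow> a \<in> carrier (F i) \<Longrightarrow> b \<in> carrier (F j) \<Longrightarrow>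
      \<exists>h\<in>H. h i = a \<and> h j = b"
  shows "H = carrier G"
proof -
  interpret H: subgroup H G by fact
  have Hc: "h \<in> H \<Longrightarrow> h i \<in> carrier (F i)" for h i
    using H.mem_carrier by (simp add: carrier_G)
  have Hinv: "h \<in> H \<Longrightarrow> (inv\<^bsub>G\<^esub> h) i = inv\<^bsub>F i\<^esub> (h i)" for h i
    by (simp add: H.mem_carrier)
  have single: "\<exists>h\<in>H. h i = a \<and> (\<forall>j\<in>J. h j = \<one>\<^bsub>F j\<^esub>)"
    if "finite J" "i \<notin> J" "a \<in> carrier (F i)" for i J a
    using that
  proof (induction J arbitrary: a rule: finite_induct)
    case empty
    then show ?case using pairs[of i "Suc i" a "\<one>\<^bsub>F (Suc i)\<^esub>"] by auto
  next
    case (insert k J)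
    interpret Fi: group "F i" by simp
    interpret Fk: group "F k" by simp
    let ?S = "{h i | h. h \<in> H \<and> (\<forall>j\<in>insert k J. h j = \<one>\<^bsub>F j\<^esub>)}"
    have "?S = carrier (F i)"
    proof (rule eq_carrier_of_commutators[OF group_F _ perfect])
      show "subgroup ?S (F i)"
      proof (rule Fi.subgroupI)
        show "?S \<subseteq> carrier (F i)" using Hc by auto
        have "\<one>\<^bsub>G\<^esub> i \<in> ?S" using H.one_closed one_G by blast
        then show "?S \<noteq> {}" by blast
        fix a assume "a \<in> ?S"
        then obtain h where h: "a = h i" "h \<in> H" "\<forall>j\<in>insert k J. h j = \<one>\<^bsub>F j\<^esub>" by blast
        have "inv\<^bsub>F j\<^esub> \<one>\<^bsub>F j\<^esub> = \<one>\<^bsub>F j\<^esub>" for j by (simp add: monoid.inv_one group.is_monoid)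
        then show "inv\<^bsub>F i\<^esub> a \<in> ?S"
          using h by (intro CollectI exI[of _ "inv\<^bsub>G\<^esub> h"]) (simp add: Hinv)
        fix b assume "b \<in> ?S"
        then obtain h' where h': "b = h' i" "h' \<in> H" "\<forall>j\<in>insert k J. h' j = \<one>\<^bsub>F j\<^esub>" by blast
        have "\<one>\<^bsub>F j\<^esub> \<otimes>\<^bsub>F j\<^esub> \<one>\<^bsub>F j\<^esub> = \<one>\<^bsub>F j\<^esub>" for j by (simp add: monoid.r_one group.is_monoid)
        then show "a \<otimes>\<^bsub>F i\<^esub> b \<in> ?S"
          using h h' by (intro CollectI exI[of _ "h \<otimes>\<^bsub>G\<^esub> h'"]) simp
      qed
    next
      fix a b assume ab: "a \<in> carrier (F i)" "b \<in> carrier (F i)"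
      \<comment> \<open>The commutator of \<open>u\<close>, trivial at \<open>k\<close>, and
        \<open>v\<close>, trivial on \<open>J\<close>, is trivial on all of
        \<open>insert k J\<close>, while its \<open>i\<close>-th coordinate is the commutator of
        \<open>a\<close> and \<open>b\<close>. In a perfect group these values generate
        everything.\<close>
      obtain u where u: "u \<in> H" "u i = a" "u k = \<one>\<^bsub>F k\<^esub>"
        using pairs[of i k a "\<one>\<^bsub>F k\<^esub>"] ab insert.prems by auto
      obtain v where v: "v \<in> H" "v i = b" "\<forall>j\<in>J. v j = \<one>\<^bsub>F j\<^esub>"
        using insert.IH[of b] ab insert.prems by auto
      let ?w = "u \<otimes>\<^bsub>G\<^esub> v \<otimes>\<^bsub>G\<^esub> inv\<^bsub>G\<^esub> u \<otimes>\<^bsub>G\<^esub> inv\<^bsub>G\<^esub> v"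
      have "?w j = \<one>\<^bsub>F j\<^esub>" if "j \<in> insert k J" for j
      proof -
        interpret Fj: group "F j" by simp
        show ?thesis
          using that u v Hc[OF u(1), of j] Hc[OF v(1), of j] by (auto simp: Hinv)
      qed
      then show "a \<otimes>\<^bsub>F i\<^esub> b \<otimes>\<^bsub>F i\<^esub> inv\<^bsub>F i\<^esub> a \<otimes>\<^bsub>F i\<^esub> inv\<^bsub>F i\<^esub> b \<in> ?S"
        using u v by (intro CollectI exI[of _ ?w]) (simp add: Hinv)
    qed
    then have "a \<in> ?S" using insert.prems(2) by (simp only:)
    then obtain h where "h \<in> H" "h i = a" "\<forall>j\<in>insert k J. h j = \<one>\<^bsub>F j\<^esub>" by blast
    then show ?case by blast
  qed
  have "y \<in> H" if y: "y \<in> carrier G" for y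
  proof (rule subgroup_G_closure[OF H y])
    fix J :: "nat set" assume "finite J"
    then show "\<exists>h\<in>H. \<forall>j\<in>J. h j = y j"
    proof (induction J rule: finite_induct)
      case empty
      then show ?case using H.one_closed by blast
    next
      case (insert k J)
      then obtain h where h: "h \<in> H" "\<forall>j\<in>J. h j = y j" by auto
      interpret Fk: group "F k" by simp
      have "y k \<in> carrier (F k)" using y by (simp add: carrier_G)
      then have "inv\<^bsub>F k\<^esub> (h k) \<otimes>\<^bsub>F k\<^esub> y k \<in> carrier (F k)"
        using Hc[OF h(1)] by auto
      \<comment> \<open>The factor \<open>z\<close> corrects the coordinate \<open>k\<close> of
        \<open>h\<close> and leaves the coordinates in \<open>J\<close> alone.\<close>
      with single[OF insert.hyps(1,2)] obtain z where
        z: "z \<in> H" "z k = inv\<^bsub>F k\<^esub> (h k) \<otimes>\<^bsub>F k\<^esub> y k" "\<forall>j\<in>J. z j = \<one>\<^bsub>F j\<^esub>" by blast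
      have "(h \<otimes>\<^bsub>G\<^esub> z) k = y k"
        using Hc[OF h(1), of k] \<open>y k \<in> _\<close> by (simp add: z Fk.m_assoc[symmetric])
      moreover have "(h \<otimes>\<^bsub>G\<^esub> z) j = y j" if "j \<in> J" for j
        using that h(2) z(3) Hc[OF h(1), of j] by (simp add: monoid.r_one group.is_monoid)
      ultimately show ?case
        using h(1) z(1) by (intro bexI[of _ "h \<otimes>\<^bsub>G\<^esub> z"]) auto
    qed
  qed
  then show ?thesis using H.subset by auto
qed

text \<open>The elements whose \<open>i\<close>-th coordinate lies in \<open>S\<close> form a closed
  subgroup, because each coordinate is a continuous map to a discrete space.\<close>

lemma top_generate_coordinate:
  assumes "Y \<subseteq> carrier G" "subgroup S (F i)" "\<And>y. y \<in> Y \<Longrightarrow> y i \<in> S"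
    and "top_generate G T Y = carrier G"
  shows "S = carrier (F i)"
proof -
  let ?H = "{x \<in> carrier G. x i \<in> S}"
  interpret G: group G by simp
  interpret S: subgroup S "F i" by fact
  have "subgroup ?H G"
  proof (rule G.subgroupI)
    show "?H \<noteq> {}" using G.one_closed by force
  qed auto
  moreover have "closedin T ?H"
  proof -
    have "closed ((\<lambda>x::nat \<Rightarrow> nat. x i) -` S)"
      by (rule closed_vimage[OF _ continuous_on_product_coordinates])
        (simp add: closed_def Topological_Spaces.open_discrete)
    moreover have "?H = carrier G \<inter> (\<lambda>x. x i) -` S" by auto
    ultimately show ?thesis by (auto simp: T_def closedin_closed)
  qed
  ultimately have "top_generate G T Y \<subseteq> ?H"
    unfolding top_generate_def using assms(1,3) by (intro hull_minimal) auto
  then have all: "x i \<in> S" if "x \<in> carrier G" for x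
    using assms(4) that by auto
  show ?thesis
  proof (rule subset_antisym[OF S.subset], rule subsetI)
    fix a assume "a \<in> carrier (F i)"
    then have "(\<lambda>j. \<one>\<^bsub>F j\<^esub>)(i := a) \<in> carrier G" by (auto simp: carrier_G)
    from all[OF this] show "a \<in> S" by simp
  qed
qed

end

section \<open>Expected generation times\<close>

lemma nn_integral_eq_top_of_AE_ge:
  fixes f :: "'a \<Rightarrow> ennreal"
  assumes "prob_space M" and "\<And>d::nat. AE x in M. of_nat d \<le> f x"
  shows "(\<integral>\<^sup>+ x. f x \<partial>M) = \<infinity>"
proof -
  interpret prob_space M by fact
  have "of_nat d \<le> (\<integral>\<^sup>+ x. f x \<partial>M)" for d
  proof -
    have "of_nat d = (\<integral>\<^sup>+ x. of_nat d \<partial>M)" by (simp add: emeasure_space_1)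
    also have "\<dots> \<le> (\<integral>\<^sup>+ x. f x \<partial>M)"
      by (rule nn_integral_mono_AE[OF assms(2)])
    finally show ?thesis .
  qed
  then have "(SUP d. of_nat d) \<le> (\<integral>\<^sup>+ x. f x \<partial>M)"
    by (rule SUP_least)
  then show ?thesis
    by (simp add: ennreal_SUP_of_nat_eq_top top_unique)
qed

context finite_groups begin

sublocale seq: product_prob_space "\<lambda>_::nat. M" UNIV
  by (rule product_prob_spaceI) (rule haar.prob_space_axioms)

lemma generation_time_le:
  assumes "Y \<subseteq> carrier G" "top_generate G T (insert (x j) Y) = carrier G" "\<And>i. x i \<in> carrier G"
  shows "generation_time G T Y x \<le> enat (Suc j)"
proof -
  have "carrier G \<subseteq> top_generate G T (Y \<union> x ` {..<Suc j})"
    unfolding assms(2)[symmetric] top_generate_def by (rule hull_mono) auto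
  moreover have "top_generate G T (Y \<union> x ` {..<Suc j}) \<subseteq> carrier G"
    unfolding top_generate_def
    by (rule hull_minimal) (use assms in \<open>auto intro: group.subgroup_self simp: T_def\<close>)
  ultimately show ?thesis
    unfolding generation_time_def by (intro Inf_lower) auto
qed

text \<open>One term outside \<open>B\<close> already generates together with \<open>Y\<close>, so
  the generation time is at most the index of the first such term. Its tail events
  \<open>E d\<close>, that the first \<open>d\<close> terms all lie in \<open>B\<close>, have
  probability at most \<open>q ^ d\<close>, and the geometric series sums to the bound.\<close>

lemma expected_generation_time_le:
  assumes "Y \<subseteq> carrier G" "B \<in> sets M" "emeasure M B \<le> ennreal q" "0 \<le> q" "q < 1"
    and "\<And>x. x \<in> carrier G - B \<Longrightarrow> top_generate G T (insert x Y) = carrier G"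
  shows "expected_generation_time G T M Y \<le> ennreal (1 / (1 - q))"
proof -
  let ?P = "PiM UNIV (\<lambda>_::nat. M)"
  define E where "E d = {x \<in> space ?P. \<forall>j\<in>{..<d}. x j \<in> B}" for d
  have E: "E d \<in> sets ?P" for d
    unfolding E_def using assms(2) by measurable
  have ind: "ennreal_of_enat (generation_time G T Y x) \<le> suminf (\<lambda>d. indicator (E d) x)"
    if x: "x \<in> space ?P" for x
  proof (cases "\<forall>j. x j \<in> B")
    case True
    then have "suminf (\<lambda>d. indicator (E d) x) = suminf (\<lambda>d::nat. 1::ennreal)"
      using x by (intro suminf_cong) (auto simp: E_def indicator_def)
    also have "\<dots> = \<infinity>"
      by (simp add: suminf_eq_SUP ennreal_SUP_of_nat_eq_top)
    finally show ?thesis by simp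
  next
    case False
    define j where "j = (LEAST j. x j \<notin> B)"
    have j: "x j \<notin> B" unfolding j_def by (rule LeastI_ex) (use False in auto)
    have less: "x i \<in> B" if "i < j" for i
      using not_less_Least[of i "\<lambda>j. x j \<notin> B"] that by (auto simp: j_def)
    have xc: "x i \<in> carrier G" for i
      using x by (auto simp: space_PiM)
    have "ennreal_of_enat (generation_time G T Y x) \<le> ennreal_of_enat (enat (Suc j))"
      using generation_time_le[OF assms(1) assms(6), of x j] xc j
      by (simp add: ennreal_of_enat_le_iff del: ennreal_of_enat_enat)
    \<comment> \<open>As \<open>x j\<close> is the first term outside \<open>B\<close>, each
      \<open>E d\<close> with \<open>d \<le> j\<close> holds, including the trivially true
      \<open>E 0\<close>; this gives \<open>Suc j\<close> ones.\<close>
    also have "\<dots> = (\<Sum>d<Suc j. indicator (E d) x)"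
      using x less by (simp add: E_def indicator_def less_Suc_eq_le)
    also have "\<dots> \<le> suminf (\<lambda>d. indicator (E d) x)"
      by (rule sum_le_suminf) auto
    finally show ?thesis .
  qed
  have "emeasure ?P (E d) \<le> ennreal (q ^ d)" for d
  proof -
    have "emeasure ?P (E d) = (\<Prod>j\<in>{..<d}. emeasure M B)"
      unfolding E_def by (rule seq.emeasure_PiM_Collect) (use assms(2) in auto)
    also have "\<dots> = emeasure M B ^ d" by simp
    also have "\<dots> \<le> ennreal q ^ d" by (rule power_mono[OF assms(3)]) simp
    finally show ?thesis using assms(4) by (simp add: ennreal_power)
  qed
  then have "suminf (\<lambda>d. emeasure ?P (E d)) \<le> suminf (\<lambda>d. ennreal (q ^ d))"
    by (intro suminf_le) auto
  also have "\<dots> = ennreal (1 / (1 - q))"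
    using assms(4,5) by (subst suminf_ennreal_eq[OF _ geometric_sums]) auto
  finally have le: "suminf (\<lambda>d. emeasure ?P (E d)) \<le> ennreal (1 / (1 - q))" .
  have "expected_generation_time G T M Y \<le> (\<integral>\<^sup>+ x. suminf (\<lambda>d. indicator (E d) x) \<partial>?P)"
    unfolding expected_generation_time_def by (rule nn_integral_mono) (rule ind)
  also have "\<dots> = suminf (\<lambda>d. emeasure ?P (E d))"
    using E by (subst nn_integral_suminf) auto
  finally show ?thesis using le by simp
qed

text \<open>The measure on sequences groups the variables by the position \<open>j\<close> in the
  sequence, whereas capture by a subgroup in the factor \<open>i\<close> concerns all positions at
  one \<open>i\<close>. Joint independence over the pairs \<open>(j, i)\<close> permits
  regrouping.\<close>

lemma indep_coordinates:
  "seq.indep_vars (\<lambda>(j, i). uniform_count_measure (carrier (F i))) (\<lambda>(j, i) x. x j i) UNIV"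
proof -
  let ?U = "\<lambda>i. uniform_count_measure (carrier (F i))"
  let ?P = "PiM UNIV (\<lambda>_::nat. M)"
  have meas: "(\<lambda>x. x j i) \<in> measurable ?P (?U i)" for j i
  proof -
    have "(\<lambda>y. y i) \<in> measurable M (?U i)"
      unfolding M_def by (rule measurable_component_singleton) simp
    then show ?thesis
      by (rule measurable_compose[rotated]) (rule measurable_component_singleton, simp)
  qed
  show ?thesis
    unfolding seq.indep_vars_def2
  proof (intro conjI ballI, goal_cases)
    case (1 k)
    then show ?case using meas by (simp add: case_prod_beta)
  next
    case 2
    show ?case
    proof (rule seq.indep_setsI, goal_cases)
      case (1 k)
      then show ?case using meas by (auto simp: case_prod_beta intro: measurable_sets)
    next
      case (2 A J)
      note \<open>finite J\<close> [simp]
      have "\<forall>k\<in>J. \<exists>B. B \<subseteq> carrier (F (snd k)) \<and> A k = {x \<in> space ?P. x (fst k) (snd k) \<in> B}"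
      proof
        fix k assume "k \<in> J"
        with 2(4) obtain B where "A k = (case k of (j, i) \<Rightarrow> \<lambda>x. x j i) -` B \<inter> space ?P"
          "B \<in> sets (case k of (j, i) \<Rightarrow> ?U i)" by blast
        then have "B \<subseteq> carrier (F (snd k))" "A k = {x \<in> space ?P. x (fst k) (snd k) \<in> B}"
          by (auto simp: sets_uniform_count_measure case_prod_beta)
        then show "\<exists>B. B \<subseteq> carrier (F (snd k)) \<and> A k = {x \<in> space ?P. x (fst k) (snd k) \<in> B}"
          by blast
      qed
      then obtain B where "\<forall>k\<in>J. B k \<subseteq> carrier (F (snd k)) \<and>
          A k = {x \<in> space ?P. x (fst k) (snd k) \<in> B k}"
        by (rule bchoice[THEN exE])
      then have B: "\<And>k. k \<in> J \<Longrightarrow> B k \<subseteq> carrier (F (snd k))"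
        "\<And>k. k \<in> J \<Longrightarrow> A k = {x \<in> space ?P. x (fst k) (snd k) \<in> B k}" by simp_all
      have B1: "B (j, i) \<subseteq> carrier (F i)" if "(j, i) \<in> J" for j i
        using B(1)[OF that] by simp
      \<comment> \<open>All conditions on the \<open>j\<close>-th term are collected first, so that
        the product over \<open>j\<close> and then the product over the factors \<open>i\<close> can
        be evaluated.\<close>
      define C where "C j = {y \<in> carrier G. \<forall>i\<in>{i. (j, i) \<in> J}. y i \<in> B (j, i)}" for j
      have finJ: "finite {i. (j, i) \<in> J}" for j
        using finite_imageI[OF \<open>finite J\<close>, of snd] by (rule finite_subset[rotated]) force
      have C: "C j \<in> sets M" for j
        unfolding C_def prod_emb_cylinder[symmetric, of "{i. (j, i) \<in> J}" "\<lambda>i. B (j, i)"] M_def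
        by (rule sets_PiM_I) (use finJ B1 in \<open>auto simp: sets_uniform_count_measure\<close>)
      have mC: "emeasure M (C j) = (\<Prod>i\<in>{i. (j, i) \<in> J}. ennreal (card (B (j, i)) / order (F i)))" for j
        unfolding C_def by (rule emeasure_cylinder) (use finJ B1 in auto)
      have one: "emeasure ?P (A k) = ennreal (card (B k) / order (F (snd k)))" if "k \<in> J" for k
      proof -
        have "A k = {x \<in> space ?P. \<forall>j\<in>{fst k}. x j \<in> {y \<in> carrier G. \<forall>i\<in>{snd k}. y i \<in> B k}}"
          using B(2)[OF that] by (auto simp: space_PiM)
        also have "emeasure ?P \<dots> = (\<Prod>j\<in>{fst k}. emeasure M {y \<in> carrier G. \<forall>i\<in>{snd k}. y i \<in> B k})"
          by (rule seq.emeasure_PiM_Collect) (use cylinder_sets in auto)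
        also have "\<dots> = ennreal (card (B k) / order (F (snd k)))"
          using B(1)[OF that] by (subst emeasure_cylinder) auto
        finally show ?thesis .
      qed
      have "(\<Inter>k\<in>J. A k) = {x \<in> space ?P. \<forall>j\<in>fst ` J. x j \<in> C j}"
        using B(2) \<open>J \<noteq> {}\<close> by (force simp: C_def space_PiM)
      also have "emeasure ?P \<dots> = (\<Prod>j\<in>fst ` J. emeasure M (C j))"
        by (rule seq.emeasure_PiM_Collect) (use \<open>finite J\<close> C in auto)
      also have "\<dots> = (\<Prod>j\<in>fst ` J. \<Prod>i\<in>{i. (j, i) \<in> J}. ennreal (card (B (j, i)) / order (F i)))"
        by (simp add: mC)
      also have "\<dots> = (\<Prod>k\<in>Sigma (fst ` J) (\<lambda>j. {i. (j, i) \<in> J}). ennreal (card (B k) / order (F (snd k))))"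
        using \<open>finite J\<close> finJ by (subst prod.Sigma) (auto simp: case_prod_beta)
      also have "Sigma (fst ` J) (\<lambda>j. {i. (j, i) \<in> J}) = J" by force
      also have "(\<Prod>k\<in>J. ennreal (card (B k) / order (F (snd k)))) = (\<Prod>k\<in>J. emeasure ?P (A k))"
        by (simp add: one)
      finally have "emeasure ?P (\<Inter>k\<in>J. A k) = (\<Prod>k\<in>J. emeasure ?P (A k))" .
      then show ?case
        by (simp add: seq.emeasure_eq_measure prod_ennreal ennreal_inj prod_nonneg)
    qed
  qed
qed


text \<open>The index sets \<open>K i\<close> are disjoint, so for distinct \<open>i\<close> the
  events that the first \<open>d\<close> terms have their \<open>i\<close>-th coordinates in
  \<open>S i\<close> are independent, each with probability the \<open>d\<close>-th power of the
  density of \<open>S i\<close>.\<close>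

lemma prob_no_common_coordinate:
  assumes J: "finite J" "J \<noteq> {}" and S: "\<And>i. i \<in> J \<Longrightarrow> S i \<subseteq> carrier (F i)"
  shows "seq.prob {x \<in> space (PiM UNIV (\<lambda>_::nat. M)). \<forall>i\<in>J. \<not> (\<forall>j<d. x j i \<in> S i)} =
    (\<Prod>i\<in>J. 1 - (card (S i) / order (F i)) ^ d)"
proof -
  let ?U = "\<lambda>i. uniform_count_measure (carrier (F i))"
  let ?P = "PiM UNIV (\<lambda>_::nat. M)"
  define K where "K i = {..<d} \<times> {i}" for i :: nat
  define R where "R i x = (\<lambda>k\<in>K i. x (fst k) (snd k))" for i and x :: "nat \<Rightarrow> nat \<Rightarrow> nat"
  have "seq.indep_vars (\<lambda>i. PiM (K i) (\<lambda>(j, i). ?U i))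
      (\<lambda>i x. restrict (\<lambda>k. (case k of (j, i) \<Rightarrow> \<lambda>x. x j i) x) (K i)) J"
    by (rule seq.indep_vars_restrict[OF indep_coordinates]) (auto simp: disjoint_family_on_def K_def)
  then have ind: "seq.indep_vars (\<lambda>i. PiM (K i) (\<lambda>(j, i). ?U i)) R J"
    by (simp add: R_def[abs_def] case_prod_beta)
  define B where "B i = Pi\<^sub>E (K i) (\<lambda>(j, i). S i)" for i
  have spU: "space (PiM (K i) (\<lambda>(j, i). ?U i)) = Pi\<^sub>E (K i) (\<lambda>(j, i). carrier (F i))" for i
    by (simp add: space_PiM split_def space_uniform_count_measure)
  have B: "B i \<in> sets (PiM (K i) (\<lambda>(j, i). ?U i))" if "i \<in> J" for i
    unfolding B_def by (rule sets_PiM_I_finite)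
      (use S[OF that] in \<open>auto simp: K_def sets_uniform_count_measure\<close>)
  have Riff: "R i x \<in> B i \<longleftrightarrow> (\<forall>j<d. x j i \<in> S i)" for i x
    by (auto simp: R_def B_def K_def PiE_iff)
  have R: "seq.random_variable (PiM (K i) (\<lambda>(j, i). ?U i)) (R i)" if "i \<in> J" for i
    using ind that by (simp add: seq.indep_vars_def2)
  have pB: "seq.prob {x \<in> space ?P. \<forall>j<d. x j i \<in> S i} = (card (S i) / order (F i)) ^ d"
    if i: "i \<in> J" for i
  proof -
    have "{x \<in> space ?P. \<forall>j<d. x j i \<in> S i} =
        {x \<in> space ?P. \<forall>j\<in>{..<d}. x j \<in> {y \<in> carrier G. \<forall>i\<in>{i}. y i \<in> S i}}"
      by (auto simp: space_PiM)
    also have "emeasure ?P \<dots> = (\<Prod>j\<in>{..<d}. emeasure M {y \<in> carrier G. \<forall>i\<in>{i}. y i \<in> S i})"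
      by (rule seq.emeasure_PiM_Collect) (use cylinder_sets in auto)
    also have "\<dots> = ennreal (card (S i) / order (F i)) ^ d"
      using S[OF i] by (subst emeasure_cylinder) auto
    finally show ?thesis
      by (simp add: seq.emeasure_eq_measure ennreal_power)
  qed
  have one: "seq.prob (R i -` (space (PiM (K i) (\<lambda>(j, i). ?U i)) - B i) \<inter> space ?P) =
      1 - (card (S i) / order (F i)) ^ d" if i: "i \<in> J" for i
  proof -
    have "R i -` (space (PiM (K i) (\<lambda>(j, i). ?U i)) - B i) \<inter> space ?P =
        space ?P - (R i -` B i \<inter> space ?P)"
      using measurable_space[OF R[OF i]] by auto
    moreover have "R i -` B i \<inter> space ?P = {x \<in> space ?P. \<forall>j<d. x j i \<in> S i}"
      using Riff by auto
    ultimately show ?thesis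
      using seq.prob_compl[OF measurable_sets[OF R[OF i] B[OF i]]] pB[OF i] by simp
  qed
  have "{x \<in> space ?P. \<forall>i\<in>J. \<not> (\<forall>j<d. x j i \<in> S i)} =
      (\<Inter>i\<in>J. R i -` (space (PiM (K i) (\<lambda>(j, i). ?U i)) - B i) \<inter> space ?P)"
    using J(2) measurable_space[OF R] Riff by auto
  also have "seq.prob \<dots> =
      (\<Prod>i\<in>J. seq.prob (R i -` (space (PiM (K i) (\<lambda>(j, i). ?U i)) - B i) \<inter> space ?P))"
    by (rule seq.indep_varsD[OF ind J(2,1)]) (use B in auto)
  finally show ?thesis by (simp add: one)
qed

text \<open>If the generation time is below \<open>d\<close>, then no proper subgroup
  \<open>S i\<close> captures the first \<open>d\<close> terms, so the sequence lies in every
  \<open>E m\<close>. By \<open>lim\<close> the probabilities of the \<open>E m\<close> tend to 0,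
  and their intersection is a null set.\<close>

lemma expected_generation_time_infinite:
  assumes S: "\<And>i. subgroup (S i) (F i)" "\<And>i. S i \<noteq> carrier (F i)"
    and J: "\<And>m. finite (J m)" "\<And>m. J m \<noteq> {}"
    and lim: "\<And>d. (\<lambda>m. \<Prod>i\<in>J m. 1 - (card (S i) / order (F i)) ^ d) \<longlonglongrightarrow> 0"
  shows "expected_generation_time G T M {} = \<infinity>"
  unfolding expected_generation_time_def
proof (rule nn_integral_eq_top_of_AE_ge)
  let ?P = "PiM UNIV (\<lambda>_::nat. M)"
  show "prob_space ?P"
    by (rule prob_space_PiM) (rule haar.prob_space_axioms)
  have S': "S i \<subseteq> carrier (F i)" for i
    using S(1) by (rule subgroup.subset)
  fix d :: nat
  define E where "E m = {x \<in> space ?P. \<forall>i\<in>J m. \<not> (\<forall>j<d. x j i \<in> S i)}" for m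
  have meas: "Measurable.pred ?P (\<lambda>x. x j i \<in> S i)" for i j
  proof -
    have "(\<lambda>x. x j) \<in> measurable ?P M" by (rule measurable_component_singleton) simp
    moreover have "{y \<in> space M. y i \<in> S i} \<in> sets M" using cylinder_sets by simp
    ultimately show ?thesis
      by (intro measurable_compose[of _ ?P M "\<lambda>y. y i \<in> S i"]) (auto simp: pred_def)
  qed
  have "seq.prob (\<Inter>m. E m) \<le> seq.prob (E m)" for m
  proof (rule seq.finite_measure_mono)
    show "E m \<in> seq.events"
      unfolding E_def using J(1) meas by measurable
  qed auto
  moreover have "seq.prob (E m) = (\<Prod>i\<in>J m. 1 - (card (S i) / order (F i)) ^ d)" for m
    unfolding E_def by (rule prob_no_common_coordinate) (use J S' in auto)
  ultimately have "seq.prob (\<Inter>m. E m) \<le> 0"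
    by (intro LIMSEQ_le_const[OF lim[of d]]) auto
  then have "seq.prob (\<Inter>m. E m) = 0"
    using measure_nonneg by (rule antisym)
  then have null: "emeasure ?P (\<Inter>m. E m) = 0"
    by (simp add: seq.emeasure_eq_measure)
  show "AE x in ?P. of_nat d \<le> ennreal_of_enat (generation_time G T {} x)"
  proof (rule AE_I)
    show "emeasure ?P (\<Inter>m. E m) = 0" by (rule null)
    show "(\<Inter>m. E m) \<in> sets ?P"
      unfolding E_def using J(1) meas by measurable
    show "{x \<in> space ?P. \<not> of_nat d \<le> ennreal_of_enat (generation_time G T {} x)} \<subseteq> (\<Inter>m. E m)"
    proof clarify
      fix x m assume x: "x \<in> space ?P" and small: "\<not> of_nat d \<le> ennreal_of_enat (generation_time G T {} x)"
      have xc: "x j \<in> carrier G" for j using x by (auto simp: space_PiM)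
      have "\<not> ennreal_of_enat (enat d) \<le> ennreal_of_enat (generation_time G T {} x)"
        using small by simp
      then have "generation_time G T {} x < enat d"
        by (simp add: ennreal_of_enat_le_iff not_le del: ennreal_of_enat_enat)
      then obtain n where n: "n < d" "top_generate G T (x ` {..<n}) = carrier G"
        unfolding generation_time_def Inf_less_iff by auto
      have "\<not> (\<forall>j<d. x j i \<in> S i)" for i
      proof
        assume "\<forall>j<d. x j i \<in> S i"
        then have "S i = carrier (F i)"
          using n xc by (intro top_generate_coordinate[OF _ S(1) _ n(2)]) auto
        then show False using S(2) by blast
      qed
      then show "x \<in> E m" using x by (simp add: E_def)
    qed
  qed
qed

end

section \<open>Three-cycles\<close>

text \<open>For distinct points this is the cycle from \<open>a\<close> to \<open>b\<close> to
  \<open>c\<close> to \<open>a\<close>. The body is what \<open>cycle_of_list [a, b, c]\<close>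
  unfolds to, which connects it to the generators \<open>three_cycles n\<close> of the alternating
  group.\<close>

definition three_cycle :: "'a \<Rightarrow> 'a \<Rightarrow> 'a \<Rightarrow> 'a \<Rightarrow> 'a" where
  "three_cycle a b c = Transposition.transpose a b \<circ> Transposition.transpose b c"

lemma three_cycle_apply:
  assumes "distinct [a, b, c]"
  shows "three_cycle a b c a = b" "three_cycle a b c b = c" "three_cycle a b c c = a"
    "w \<noteq> a \<Longrightarrow> w \<noteq> b \<Longrightarrow> w \<noteq> c \<Longrightarrow> three_cycle a b c w = w"
  using assms by (auto simp: three_cycle_def Transposition.transpose_def)

lemma three_cycle_rotate:
  "distinct [a, b, c] \<Longrightarrow> three_cycle a b c = three_cycle b c a"
  by (auto simp: three_cycle_def Transposition.transpose_def fun_eq_iff)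

lemma bij_three_cycle: "bij (three_cycle a b c)"
  by (simp add: three_cycle_def bij_comp)

lemma inv_three_cycle: "inv' (three_cycle a b c) = three_cycle c b a"
  by (rule inv_unique_comp) (auto simp: three_cycle_def fun_eq_iff transpose_commute)

lemma conj_three_cycle:
  assumes "bij h"
  shows "h \<circ> three_cycle a b c \<circ> inv' h = three_cycle (h a) (h b) (h c)"
proof
  fix x
  have "h (three_cycle a b c y) = three_cycle (h a) (h b) (h c) (h y)" for y
    using bij_is_inj[OF assms] by (simp add: three_cycle_def Transposition.transpose_def inj_eq)
  then show "(h \<circ> three_cycle a b c \<circ> inv' h) x = three_cycle (h a) (h b) (h c) x"
    using assms by (simp add: bij_inv_eq_iff surj_f_inv_f bij_is_surj)
qed

text \<open>Two permutations whose supports meet in the single point \<open>z\<close> commute up to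
  a 3-cycle through \<open>z\<close>; this is the source of all 3-cycles below.\<close>

lemma commutator_three_cycle:
  assumes "bij u" "bij v" "u z \<noteq> z" "v z \<noteq> z" and fixed: "\<And>w. w \<noteq> z \<Longrightarrow> u w = w \<or> v w = w"
  shows "u \<circ> v \<circ> inv' u \<circ> inv' v = three_cycle z (u z) (v z)" "distinct [z, u z, v z]"
proof -
  have ueq: "u x = u y \<longleftrightarrow> x = y" and veq: "v x = v y \<longleftrightarrow> x = y" for x y
    using assms(1,2) by (simp_all add: bij_is_inj inj_eq)
  \<comment> \<open>By injectivity \<open>u\<close> moves \<open>u z\<close>, and \<open>u z\<close>
    differs from the only common moved point \<open>z\<close>, so \<open>v\<close> fixes it;
    symmetrically for \<open>uv\<close>.\<close>
  have vu: "v (u z) = u z" using fixed[of "u z"] assms(3) ueq by auto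
  have uv: "u (v z) = v z" using fixed[of "v z"] assms(4) veq by auto
  show dist: "distinct [z, u z, v z]"
    using assms(3,4) vu veq by auto
  have "u (v w) = three_cycle z (u z) (v z) (v (u w))" for w
  proof (cases "w = z")
    case True
    then show ?thesis using three_cycle_apply[OF dist] by (simp add: vu uv)
  next
    case False
    show ?thesis
    proof (cases "u w = w")
      case True
      show ?thesis
      proof (cases "v w = z")
        case True
        then show ?thesis using \<open>u w = w\<close> three_cycle_apply[OF dist] by simp
      next
        case False
        have "u (v w) = v w" using fixed[OF False] veq True by metis
        moreover have "v w \<noteq> v z" "v w \<noteq> u z" using \<open>w \<noteq> z\<close> vu veq True ueq by metis+
        ultimately show ?thesis using False True three_cycle_apply(4)[OF dist] by simp
      qed
    next
      case uw: False
      then have vw: "v w = w" using fixed[OF False] by simp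
      show ?thesis
      proof (cases "u w = z")
        case True
        then show ?thesis using vw three_cycle_apply[OF dist] by simp
      next
        case F: False
        have "v (u w) = u w" using fixed[OF F] ueq uw by metis
        moreover have "u w \<noteq> u z" "u w \<noteq> v z" using False uv ueq uw by metis+
        ultimately show ?thesis using F vw three_cycle_apply(4)[OF dist] by simp
      qed
    qed
  qed
  moreover have id: "u \<circ> inv' u = id" "v \<circ> inv' v = id"
    using assms(1,2) by (simp_all add: bij_is_surj surj_iff[symmetric])
  ultimately have "u \<circ> v = three_cycle z (u z) (v z) \<circ> (v \<circ> u)" by (simp add: fun_eq_iff)
  then have "u \<circ> v \<circ> inv' u \<circ> inv' v = three_cycle z (u z) (v z) \<circ> (v \<circ> (u \<circ> inv' u) \<circ> inv' v)"
    by (simp add: comp_assoc)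
  also have "\<dots> = three_cycle z (u z) (v z)"
    by (simp add: id)
  finally show "u \<circ> v \<circ> inv' u \<circ> inv' v = three_cycle z (u z) (v z)" .
qed

section \<open>Points joined by 3-cycles of a subgroup\<close>

lemma alt_subgroup_closed:
  assumes "subgroup H (alt_group n)"
  shows "id \<in> H" "u \<in> H \<Longrightarrow> v \<in> H \<Longrightarrow> u \<circ> v \<in> H" "u \<in> H \<Longrightarrow> inv' u \<in> H"
    "u \<in> H \<Longrightarrow> u permutes {1..n}" "u \<in> H \<Longrightarrow> bij u"
proof -
  interpret H: subgroup H "alt_group n" by fact
  show "id \<in> H" using H.one_closed by (simp add: alt_group_one)
  show "u \<circ> v \<in> H" if "u \<in> H" "v \<in> H" using H.m_closed[OF that] by (simp add: alt_group_mult)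
  show "inv' u \<in> H" if "u \<in> H"
    using H.m_inv_closed[OF that] H.mem_carrier[OF that] by (simp add: alt_group_inv_equality)
  show "u permutes {1..n}" if "u \<in> H" using H.mem_carrier[OF that] by (simp add: alt_group_carrier)
  then show "bij u" if "u \<in> H" using that permutes_bij by blast
qed

lemma three_cycle_reverse_mem:
  assumes "subgroup H (alt_group n)" "three_cycle a b c \<in> H"
  shows "three_cycle c b a \<in> H"
  using alt_subgroup_closed(3)[OF assms] by (simp add: inv_three_cycle)

text \<open>For a subgroup \<open>H\<close> of an alternating group this is an equivalence relation,
  invariant under \<open>H\<close>, and \<open>H\<close> contains every 3-cycle on distinct points
  of one class. Proving \<open>H\<close> to be everything thus reduces to merging the classes into
  one.\<close>

definition linked :: "('a \<Rightarrow> 'a) set \<Rightarrow> 'a \<Rightarrow> 'a \<Rightarrow> bool" where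
  "linked H a b \<longleftrightarrow> a = b \<or> (\<exists>c. distinct [a, b, c] \<and> three_cycle a b c \<in> H)"

lemma linked_three_cycle:
  assumes H: "subgroup H (alt_group n)" and "linked H a b" "linked H b d" "distinct [a, b, d]"
  shows "three_cycle a b d \<in> H"
proof -
  obtain c where c: "distinct [a, b, c]" "three_cycle a b c \<in> H"
    using assms by (auto simp: linked_def)
  obtain e where e: "distinct [b, d, e]" "three_cycle b d e \<in> H"
    using assms by (auto simp: linked_def)
  note bij = alt_subgroup_closed(5)[OF H]
  consider "c = d" | "e = a" | "c \<noteq> d" "e = c" | "c \<noteq> d" "e \<noteq> a" "e \<noteq> c" by auto
  then show ?thesis
  proof cases
    case 1
    then show ?thesis using c by simp
  next
    case 2
    then show ?thesis using e three_cycle_rotate[of a b d] assms(4) by simp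
  next
    case 3
    \<comment> \<open>Only four points are involved. Conjugation by this 3-cycle fixes
      \<open>a\<close> and sends \<open>b\<close> to \<open>d\<close> and \<open>c\<close> to
      \<open>b\<close>, which gives the inverse of the desired cycle up to rotation.\<close>
    let ?v = "three_cycle b d c"
    have "?v \<circ> three_cycle a b c \<circ> inv' ?v \<in> H"
      using c e 3 alt_subgroup_closed[OF H] by simp
    then have "three_cycle (?v a) (?v b) (?v c) \<in> H"
      by (simp add: conj_three_cycle bij_three_cycle)
    moreover have "distinct [b, d, c]" using e 3 by simp
    ultimately have "three_cycle a d b \<in> H"
      using three_cycle_apply[of b d c] c assms(4) by auto
    then show ?thesis
      using three_cycle_reverse_mem[OF H] three_cycle_rotate[of a b d] three_cycle_rotate[of b d a] assms(4)
      by fastforce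
  next
    case 4
    \<comment> \<open>The two 3-cycles now share only \<open>b\<close>, so their commutator is a
      3-cycle. The first one is inverted so that it sends \<open>b\<close> to
      \<open>a\<close>.\<close>
    let ?u = "three_cycle b a c" and ?v = "three_cycle b d e"
    have "three_cycle c b a \<in> H" by (rule three_cycle_reverse_mem[OF H c(2)])
    then have u: "?u \<in> H"
      using three_cycle_rotate[of c b a] c by auto
    have d1: "distinct [b, a, c]" using c by auto
    note ap = three_cycle_apply[OF d1] three_cycle_apply[OF e(1)]
    have "?u \<circ> ?v \<circ> inv' ?u \<circ> inv' ?v \<in> H"
      using u e alt_subgroup_closed[OF H] by simp
    also have "?u \<circ> ?v \<circ> inv' ?u \<circ> inv' ?v = three_cycle b (?u b) (?v b)"
    proof (rule commutator_three_cycle)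
      show "bij ?u" "bij ?v" by (rule bij_three_cycle)+
      show "?u b \<noteq> b" "?v b \<noteq> b" using ap d1 e by auto
      show "?u w = w \<or> ?v w = w" if "w \<noteq> b" for w
        using that ap(4)[of w] ap(8)[of w] 4 assms(4) by auto
    qed
    finally have "three_cycle b a d \<in> H" using ap by simp
    from three_cycle_reverse_mem[OF H this] show ?thesis
      using three_cycle_rotate[of d a b] assms(4) by auto
  qed
qed

lemma linked_sym:
  assumes "subgroup H (alt_group n)" "linked H a b"
  shows "linked H b a"
  using assms(2) three_cycle_reverse_mem[OF assms(1)] three_cycle_rotate
  unfolding linked_def by (metis distinct_length_2_or_more distinct_singleton)

lemma linked_trans:
  assumes "subgroup H (alt_group n)" "linked H a b" "linked H b d"
  shows "linked H a d"
proof (cases "distinct [a, b, d]")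
  case True
  then have "three_cycle d b a \<in> H"
    using linked_three_cycle[OF assms True] three_cycle_reverse_mem[OF assms(1)] by blast
  then have "three_cycle a d b \<in> H"
    using True three_cycle_rotate[of a d b] three_cycle_rotate[of d b a] by auto
  then show ?thesis using True by (auto simp: linked_def)
qed (use assms in \<open>auto simp: linked_def\<close>)

text \<open>Membership of \<open>h\<close> in \<open>H\<close> is not assumed, only that conjugation
  by \<open>h\<close> maps \<open>H\<close> into itself: for a normal subgroup, \<open>h\<close>
  ranges over the whole alternating group.\<close>

lemma linked_conj:
  assumes bij: "bij h" and conj: "\<And>u. u \<in> H \<Longrightarrow> h \<circ> u \<circ> inv' h \<in> H" and "linked H a b"
  shows "linked H (h a) (h b)"
proof (cases "a = b")
  case False
  then obtain c where c: "distinct [a, b, c]" "three_cycle a b c \<in> H"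
    using assms(3) by (auto simp: linked_def)
  have "three_cycle (h a) (h b) (h c) \<in> H"
    using conj[OF c(2)] by (simp add: conj_three_cycle bij)
  moreover have "distinct [h a, h b, h c]"
    using c(1) bij_is_inj[OF bij] by (auto simp: inj_eq)
  ultimately show ?thesis by (auto simp: linked_def)
qed (simp add: linked_def)

lemma linked_image:
  assumes H: "subgroup H (alt_group n)" and "h \<in> H" "linked H a b"
  shows "linked H (h a) (h b)"
  by (rule linked_conj) (use assms alt_subgroup_closed[OF H] in simp_all)

lemma eq_alt_group_of_linked:
  assumes H: "subgroup H (alt_group n)"
    and "\<And>a b. a \<in> {1..n} \<Longrightarrow> b \<in> {1..n} \<Longrightarrow> linked H a b"
  shows "H = carrier (alt_group n)"
proof
  show "H \<subseteq> carrier (alt_group n)" using H by (rule subgroup.subset)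
  have "three_cycles n \<subseteq> H"
  proof
    fix u assume "u \<in> three_cycles n"
    then obtain cs where cs: "u = cycle_of_list cs" "distinct cs" "length cs = 3" "set cs \<subseteq> {1..n}"
      by auto
    then obtain a b c where abc: "cs = [a, b, c]"
      by (metis stupid_lemma)
    then have "u = three_cycle a b c"
      using cs by (simp add: three_cycle_def)
    then show "u \<in> H"
      using linked_three_cycle[OF H, of a b c] assms(2) cs abc by simp
  qed
  then show "carrier (alt_group n) \<subseteq> H"
    unfolding alt_group_carrier_as_three_cycles
    by (rule group.generate_subgroup_incl[OF alt_group_is_group _ H])
qed

section \<open>Powers of a product of two cycles\<close>

text \<open>A dilation of the residues of \<open>A\<close> into an interval of length less than \<open>q / 2\<close> makes the
  difference between the largest and the smallest residue unique.\<close>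

lemma unique_difference:
  fixes q :: nat
  assumes "Factorial_Ring.prime q" "A \<subseteq> {..<q}" "A \<noteq> {}" "4 ^ card A < q"
  shows "\<exists>s. \<exists>!a. a \<in> A \<and> (a + s) mod q \<in> A"
proof -
  have fin: "finite A" using assms(2) finite_subset by blast
  have q: "0 < q" using assms(1) prime_gt_0_nat by blast
  obtain f where f: "bij_betw f {..<card A} A"
    using ex_bij_betw_nat_finite[OF fin] by (auto simp: atLeast0LessThan)
  \<comment> \<open>Simultaneous Dirichlet approximation to within 1/4: the multiplier
    \<open>t\<close> is positive and at most \<open>4 ^ card A\<close>, hence less than
    \<open>q\<close> and invertible modulo \<open>q\<close>, and \<open>t\<close> times each
    \<open>a\<close> is within \<open>q / 4\<close> of a multiple of \<open>q\<close>.\<close>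
  obtain t P where t: "0 < t" "t \<le> int (4 ^ card A)"
    and P: "\<And>i. i < card A \<Longrightarrow> \<bar>of_int t * (real (f i) / real q) - of_int (P i)\<bar> < 1 / real 4"
    using Dirichlet_approx_simult[of 4 "card A" "\<lambda>i. real (f i) / real q"] by auto
  have t_less: "t < int q" using t(2) assms(4) by linarith
  define \<rho> where "\<rho> a = t * int a - int q * P (inv_into {..<card A} f a)" for a
  have small: "4 * \<bar>\<rho> a\<bar> < int q" if "a \<in> A" for a
  proof -
    define i where "i = inv_into {..<card A} f a"
    have i: "i < card A" "f i = a"
      using f that unfolding i_def
      by (metis bij_betw_imp_surj_on inv_into_into lessThan_iff, metis bij_betw_imp_surj_on f_inv_into_f)
    have "real_of_int (\<rho> a) = real q * (of_int t * (real (f i) / real q) - of_int (P i))"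
      using q i(2) by (simp add: \<rho>_def i_def[symmetric] field_simps)
    then have "\<bar>real_of_int (\<rho> a)\<bar> = real q * \<bar>of_int t * (real (f i) / real q) - of_int (P i)\<bar>"
      by (simp add: abs_mult)
    also have "\<dots> < real q * (1 / 4)"
      using P[OF i(1)] q by (intro mult_strict_left_mono) auto
    finally show ?thesis by linarith
  qed
  have cop: "coprime (int q) t"
    by (rule prime_imp_coprime) (use assms(1) zdvd_not_zless[OF t(1) t_less] in simp_all)
  have dvd_imp: "int q dvd b" if "int q dvd t * b" for b
    using that cop by (simp add: coprime_dvd_mult_right_iff)
  have inj: "a = b" if "a \<in> A" "b \<in> A" "\<rho> a = \<rho> b" for a b
  proof -
    have "t * (int a - int b) = int q * (P (inv_into {..<card A} f a) - P (inv_into {..<card A} f b))"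
      using that(3) by (simp add: \<rho>_def algebra_simps)
    then have "int q dvd int a - int b" by (rule dvd_imp[OF dvdI])
    moreover have "a < q" "b < q" using that(1,2) assms(2) by auto
    then have "\<bar>int a - int b\<bar> < int q" by linarith
    ultimately have "int a - int b = 0"
      using dvd_imp_le_int[of "int a - int b" "int q"] by linarith
    then show ?thesis by simp
  qed
  have "Max (\<rho> ` A) \<in> \<rho> ` A" "Min (\<rho> ` A) \<in> \<rho> ` A"
    using fin assms(3) by (simp_all add: Max_in Min_in)
  then obtain a1 a0 where max: "a1 \<in> A" "\<rho> a1 = Max (\<rho> ` A)" and min: "a0 \<in> A" "\<rho> a0 = Min (\<rho> ` A)"
    by (metis imageE)
  have a1: "a1 \<in> A" "\<And>a. a \<in> A \<Longrightarrow> \<rho> a \<le> \<rho> a1" and a0: "a0 \<in> A" "\<And>a. a \<in> A \<Longrightarrow> \<rho> a0 \<le> \<rho> a"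
    using max min fin by simp_all
  have lt: "a0 < q" "a1 < q" using a0 a1 assms(2) by auto
  \<comment> \<open>The difference of the elements with extreme residues, shifted by
    \<open>q\<close> to stay a natural number.\<close>
  define s where "s = a1 + (q - a0)"
  show ?thesis
  proof (intro exI[of _ s] ex1I[of _ a0] conjI)
    have "a0 + s = a1 + q" using lt by (simp add: s_def)
    then show "(a0 + s) mod q \<in> A" using a1 lt by simp
    fix a assume "a \<in> A \<and> (a + s) mod q \<in> A"
    then have a: "a \<in> A" and b: "(a + s) mod q \<in> A" by auto
    define b where "b = (a + s) mod q"
    have "int b = (int a + int s) mod int q" by (simp add: b_def zmod_int)
    then have "int q dvd int b - (int a + int s)" by (metis mod_eq_dvd_iff mod_mod_trivial)
    then have "int q dvd (int b - (int a + int s)) + int q" by (rule dvd_add) simp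
    also have "(int b - (int a + int s)) + int q = int b - int a - int a1 + int a0"
      using lt by (simp add: s_def)
    finally obtain c where c: "int b - int a - int a1 + int a0 = int q * c" by (rule dvdE)
    have "\<rho> b - \<rho> a - \<rho> a1 + \<rho> a0 = t * (int b - int a - int a1 + int a0) -
        int q * (P (inv_into {..<card A} f b) - P (inv_into {..<card A} f a)
           - P (inv_into {..<card A} f a1) + P (inv_into {..<card A} f a0))"
      by (simp add: \<rho>_def algebra_simps)
    then have "int q dvd \<rho> b - \<rho> a - \<rho> a1 + \<rho> a0"
      by (simp add: c)
    \<comment> \<open>Four residues below \<open>q / 4\<close> in absolute value cannot add up to a
      nonzero multiple of \<open>q\<close>, so the congruence is an equality of integers. The
      difference of \<open>\<rho> b\<close> and \<open>\<rho> a\<close> is then the largest possible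
      one, which forces \<open>a\<close> to be \<open>a0\<close>.\<close>
    moreover have "\<bar>\<rho> b - \<rho> a - \<rho> a1 + \<rho> a0\<bar> < int q"
      using small[OF a] small[of b] small[OF a0(1)] small[OF a1(1)] b unfolding b_def[symmetric] by linarith
    ultimately have "\<rho> b - \<rho> a - \<rho> a1 + \<rho> a0 = 0"
      using dvd_imp_le_int[of "\<rho> b - \<rho> a - \<rho> a1 + \<rho> a0" "int q"] by linarith
    then have "\<rho> a = \<rho> a0"
      using a1(2)[of b] a0(2)[OF a] b unfolding b_def[symmetric] by linarith
    then show "a = a0" using inj a a0(1) by blast
  qed (use a0 in auto)
qed

text \<open>At most \<open>card A ^ 2\<close> residues are differences of two elements of
  \<open>A\<close>; any other residue serves as the shift.\<close>

lemma shift_disjoint: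
  fixes q :: nat
  assumes "A \<subseteq> {..<q}" "card A ^ 2 < q"
  shows "\<exists>s. \<forall>a\<in>A. (a + s) mod q \<notin> A"
proof -
  have fin: "finite A" using assms(1) finite_subset by blast
  let ?D = "(\<lambda>(a, b). (b + (q - a)) mod q) ` (A \<times> A)"
  have "card ?D \<le> card (A \<times> A)" by (rule card_image_le) (simp add: fin)
  then have "card ?D < card {..<q}"
    using assms(2) by (simp add: card_cartesian_product power2_eq_square)
  then have "\<not> {..<q} \<subseteq> ?D"
    using card_mono[of ?D "{..<q}"] fin by auto
  then obtain s where s: "s < q" "s \<notin> ?D" by auto
  have "(a + s) mod q \<notin> A" if a: "a \<in> A" for a
  proof
    assume b: "(a + s) mod q \<in> A"
    have "((a + s) mod q + (q - a)) mod q = (a + s + (q - a)) mod q" by (simp add: mod_simps)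
    also have "a + s + (q - a) = s + q" using a assms(1) by auto
    finally have "((a + s) mod q + (q - a)) mod q = s" using s(1) by simp
    then have "s \<in> ?D" using a b by (intro image_eqI[of _ _ "(a, (a + s) mod q)"]) auto
    then show False using s(2) by simp
  qed
  then show ?thesis by blast
qed

text \<open>\<open>two_cycles p n s\<close> is the \<open>s\<close>-th power of the product of the cycles \<open>(1 \<dots> p)\<close> and
  \<open>(p + 1 \<dots> n)\<close>.\<close>

definition two_cycles :: "nat \<Rightarrow> nat \<Rightarrow> nat \<Rightarrow> nat \<Rightarrow> nat" where
  "two_cycles p n s x =
    (if 1 \<le> x \<and> x \<le> p then Suc ((x - 1 + s) mod p)
     else if p < x \<and> x \<le> n then Suc (p + (x - Suc p + s) mod (n - p)) else x)"

lemma two_cycles_left: "u < p \<Longrightarrow> two_cycles p n s (Suc u) = Suc ((u + s) mod p)"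
  by (auto simp: two_cycles_def)

lemma two_cycles_right: "u < n - p \<Longrightarrow> two_cycles p n s (Suc (p + u)) = Suc (p + (u + s) mod (n - p))"
  by (auto simp: two_cycles_def)

lemma two_cycles_cases:
  assumes "p \<le> n"
  obtains (left) u where "x = Suc u" "u < p" | (right) u where "x = Suc (p + u)" "u < n - p"
    | (out) "x \<notin> {1..n}"
proof -
  consider "x \<notin> {1..n}" | "1 \<le> x" "x \<le> p" | "p < x" "x \<le> n" by force
  then show thesis
  proof cases
    case 1 then show thesis by (rule out)
  next
    case 2 then show thesis by (intro left[of "x - 1"]) auto
  next
    case 3 then show thesis by (intro right[of "x - Suc p"]) auto
  qed
qed

lemma two_cycles_out: "p \<le> n \<Longrightarrow> x \<notin> {1..n} \<Longrightarrow> two_cycles p n s x = x"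
  by (auto simp: two_cycles_def)

lemma two_cycles_compose:
  assumes "p \<le> n"
  shows "two_cycles p n s \<circ> two_cycles p n t = two_cycles p n (s + t)"
proof
  fix x
  from assms show "(two_cycles p n s \<circ> two_cycles p n t) x = two_cycles p n (s + t) x"
  proof (cases rule: two_cycles_cases[of p n x])
    case (left u)
    moreover from this have "(u + t) mod p < p" by simp
    ultimately show ?thesis
      by (simp add: two_cycles_left mod_simps) (simp add: ac_simps)
  next
    case (right u)
    moreover from this have "(u + t) mod (n - p) < n - p" by simp
    ultimately show ?thesis
      by (simp add: two_cycles_right mod_simps) (simp add: ac_simps)
  next
    case out
    then show ?thesis using assms by (simp add: two_cycles_out)
  qed
qed

lemma two_cycles_cong:
  assumes "p \<le> n" "[s = t] (mod p)" "[s = t] (mod (n - p))"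
  shows "two_cycles p n s = two_cycles p n t"
proof
  fix x
  from assms(1) show "two_cycles p n s x = two_cycles p n t x"
  proof (cases rule: two_cycles_cases[of p n x])
    case (left u)
    then show ?thesis
      using cong_add_lcancel_nat[of u s t p] assms(2) by (simp add: two_cycles_left cong_def)
  next
    case (right u)
    then show ?thesis
      using cong_add_lcancel_nat[of u s t "n - p"] assms(3) by (simp add: two_cycles_right cong_def)
  qed (use assms in \<open>simp add: two_cycles_out\<close>)
qed

lemma two_cycles_zero: "two_cycles p n 0 = id"
  by (auto simp: two_cycles_def fun_eq_iff)

lemma two_cycles_permutes:
  assumes "0 < p" "p < n"
  shows "two_cycles p n s permutes {1..n}"
proof -
  have "two_cycles p n (s * (p * (n - p))) = two_cycles p n 0"
    by (rule two_cycles_cong) (use assms in \<open>auto simp: cong_0_iff\<close>)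
  then have id: "two_cycles p n (s * (p * (n - p))) = id" by (simp add: two_cycles_zero)
  have "bij (two_cycles p n s)"
  proof -
    have "p * (n - p) \<noteq> 0" using assms by simp
    then obtain k where k: "p * (n - p) = Suc k" using not0_implies_Suc by blast
    have "s + s * k = s * (p * (n - p))" by (simp add: k)
    then have "two_cycles p n s \<circ> two_cycles p n (s * k) = id" "two_cycles p n (s * k) \<circ> two_cycles p n s = id"
      using id assms by (simp_all add: two_cycles_compose add.commute)
    then show ?thesis by (simp add: o_bij)
  qed
  then show ?thesis
    using assms by (auto simp: permutes_def bij_iff two_cycles_out)
qed

lemma moved_conj:
  assumes "bij h"
  shows "(h \<circ> u \<circ> inv' h) w \<noteq> w \<longleftrightarrow> w \<in> h ` {v. u v \<noteq> v}"
proof -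
  obtain v where v: "w = h v" using bij_is_surj[OF assms] by auto
  then show ?thesis
    using bij_is_inj[OF assms] by (auto simp: inj_eq inj_image_mem_iff)
qed

text \<open>Shifting a link by multiples of its difference \<open>s\<close> gives a chain of links,
  and \<open>s\<close> is invertible modulo the prime \<open>q\<close>, so the chain visits every
  residue. The embedding \<open>\<iota>\<close> lets the argument serve both cycles.\<close>

lemma linked_orbit:
  fixes q u v w :: nat and f :: "nat \<Rightarrow> nat \<Rightarrow> nat" and \<iota> :: "nat \<Rightarrow> nat"
  assumes H: "subgroup H (alt_group n)" and q: "Factorial_Ring.prime q"
    and f: "\<And>s. f s \<in> H" "\<And>s u. u < q \<Longrightarrow> f s (\<iota> u) = \<iota> ((u + s) mod q)"
    and "u < q" "v < q" "u \<noteq> v" "linked H (\<iota> u) (\<iota> v)" "w < q"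
  shows "linked H (\<iota> u) (\<iota> w)"
proof -
  define s where "s = (v + (q - u)) mod q"
  have us: "(u + s) mod q = v"
  proof -
    have "u + (v + (q - u)) = v + q" using assms(5) by arith
    then have "(u + (v + (q - u))) mod q = v" using assms(6) by simp
    then show ?thesis by (simp add: s_def mod_simps)
  qed
  have step: "linked H (\<iota> ((u + k * s) mod q)) (\<iota> ((u + Suc k * s) mod q))" for k
  proof -
    have "linked H (f (k * s) (\<iota> u)) (f (k * s) (\<iota> v))"
      by (rule linked_image[OF H f(1) assms(8)])
    moreover have "(v + k * s) mod q = (u + Suc k * s) mod q"
      unfolding us[symmetric] by (simp add: mod_simps ac_simps)
    ultimately show ?thesis
      using assms(5,6) by (simp add: f(2))
  qed
  have all: "linked H (\<iota> u) (\<iota> ((u + k * s) mod q))" for k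
  proof (induction k)
    case 0
    then show ?case using assms(5) by (simp add: linked_def)
  next
    case (Suc k)
    then show ?case using linked_trans[OF H _ step] by blast
  qed
  have "\<not> q dvd s"
  proof
    assume "q dvd s"
    then obtain c where "s = q * c" by (rule dvdE)
    then have "v = u" using us assms(5) by simp
    then show False using assms(7) by simp
  qed
  then have "coprime s q"
    using prime_imp_coprime[OF q] coprime_commute by blast
  then obtain k0 where "[s * k0 = Suc 0] (mod q)"
    using cong_solve_coprime_nat by blast
  then have "[s * k0 * (w + (q - u)) = Suc 0 * (w + (q - u))] (mod q)"
    by (rule cong_scalar_right)
  moreover define k where "k = k0 * (w + (q - u))"
  ultimately have "[k * s = w + (q - u)] (mod q)"
    by (simp add: ac_simps)
  then have "[u + k * s = u + (w + (q - u))] (mod q)"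
    by (simp add: cong_add_lcancel_nat)
  moreover have "u + (w + (q - u)) = w + q" using assms(5) by arith
  ultimately have "(u + k * s) mod q = w" using assms(9) by (simp add: cong_def)
  then show ?thesis using all[of k] by simp
qed

text \<open>The exponential gaps are the price of \<open>unique_difference\<close>, where the
  modulus must exceed 4 to the power of the number of residues: \<open>r_less\<close> pays for at
  most \<open>r\<close> points in the first cycle, \<open>p_less\<close> for at most
  \<open>p\<close> points in the second.\<close>

locale two_cycle_generator =
  fixes p n r :: nat
  assumes prime_p: "Factorial_Ring.prime p" and prime_diff: "Factorial_Ring.prime (n - p)"
    and r_less: "4 ^ r < p" and p_less: "4 ^ p < n - p" and r_pos: "0 < r"
begin

lemma p_bounds: "4 < p" "p < n" "p < n - p" "p ^ 2 < n - p"
proof -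
  have "4 ^ 1 \<le> (4::nat) ^ r" using r_pos by (intro power_increasing) auto
  then show "4 < p" using r_less by simp
  have "p < 4 ^ p" by (rule less_exp[THEN less_le_trans]) (simp add: power_mono)
  then show "p < n - p" using p_less by simp
  then show "p < n" by simp
  have "p ^ 2 \<le> (2 ^ p) ^ 2" by (intro power_mono less_imp_le[OF less_exp]) simp
  also have "(2 ^ p) ^ 2 = ((2::nat) ^ 2) ^ p" by (simp only: power_mult[symmetric] mult.commute)
  also have "\<dots> = 4 ^ p" by simp
  finally show "p ^ 2 < n - p" using p_less by simp
qed

lemma coprime_p: "coprime p (n - p)"
  using primes_coprime[OF prime_p prime_diff] p_bounds by simp

lemma crt: "\<exists>s. [s = a] (mod p) \<and> [s = b] (mod (n - p))"
  by (rule binary_chinese_remainder_nat[OF coprime_p])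

abbreviation g :: "nat \<Rightarrow> nat" where "g \<equiv> two_cycles p n (Suc 0)"

text \<open>The order of the product of the two cycles divides the odd number
  \<open>p * (n - p)\<close>, so each power of it is a square and hence even.\<close>

lemma two_cycles_alt: "two_cycles p n s \<in> carrier (alt_group n)"
proof -
  have odd: "odd (p * (n - p))"
    using prime_odd_nat[OF prime_p] prime_odd_nat[OF prime_diff] p_bounds by simp
  define t where "t = (s + s * (p * (n - p))) div 2"
  have "s + s * (p * (n - p)) = t + t"
    using odd unfolding t_def by (metis dvd_mult_div_cancel even_add even_mult_iff mult_2)
  then have "two_cycles p n t \<circ> two_cycles p n t = two_cycles p n (s + s * (p * (n - p)))"
    using p_bounds by (simp add: two_cycles_compose)
  also have "\<dots> = two_cycles p n s"
  proof (rule two_cycles_cong)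
    have "s * (p * (n - p)) = p * (s * (n - p))" "s * (p * (n - p)) = (n - p) * (s * p)"
      by (simp_all only: ac_simps)
    then show "[s + s * (p * (n - p)) = s] (mod p)" "[s + s * (p * (n - p)) = s] (mod (n - p))"
      by (metis cong_def mod_mult_self2)+
  qed (use p_bounds in simp)
  finally have eq: "two_cycles p n s = two_cycles p n t \<circ> two_cycles p n t" by simp
  have perm: "two_cycles p n s permutes {1..n}" for s
    by (rule two_cycles_permutes) (use p_bounds in auto)
  have "permutation (two_cycles p n t)"
    using perm[of t] permutation_permutes by blast
  then have "evenperm (two_cycles p n s)"
    unfolding eq by (simp add: evenperm_comp)
  with perm show ?thesis by (simp add: alt_group_carrier)
qed

lemma two_cycles_mem:
  assumes H: "subgroup H (alt_group n)" and "g \<in> H"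
  shows "two_cycles p n s \<in> H"
proof (induction s)
  case 0
  then show ?case using alt_subgroup_closed(1)[OF H] by (simp only: two_cycles_zero)
next
  case (Suc s)
  then have "g \<circ> two_cycles p n s \<in> H"
    using alt_subgroup_closed(2)[OF H] assms(2) by blast
  then show ?case using p_bounds by (simp add: two_cycles_compose)
qed

text \<open>If \<open>W\<close> misses the first cycle, a unique difference is found in the second.
  Otherwise it is found among the few points in the first cycle, and the Chinese remainder theorem
  combines it with a shift of the second cycle that moves all points of \<open>W\<close> there off
  \<open>W\<close>.\<close>

lemma unique_overlap:
  assumes W: "W \<subseteq> {1..n}" "card W = p" "card (W \<inter> {1..p}) \<le> r"
  shows "\<exists>s. \<exists>!w. w \<in> W \<and> two_cycles p n s w \<in> W"
proof -
  define A where "A = {v. v < n - p \<and> Suc (p + v) \<in> W}"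
  define B where "B = {u. u < p \<and> Suc u \<in> W}"
  have fin: "finite W" using W(1) finite_subset by blast
  have "card A = card ((\<lambda>v. Suc (p + v)) ` A)"
    by (rule card_image[symmetric]) (auto simp: inj_on_def)
  also have "\<dots> \<le> card W"
    by (rule card_mono[OF fin]) (auto simp: A_def)
  finally have cA: "card A \<le> p" using W(2) by simp
  have "card B = card (Suc ` B)"
    by (rule card_image[symmetric]) (auto simp: inj_on_def)
  also have "\<dots> \<le> card (W \<inter> {1..p})"
    by (rule card_mono) (use fin in \<open>auto simp: B_def\<close>)
  finally have cB: "card B \<le> r" using W(3) by simp
  have sub: "A \<subseteq> {..<n - p}" "B \<subseteq> {..<p}" by (auto simp: A_def B_def)
  have le: "p \<le> n" using p_bounds by simp
  have outB: "(\<And>u. u < p \<Longrightarrow> w \<noteq> Suc u) \<Longrightarrow> w \<in> W \<Longrightarrow> \<exists>v. w = Suc (p + v) \<and> v < n - p" for w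
    using W(1) two_cycles_cases[OF le, of w] by (metis subsetD)
  show ?thesis
  proof (cases "B = {}")
    case True
    have "W \<noteq> {}" using W(2) p_bounds by auto
    have form: "\<exists>v\<in>A. w = Suc (p + v)" if "w \<in> W" for w
      using outB[of w] that True by (auto simp: A_def B_def)
    then have "A \<noteq> {}" using \<open>W \<noteq> {}\<close> by blast
    moreover have "4 ^ card A < n - p"
      by (rule le_less_trans[OF power_increasing[OF cA] p_less]) simp
    ultimately obtain s where s: "\<exists>!a. a \<in> A \<and> (a + s) mod (n - p) \<in> A"
      using unique_difference[OF prime_diff sub(1)] by blast
    then obtain a where a: "a \<in> A" "(a + s) mod (n - p) \<in> A"
      "\<And>b. b \<in> A \<Longrightarrow> (b + s) mod (n - p) \<in> A \<Longrightarrow> b = a" by blast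
    show ?thesis
    proof (intro exI[of _ s] ex1I[of _ "Suc (p + a)"] conjI)
      show "Suc (p + a) \<in> W" "two_cycles p n s (Suc (p + a)) \<in> W"
        using a(1,2) by (auto simp: A_def two_cycles_right)
      fix w assume w: "w \<in> W \<and> two_cycles p n s w \<in> W"
      then obtain v where v: "v \<in> A" "w = Suc (p + v)" using form by blast
      have "(v + s) mod (n - p) \<in> A"
        using w v by (auto simp: A_def two_cycles_right)
      then show "w = Suc (p + a)" using a(3)[OF v(1)] v(2) by simp
    qed
  next
    case False
    have "4 ^ card B < p"
      by (rule le_less_trans[OF power_increasing[OF cB] r_less]) simp
    then obtain s1 where "\<exists>!a. a \<in> B \<and> (a + s1) mod p \<in> B"
      using unique_difference[OF prime_p sub(2) False] by blast
    then obtain a where a: "a \<in> B" "(a + s1) mod p \<in> B"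
      "\<And>b. b \<in> B \<Longrightarrow> (b + s1) mod p \<in> B \<Longrightarrow> b = a" by blast
    have "card A ^ 2 < n - p"
      by (rule le_less_trans[OF power_mono[OF cA] p_bounds(4)]) simp
    then obtain s2 where s2: "\<forall>a\<in>A. (a + s2) mod (n - p) \<notin> A"
      using shift_disjoint[OF sub(1)] by blast
    obtain s where s: "[s = s1] (mod p)" "[s = s2] (mod (n - p))"
      using crt by blast
    have sp: "(u + s) mod p = (u + s1) mod p" for u
      using s(1) by (metis cong_def cong_add_lcancel_nat)
    have sN: "(u + s) mod (n - p) = (u + s2) mod (n - p)" for u
      using s(2) by (metis cong_def cong_add_lcancel_nat)
    show ?thesis
    proof (intro exI[of _ s] ex1I[of _ "Suc a"] conjI)
      show "Suc a \<in> W" "two_cycles p n s (Suc a) \<in> W"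
        using a(1,2) by (auto simp: B_def two_cycles_left sp)
      fix w assume w: "w \<in> W \<and> two_cycles p n s w \<in> W"
      show "w = Suc a"
      proof (cases "\<exists>u<p. w = Suc u")
        case True
        then obtain u where u: "u < p" "w = Suc u" by blast
        then have "u \<in> B" "(u + s1) mod p \<in> B"
          using w by (auto simp: B_def two_cycles_left sp)
        then show ?thesis using a(3) u by simp
      next
        case False
        then obtain v where v: "w = Suc (p + v)" "v < n - p"
          using outB[of w] w by blast
        then have "v \<in> A" "(v + s2) mod (n - p) \<in> A"
          using w by (auto simp: A_def two_cycles_right sN)
        then show ?thesis using s2 by blast
      qed
    qed
  qed
qed


text \<open>By the Chinese remainder theorem a power of \<open>g\<close> can fix \<open>a\<close>
  and move \<open>b\<close> anywhere in the second cycle, or fix \<open>b\<close> and move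
  \<open>a\<close> anywhere in the first. So a single link between the cycles spreads to all
  points.\<close>

lemma linked_all_of_mixed:
  assumes H: "subgroup H (alt_group n)" and g: "g \<in> H"
    and ab: "a \<in> {1..p}" "b \<in> {Suc p..n}" "linked H a b"
  shows "H = carrier (alt_group n)"
proof (rule eq_alt_group_of_linked[OF H])
  obtain u where u: "a = Suc u" "u < p" using ab(1) by (cases a) auto
  obtain v where v: "b = Suc (p + v)" "v < n - p"
    using ab(2) that[of "b - Suc p"] by auto
  have right: "linked H a (Suc (p + w))" if w: "w < n - p" for w
  proof -
    obtain s where s: "[s = 0] (mod p)" "[s = w + (n - p - v)] (mod (n - p))"
      using crt by blast
    have "(u + s) mod p = u"
      using cong_add_lcancel_nat[of u s 0 p] s(1) u(2) by (simp add: cong_def)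
    moreover have "(v + s) mod (n - p) = w"
    proof -
      have "(v + s) mod (n - p) = (v + (w + (n - p - v))) mod (n - p)"
        using cong_add_lcancel_nat[of v s "w + (n - p - v)" "n - p"] s(2) by (simp add: cong_def)
      also have "v + (w + (n - p - v)) = w + (n - p)" using v(2) by arith
      also have "\<dots> mod (n - p) = w" using w by (simp only: mod_add_self2 mod_less)
      finally show ?thesis .
    qed
    ultimately show ?thesis
      using linked_image[OF H two_cycles_mem[OF H g, of s] ab(3)] u v
      by (simp add: two_cycles_left two_cycles_right)
  qed
  have left: "linked H b (Suc w)" if w: "w < p" for w
  proof -
    obtain s where s: "[s = w + (p - u)] (mod p)" "[s = 0] (mod (n - p))"
      using crt by blast
    have "(v + s) mod (n - p) = v"
      using cong_add_lcancel_nat[of v s 0 "n - p"] s(2) v(2) by (simp add: cong_def)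
    moreover have "(u + s) mod p = w"
    proof -
      have "(u + s) mod p = (u + (w + (p - u))) mod p"
        using cong_add_lcancel_nat[of u s "w + (p - u)" p] s(1) by (simp add: cong_def)
      also have "u + (w + (p - u)) = w + p" using u(2) by arith
      finally show ?thesis using w by simp
    qed
    ultimately show ?thesis
      using linked_image[OF H two_cycles_mem[OF H g, of s] linked_sym[OF H ab(3)]] u v
      by (simp add: two_cycles_left two_cycles_right)
  qed
  have all: "linked H a x" if "x \<in> {1..n}" for x
  proof -
    have "p \<le> n" using p_bounds by simp
    then show ?thesis
    proof (cases rule: two_cycles_cases[of p n x])
      case (left w)
      then show ?thesis
        using linked_trans[OF H ab(3)] \<open>\<And>w. w < p \<Longrightarrow> linked H b (Suc w)\<close> by simp
    next
      case (right w)
      then show ?thesis using \<open>\<And>w. w < n - p \<Longrightarrow> linked H a (Suc (p + w))\<close> by simp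
    qed (use that in auto)
  qed
  show "linked H x y" if "x \<in> {1..n}" "y \<in> {1..n}" for x y
    using linked_trans[OF H linked_sym[OF H all] all] that by blast
qed

text \<open>A link inside one cycle spreads over that cycle, and \<open>x\<close> carries links to
  links. If \<open>x\<close> sends one point of the cycle to each side, a mixed link arises. If it
  sends the first cycle entirely into the second, a link inside the second cycle arises, and the
  argument continues there.\<close>

lemma generates_of_three_cycle:
  assumes H: "subgroup H (alt_group n)" and g: "g \<in> H" and x: "x \<in> H"
    and ab: "a \<noteq> b" "linked H a b" and move: "\<not> x ` {1..p} \<subseteq> {1..p}"
  shows "H = carrier (alt_group n)"
proof (rule ccontr)
  assume contra: "H \<noteq> carrier (alt_group n)"
  have mixed: "\<not> linked H a b" if "a \<in> {1..p}" "b \<in> {Suc p..n}" for a b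
    using linked_all_of_mixed[OF H g that] contra by blast
  have le: "p \<le> n" using p_bounds by simp
  have xperm: "x permutes {1..n}" by (rule alt_subgroup_closed(4)[OF H x])
  have xinj: "x y = x z \<longleftrightarrow> y = z" for y z
    using permutes_inj[OF xperm] by (auto simp: inj_eq)
  obtain c where c: "distinct [a, b, c]" "three_cycle a b c \<in> H"
    using ab by (auto simp: linked_def)
  have abn: "a \<in> {1..n}" "b \<in> {1..n}"
    using alt_subgroup_closed(4)[OF H c(2)] three_cycle_apply[OF c(1)] c(1)
    by (metis permutes_not_in distinct_length_2_or_more)+
  have Q: False if hyp: "a \<noteq> b" "a \<in> {Suc p..n}" "b \<in> {Suc p..n}" "linked H a b" for a b
  proof -
    have form: "\<exists>u. y = Suc (p + u) \<and> u < n - p" if "y \<in> {Suc p..n}" for y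
      using that by (intro exI[of _ "y - Suc p"]) auto
    obtain u v where uv: "a = Suc (p + u)" "u < n - p" "b = Suc (p + v)" "v < n - p"
      using form hyp(2,3) by blast
    have "linked H (Suc (p + u)) (Suc (p + w))" if "w < n - p" for w
      by (rule linked_orbit[OF H prime_diff, where f = "two_cycles p n" and v = v])
        (use uv hyp(1,4) that two_cycles_mem[OF H g] in \<open>auto simp: two_cycles_right\<close>)
    then have all: "linked H y z" if "y \<in> {Suc p..n}" "z \<in> {Suc p..n}" for y z
      using form[OF that(1)] form[OF that(2)] linked_trans[OF H] linked_sym[OF H] by blast
    have split: "y \<in> {1..p} \<or> y \<in> {Suc p..n}" if "y \<in> {1..n}" for y using that by auto
    have xn: "x y \<in> {1..n}" if "y \<in> {1..n}" for y
      using permutes_in_image[OF xperm] that by blast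
    have sub: "{1..p} \<subseteq> {1..n}" "{Suc p..n} \<subseteq> {1..n}" using le by auto
    \<comment> \<open>Otherwise \<open>x\<close> would map the second cycle onto itself by
      finiteness, and hence preserve the first one, contrary to \<open>move\<close>.\<close>
    have "\<exists>y\<in>{Suc p..n}. x y \<in> {1..p}"
    proof (rule ccontr)
      assume no: "\<not> ?thesis"
      then have "x ` {Suc p..n} \<subseteq> {Suc p..n}"
        using split xn sub(2) by blast
      then have onto: "x ` {Suc p..n} = {Suc p..n}"
        by (intro card_subset_eq) (auto simp: card_image inj_on_def xinj)
      obtain y where y: "y \<in> {1..p}" "x y \<notin> {1..p}" using move by blast
      then have "x y \<in> x ` {Suc p..n}"
        unfolding onto using split xn sub(1) by blast
      then have "y \<in> {Suc p..n}" by (auto simp only: xinj image_iff)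
      then show False using y(1) by simp
    qed
    then obtain y where y: "y \<in> {Suc p..n}" "x y \<in> {1..p}" by blast
    \<comment> \<open>The \<open>n - p > p\<close> points of the second cycle do not all fit into
      the first.\<close>
    have "\<exists>z\<in>{Suc p..n}. x z \<in> {Suc p..n}"
    proof (rule ccontr)
      assume "\<not> ?thesis"
      then have "x ` {Suc p..n} \<subseteq> {1..p}"
        using split xn sub(2) by blast
      then have "card (x ` {Suc p..n}) \<le> card {1..p}" by (intro card_mono) auto
      also have "card (x ` {Suc p..n}) = n - p"
        by (subst card_image) (auto simp: inj_on_def xinj)
      finally show False using p_bounds by simp
    qed
    then obtain z where z: "z \<in> {Suc p..n}" "x z \<in> {Suc p..n}" by blast
    show False
      using mixed[OF y(2) z(2)] linked_image[OF H x all[OF y(1) z(1)]] by blast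
  qed
  have P: False if hyp: "a \<noteq> b" "a \<in> {1..p}" "b \<in> {1..p}" "linked H a b" for a b
  proof -
    have form: "\<exists>u. y = Suc u \<and> u < p" if "y \<in> {1..p}" for y
      using that by (intro exI[of _ "y - 1"]) auto
    obtain u v where uv: "a = Suc u" "u < p" "b = Suc v" "v < p"
      using form hyp(2,3) by blast
    have "linked H (Suc u) (Suc w)" if "w < p" for w
      by (rule linked_orbit[OF H prime_p, where f = "two_cycles p n" and v = v])
        (use uv hyp(1,4) that two_cycles_mem[OF H g] in \<open>auto simp: two_cycles_left\<close>)
    then have all: "linked H y z" if "y \<in> {1..p}" "z \<in> {1..p}" for y z
      using form[OF that(1)] form[OF that(2)] linked_trans[OF H] linked_sym[OF H] by blast
    obtain y where y: "y \<in> {1..p}" "x y \<notin> {1..p}" using move by blast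
    then have xy: "x y \<in> {Suc p..n}"
      using permutes_in_image[OF xperm, of y] le by auto
    show False
    proof (cases "\<exists>z\<in>{1..p}. x z \<in> {1..p}")
      case True
      then obtain z where z: "z \<in> {1..p}" "x z \<in> {1..p}" by blast
      show False
        using mixed[OF z(2) xy] linked_image[OF H x all[OF z(1) y(1)]] by blast
    next
      case False
      obtain z where z: "z \<in> {1..p}" "z \<noteq> y"
        using hyp(1-3) by metis
      then have "x z \<in> {Suc p..n}"
        using False permutes_in_image[OF xperm, of z] le by fastforce
      moreover have "x y \<noteq> x z" using z(2) by (simp add: xinj)
      ultimately show False
        using Q[OF _ xy] linked_image[OF H x all[OF y(1) z(1)]] by blast
    qed
  qed
  have "a \<in> {1..p} \<or> a \<in> {Suc p..n}" "b \<in> {1..p} \<or> b \<in> {Suc p..n}" using abn by auto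
  then consider "a \<in> {1..p}" "b \<in> {1..p}" | "a \<in> {Suc p..n}" "b \<in> {Suc p..n}"
    | "a \<in> {1..p}" "b \<in> {Suc p..n}" | "b \<in> {1..p}" "a \<in> {Suc p..n}"
    by blast
  then show False
  proof cases
    case 1
    then show False using P[OF ab(1) _ _ ab(2)] by simp
  next
    case 2
    then show False using Q[OF ab(1) _ _ ab(2)] by simp
  next
    case 3
    then show False using mixed ab(2) by simp
  next
    case 4
    then show False using mixed linked_sym[OF H ab(2)] by simp
  qed
qed

theorem generates_of_small_overlap:
  assumes H: "subgroup H (alt_group n)" and g: "g \<in> H" and x: "x \<in> H"
    and small: "card (x ` {1..p} \<inter> {1..p}) \<le> r"
  shows "H = carrier (alt_group n)"
proof -
  note closed = alt_subgroup_closed[OF H]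
  have xperm: "x permutes {1..n}" by (rule closed(4)[OF x])
  have bx: "bij x" by (rule closed(5)[OF x])
  have le: "p \<le> n" using p_bounds by simp
  define W where "W = x ` {1..p}"
  have W: "W \<subseteq> {1..n}" "card W = p"
  proof -
    show "W \<subseteq> {1..n}"
      using permutes_image[OF xperm] le unfolding W_def by (metis atLeastatMost_subset_iff image_mono le_refl)
    show "card W = p"
      unfolding W_def by (subst card_image) (use bx in \<open>auto simp: bij_def intro: inj_on_subset\<close>)
  qed
  obtain s w where w: "w \<in> W" "two_cycles p n s w \<in> W"
    "\<And>v. v \<in> W \<Longrightarrow> two_cycles p n s v \<in> W \<Longrightarrow> v = w"
    using unique_overlap[OF W] small unfolding W_def by blast
  \<comment> \<open>The exponent isolating the short cycle: \<open>two_cycles p n t\<close> rotates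
    \<open>{1..p}\<close> by one step and is trivial elsewhere.\<close>
  obtain t where t: "[t = 1] (mod p)" "[t = 0] (mod (n - p))" using crt by blast
  define c where "c = two_cycles p n t"
  define d where "d = two_cycles p n s"
  have cd: "c \<in> H" "d \<in> H" by (auto simp: c_def d_def two_cycles_mem[OF H g])
  have moved_c: "{v. c v \<noteq> v} = {1..p}"
  proof -
    have "c v \<noteq> v \<longleftrightarrow> v \<in> {1..p}" for v
      using le
    proof (cases rule: two_cycles_cases[of p n v])
      case (left u)
      have "(u + t) mod p = (u + 1) mod p"
        using cong_add_lcancel_nat[of u t 1 p] t(1) by (simp add: cong_def)
      also have "\<dots> \<noteq> u"
        using left(2) p_bounds by (cases "Suc u = p") auto
      finally show ?thesis using left by (simp add: c_def two_cycles_left)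
    next
      case (right u)
      have "(u + t) mod (n - p) = u"
        using cong_add_lcancel_nat[of u t 0 "n - p"] t(2) right(2) by (simp add: cong_def)
      then show ?thesis using right by (simp add: c_def two_cycles_right)
    next
      case out
      then show ?thesis using le by (auto simp: c_def two_cycles_out)
    qed
    then show ?thesis by blast
  qed
  define u where "u = x \<circ> c \<circ> inv' x"
  define v where "v = d \<circ> u \<circ> inv' d"
  have uv: "u \<in> H" "v \<in> H" using cd x closed by (simp_all add: u_def v_def)
  have moved_u: "u z \<noteq> z \<longleftrightarrow> z \<in> W" for z
    unfolding u_def moved_conj[OF bx] moved_c W_def ..
  then have "{z. u z \<noteq> z} = W" by blast
  then have moved_v: "v z \<noteq> z \<longleftrightarrow> z \<in> d ` W" for z
    unfolding v_def moved_conj[OF closed(5)[OF cd(2)]] by simp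
  have fixed: "u z = z \<or> v z = z" if "z \<noteq> d w" for z
  proof (rule ccontr)
    assume "\<not> ?thesis"
    then have "z \<in> W" "z \<in> d ` W" using moved_u moved_v by blast+
    then show False using w(3) that unfolding d_def by blast
  qed
  have z: "u (d w) \<noteq> d w" "v (d w) \<noteq> d w"
    using moved_u moved_v w unfolding d_def by blast+
  note comm = commutator_three_cycle[OF closed(5)[OF uv(1)] closed(5)[OF uv(2)] z fixed]
  have "u \<circ> v \<circ> inv' u \<circ> inv' v \<in> H" using uv closed by simp
  then have "three_cycle (d w) (u (d w)) (v (d w)) \<in> H" using comm(1) by simp
  then have "linked H (d w) (u (d w))" using comm(2) by (auto simp: linked_def)
  moreover have "\<not> x ` {1..p} \<subseteq> {1..p}"
  proof
    assume "x ` {1..p} \<subseteq> {1..p}"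
    then have "x ` {1..p} \<inter> {1..p} = W" by (auto simp: W_def)
    then have "p \<le> r" using small W(2) by simp
    moreover have "r < 4 ^ r" by (rule less_le_trans[OF less_exp]) (simp add: power_mono)
    ultimately show False using r_less by simp
  qed
  ultimately show ?thesis
    using generates_of_three_cycle[OF H g x] z(1) by metis
qed

end

section \<open>Simplicity of the alternating groups and subdirect products\<close>

lemma three_cycle_alt:
  assumes "distinct [a, b, c]" "{a, b, c} \<subseteq> {1..n}"
  shows "three_cycle a b c \<in> carrier (alt_group n)"
proof -
  have "three_cycle a b c \<in> three_cycles n"
    by (rule CollectI) (rule exI[of _ "[a, b, c]"], use assms in \<open>simp add: three_cycle_def\<close>)
  then show ?thesis using three_cycles_incl by blast
qed

lemma obtain_outside:
  assumes "finite S" "card S + 2 \<le> n"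
  obtains c d where "c \<in> {1..n} - S" "d \<in> {1..n} - S" "c \<noteq> d"
proof -
  have "n - card S \<le> card ({1..n} - S)"
    using diff_card_le_card_Diff[OF assms(1), of "{1..n}"] by simp
  then have "2 \<le> card ({1..n} - S)" using assms(2) by simp
  then show thesis
    using that by (metis card_le_Suc0_iff_eq finite_Diff finite_atLeastAtMost not_less_eq_eq numeral_2_eq_2)
qed

text \<open>Commutators with 3-cycles stay in \<open>N\<close>. The first one replaces
  \<open>\<nu>\<close> by an element \<open>w\<close> moving at most six points; the second one,
  with a 3-cycle meeting the support of \<open>w\<close> in one point, is a 3-cycle. Two free points
  besides those six account for the bound 8.\<close>

theorem alt_group_simple:
  assumes N: "subgroup N (alt_group n)" and n: "8 \<le> n"
    and conj: "\<And>h u. h \<in> carrier (alt_group n) \<Longrightarrow> u \<in> N \<Longrightarrow> h \<circ> u \<circ> inv' h \<in> N"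
    and \<nu>: "\<nu> \<in> N" "\<nu> \<noteq> id"
  shows "N = carrier (alt_group n)"
proof -
  note closed = alt_subgroup_closed[OF N]
  note bij3 = bij_three_cycle
  obtain a where a: "\<nu> a \<noteq> a" using \<nu>(2) by (auto simp: fun_eq_iff)
  have perm: "\<nu> permutes {1..n}" by (rule closed(4)[OF \<nu>(1)])
  have an: "a \<in> {1..n}" "\<nu> a \<in> {1..n}"
    using a permutes_not_in[OF perm] permutes_in_image[OF perm] by blast+
  have "card {a, \<nu> a} + 2 \<le> n" using n card_insert_le_m1[of 2 "{\<nu> a}" a] by simp
  then obtain c d where cd: "c \<in> {1..n} - {a, \<nu> a}" "d \<in> {1..n} - {a, \<nu> a}" "c \<noteq> d"
    using obtain_outside[of "{a, \<nu> a}" n] by blast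
  define t where "t = three_cycle a c d"
  have acd: "distinct [a, c, d]" using cd by auto
  have t: "t \<in> carrier (alt_group n)"
    unfolding t_def by (rule three_cycle_alt[OF acd]) (use an cd in auto)
  \<comment> \<open>A product of the 3-cycle on the \<open>\<nu>\<close>-images of \<open>a\<close>,
    \<open>c\<close>, \<open>d\<close> and the inverse of \<open>t\<close>. As \<open>c\<close> and
    \<open>d\<close> avoid \<open>\<nu> a\<close>, the latter fixes \<open>\<nu> a\<close>, so
    \<open>w\<close> is nontrivial.\<close>
  define w where "w = \<nu> \<circ> (t \<circ> inv' \<nu> \<circ> inv' t)"
  have w: "w \<in> N"
    unfolding w_def using \<nu>(1) conj[OF t] closed by blast
  have w_eq: "w = three_cycle (\<nu> a) (\<nu> c) (\<nu> d) \<circ> inv' t"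
    unfolding conj_three_cycle[OF closed(5)[OF \<nu>(1)], symmetric] w_def t_def by (simp add: comp_assoc)
  have d\<nu>: "distinct [\<nu> a, \<nu> c, \<nu> d]"
    using acd permutes_inj[OF perm] by (auto simp: inj_eq)
  define S where "S = {\<nu> a, \<nu> c, \<nu> d, a, c, d}"
  have invt: "inv' t = three_cycle d c a" by (simp add: t_def inv_three_cycle)
  have outside: "w y = y" if "y \<notin> S" for y
    using that three_cycle_apply(4)[OF d\<nu>, of y] three_cycle_apply(4)[of d c a y] acd
    by (auto simp: w_eq invt S_def)
  have "w (\<nu> a) = \<nu> c"
    using three_cycle_apply(4)[of d c a "\<nu> a"] acd cd a three_cycle_apply(1)[OF d\<nu>]
    by (auto simp: w_eq invt)
  then obtain e where e: "w e \<noteq> e" using d\<nu> by (metis distinct_length_2_or_more)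
  have "card S \<le> 6"
    using card_length[of "[\<nu> a, \<nu> c, \<nu> d, a, c, d]"] by (simp add: S_def)
  then obtain f h where fh: "f \<in> {1..n} - S" "h \<in> {1..n} - S" "f \<noteq> h"
    using obtain_outside[of S n] n by (auto simp: S_def)
  have eS: "e \<in> S" using e outside by blast
  have en: "e \<in> {1..n}" using e permutes_not_in[OF closed(4)[OF w]] by blast
  define z where "z = three_cycle e f h"
  have efh: "distinct [e, f, h]" using eS fh by auto
  have z: "z \<in> carrier (alt_group n)"
    unfolding z_def by (rule three_cycle_alt[OF efh]) (use en fh in auto)
  have zb: "bij z" by (simp add: z_def bij3)
  have ze: "z e \<noteq> e" unfolding z_def using three_cycle_apply(1)[OF efh] efh by simp
  have disj: "w y = y \<or> z y = y" if "y \<noteq> e" for y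
    using that fh outside three_cycle_apply(4)[OF efh] unfolding z_def by blast
  note comm = commutator_three_cycle[OF closed(5)[OF w] zb e ze disj]
  have "w \<circ> (z \<circ> inv' w \<circ> inv' z) \<in> N"
    using w conj[OF z] closed by blast
  then have "three_cycle e (w e) (z e) \<in> N"
    using comm(1) by (simp add: comp_assoc)
  then have link: "linked N e (w e)" using comm(2) by (auto simp: linked_def)
  have wn: "w e \<in> {1..n}" using en permutes_in_image[OF closed(4)[OF w]] by blast
  have all: "linked N e y" if y: "y \<in> {1..n}" for y
  proof (cases "y = e \<or> y = w e")
    case True
    then show ?thesis using link by (auto simp: linked_def)
  next
    case False
    have "card {e, w e, y} + 2 \<le> n"
      using n by (simp add: card_insert_if)
    then obtain m where m: "m \<in> {1..n} - {e, w e, y}"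
      using obtain_outside[of "{e, w e, y}" n] by blast
    \<comment> \<open>Fixes \<open>e\<close> and carries \<open>w e\<close> to \<open>y\<close>, so
      conjugation by it carries the link of \<open>e\<close> and \<open>w e\<close> to one of
      \<open>e\<close> and \<open>y\<close>.\<close>
    define k where "k = three_cycle (w e) y m"
    have dist: "distinct [w e, y, m]" using False m by auto
    have "k \<in> carrier (alt_group n)"
      unfolding k_def by (rule three_cycle_alt[OF dist]) (use wn y m in auto)
    then have "linked N (k e) (k (w e))"
      using conj by (intro linked_conj[OF _ _ link]) (auto simp: k_def bij3)
    moreover have "k e = e" "k (w e) = y"
      unfolding k_def using three_cycle_apply[OF dist] False m e by auto
    ultimately show ?thesis by simp
  qed
  show ?thesis
    by (rule eq_alt_group_of_linked[OF N]) (rule linked_trans[OF N linked_sym[OF N all] all])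
qed

lemma subgroup_image_DirProd:
  assumes "group A" "group B" "subgroup K (A \<times>\<times> B)"
  shows "subgroup (fst ` K) A" "subgroup (snd ` K) B"
proof -
  have "fst \<in> hom (A \<times>\<times> B) A" "snd \<in> hom (A \<times>\<times> B) B" by (auto simp: hom_def)
  then have "group_hom (A \<times>\<times> B) A fst" "group_hom (A \<times>\<times> B) B snd"
    using assms DirProd_group by (auto simp: group_hom_def group_hom_axioms_def)
  then show "subgroup (fst ` K) A" "subgroup (snd ` K) B"
    using assms(3) group_hom.subgroup_img_is_subgroup by blast+
qed

text \<open>Goursat's argument: as \<open>K\<close> projects onto the first factor, the elements
  \<open>a\<close> with \<open>(a, id)\<close> in \<open>K\<close> form a normal subgroup, which is
  everything by simplicity as soon as it is nontrivial.\<close>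

lemma subdirect_alt_full:
  assumes K: "subgroup K (alt_group n \<times>\<times> alt_group m)" and n: "8 \<le> n"
    and surj: "fst ` K = carrier (alt_group n)" "snd ` K = carrier (alt_group m)"
    and u: "(u, id) \<in> K" "u \<noteq> id"
  shows "K = carrier (alt_group n) \<times> carrier (alt_group m)"
proof -
  interpret K: subgroup K "alt_group n \<times>\<times> alt_group m" by fact
  have mult: "(a \<circ> c, b \<circ> d) \<in> K" if "(a, b) \<in> K" "(c, d) \<in> K" for a b c d
    using K.m_closed[OF that] by (simp add: alt_group_mult)
  have car: "a \<in> carrier (alt_group n)" "b \<in> carrier (alt_group m)" if "(a, b) \<in> K" for a b
    using K.mem_carrier[OF that] by simp_all
  have inv: "(inv' a, inv' b) \<in> K" if "(a, b) \<in> K" for a b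
    using K.m_inv_closed[OF that] car[OF that]
    by (simp add: inv_DirProd alt_group_is_group alt_group_inv_equality)
  have one: "(id, id) \<in> K" using K.one_closed by (simp add: alt_group_one)
  define N where "N = {a. (a, id) \<in> K}"
  interpret S: group "alt_group n" by (rule alt_group_is_group)
  have bij: "bij b" if "b \<in> carrier (alt_group m)" for b m
    using that permutes_bij by (auto simp: alt_group_carrier)
  have N: "N = carrier (alt_group n)"
  proof (rule alt_group_simple[OF _ n])
    show "subgroup N (alt_group n)"
    proof (rule S.subgroupI)
      show "N \<subseteq> carrier (alt_group n)" using car by (auto simp: N_def)
      show "N \<noteq> {}" using one by (auto simp: N_def)
      show "inv\<^bsub>alt_group n\<^esub> a \<in> N" if "a \<in> N" for a
        using that inv[of a id] car[of a id] by (simp add: N_def alt_group_inv_equality)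
      show "a \<otimes>\<^bsub>alt_group n\<^esub> b \<in> N" if "a \<in> N" "b \<in> N" for a b
        using that mult[of a id b id] by (simp add: N_def alt_group_mult)
    qed
    show "u \<in> N" "u \<noteq> id" using u by (simp_all add: N_def)
    fix h v assume "h \<in> carrier (alt_group n)" "v \<in> N"
    then obtain b where b: "(h, b) \<in> K" using surj(1) by force
    have "(h \<circ> v \<circ> inv' h, b \<circ> id \<circ> inv' b) \<in> K"
      using mult[OF mult[OF b, of v id] inv[OF b]] \<open>v \<in> N\<close> by (simp add: N_def)
    moreover have "b \<circ> id \<circ> inv' b = id"
      using bij[OF car(2)[OF b]] by (simp add: bij_is_surj surj_iff[symmetric])
    ultimately show "h \<circ> v \<circ> inv' h \<in> N" by (simp add: N_def)
  qed
  have "(a, b) \<in> K" if a: "a \<in> carrier (alt_group n)" and b: "b \<in> carrier (alt_group m)" for a b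
  proof -
    obtain c where c: "(c, b) \<in> K" using surj(2) b by force
    have "a \<circ> inv' c \<in> carrier (alt_group n)"
      using S.m_closed[OF a S.inv_closed[OF car(1)[OF c]]] car(1)[OF c]
      by (simp add: alt_group_mult alt_group_inv_equality)
    then have "(a \<circ> inv' c, id) \<in> K"
      using N by (auto simp: N_def)
    from mult[OF this c] have "(a \<circ> (inv' c \<circ> c), b) \<in> K" by (simp add: comp_assoc)
    moreover have "inv' c \<circ> c = id"
      using bij[OF car(1)[OF c]] by (simp add: bij_is_inj)
    ultimately show ?thesis by simp
  qed
  then show ?thesis using car by auto
qed

text \<open>The quotient of two elements of \<open>K\<close> over the same \<open>b\<close> has
  trivial second coordinate, so a proper subdirect subgroup is the graph of a map from the second
  factor to the first.\<close>

lemma subdirect_alt_determined: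
  assumes K: "subgroup K (alt_group n \<times>\<times> alt_group m)" and n: "8 \<le> n"
    and surj: "fst ` K = carrier (alt_group n)" "snd ` K = carrier (alt_group m)"
    and "K \<noteq> carrier (alt_group n) \<times> carrier (alt_group m)" "(a, b) \<in> K" "(c, b) \<in> K"
  shows "a = c"
proof -
  interpret K: subgroup K "alt_group n \<times>\<times> alt_group m" by fact
  have car: "a \<in> carrier (alt_group n)" "b \<in> carrier (alt_group m)" "c \<in> carrier (alt_group n)"
    using K.mem_carrier assms(6,7) by auto
  have bij: "bij b" if "b \<in> carrier (alt_group m)" for b m
    using that permutes_bij by (auto simp: alt_group_carrier)
  have "(a \<circ> inv' c, b \<circ> inv' b) \<in> K"
    using K.m_closed[OF assms(6) K.m_inv_closed[OF assms(7)]] car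
    by (simp add: inv_DirProd alt_group_is_group alt_group_inv_equality alt_group_mult)
  also have "b \<circ> inv' b = id"
    using bij[OF car(2)] by (simp add: bij_is_surj surj_iff[symmetric])
  finally have "a \<circ> inv' c = id"
    using subdirect_alt_full[OF K n surj] assms(5) by blast
  then have "a \<circ> (inv' c \<circ> c) = c" by (metis comp_assoc id_comp)
  then show ?thesis using bij[OF car(3)] by (simp add: bij_is_inj)
qed

text \<open>Otherwise a map from the smaller alternating group onto the larger one would
  exist.\<close>

lemma subdirect_alt_different:
  assumes K: "subgroup K (alt_group n \<times>\<times> alt_group m)" and n: "8 \<le> n" and m: "2 \<le> m" "m < n"
    and surj: "fst ` K = carrier (alt_group n)" "snd ` K = carrier (alt_group m)"
  shows "K = carrier (alt_group n) \<times> carrier (alt_group m)"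
proof (rule ccontr)
  assume no: "K \<noteq> carrier (alt_group n) \<times> carrier (alt_group m)"
  have fin: "finite (carrier (alt_group k))" for k
    by (rule finite_subset[OF _ finite_permutations[of "{1..k}"]]) (auto simp: alt_group_carrier)
  have K_sub: "K \<subseteq> carrier (alt_group n) \<times> carrier (alt_group m)"
    using subgroup.subset[OF K] by simp
  then have finK: "finite K" using fin by (meson finite_SigmaI finite_subset)
  have "inj_on snd K"
    using subdirect_alt_determined[OF K n surj no] by (auto simp: inj_on_def)
  then have "card K = card (carrier (alt_group m))"
    using card_image surj(2) by metis
  moreover have "card (carrier (alt_group n)) \<le> card K"
    using card_image_le[OF finK, of fst] surj(1) by simp
  ultimately have "(fact n :: nat) \<le> fact m"
    using alt_group_card_carrier[of n] alt_group_card_carrier[of m] n m by linarith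
  moreover have "fact m < (fact n :: nat)"
    using m by (intro fact_less_mono_nat) auto
  ultimately show False by simp
qed

section \<open>Counting permutations\<close>

definition involutions :: "'a set \<Rightarrow> ('a \<Rightarrow> 'a) set" where
  "involutions S = {u. u permutes S \<and> u \<circ> u = id}"

lemma finite_involutions: "finite S \<Longrightarrow> finite (involutions S)"
  by (rule finite_subset[OF _ finite_permutations]) (auto simp: involutions_def)

text \<open>Removing the orbit of a point \<open>z\<close> bounds the count for size
  \<open>n\<close> by that for \<open>n - 1\<close> plus \<open>n - 1\<close> times that for
  \<open>n - 2\<close>. The right-hand side is chosen to satisfy this recursion and to save a
  superpolynomial factor over \<open>n!\<close>.\<close>

lemma card_involutions:
  assumes "finite S"
  shows "real (card (involutions S)) \<le> fact (card S) / fact (card S div 2)"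
  using assms
proof (induction "card S" arbitrary: S rule: less_induct)
  case (less S)
  show ?case
  proof (cases "S = {}")
    case True
    then have "involutions S = {id}" by (auto simp: involutions_def)
    then show ?thesis using True by simp
  next
    case False
    then obtain z where z: "z \<in> S" by blast
    define n where "n = card S"
    have n: "n = Suc (n - 1)" using False less.prems by (simp add: n_def card_gt_0_iff)
    \<comment> \<open>The orbit of \<open>z\<close> is recorded by \<open>u z\<close>, and the
      transposition undoes \<open>u\<close> on it; for \<open>u z = z\<close> it is the identity and
      only \<open>z\<close> is removed.\<close>
    let ?\<phi> = "\<lambda>u. (u z, Transposition.transpose z (u z) \<circ> u)"
    have inj: "inj_on ?\<phi> (involutions S)"
    proof (rule inj_onI)
      fix u v assume "?\<phi> u = ?\<phi> v"
      then have "u z = v z \<and> Transposition.transpose z (u z) \<circ> u = Transposition.transpose z (v z) \<circ> v"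
        unfolding prod.inject .
      note eq = conjunct1[OF this] conjunct2[OF this]
      have "Transposition.transpose z (u z) \<circ> (Transposition.transpose z (u z) \<circ> u) =
          Transposition.transpose z (u z) \<circ> (Transposition.transpose z (u z) \<circ> v)"
        by (simp only: eq(1) eq(2)[unfolded eq(1)])
      then show "u = v" by (simp add: comp_assoc[symmetric])
    qed
    have into: "?\<phi> ` involutions S \<subseteq> Sigma S (\<lambda>y. involutions (S - {z, y}))"
    proof safe
      fix u assume "u \<in> involutions S"
      then have u: "u permutes S" "u \<circ> u = id" by (auto simp: involutions_def)
      show "u z \<in> S" using permutes_in_image[OF u(1)] z by simp
      let ?\<tau> = "Transposition.transpose z (u z)"
      have uu: "u (u y) = y" for y using u(2) by (simp add: fun_eq_iff)
      have eq: "u y = u x \<longleftrightarrow> y = x" for x y using permutes_inj[OF u(1)] by (auto simp: inj_eq)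
      have "?\<tau> \<circ> u permutes S"
        using u(1) \<open>u z \<in> S\<close> z by (intro permutes_compose permutes_swap_id)
      then have "?\<tau> \<circ> u permutes S - {z, u z}"
        by (rule permutes_superset) (auto simp: uu)
      moreover have "(?\<tau> \<circ> u) ((?\<tau> \<circ> u) y) = y" for y
        using eq[of y z] by (auto simp: Transposition.transpose_def uu)
      then have "(?\<tau> \<circ> u) \<circ> (?\<tau> \<circ> u) = id" by (simp add: fun_eq_iff)
      ultimately show "?\<tau> \<circ> u \<in> involutions (S - {z, u z})"
        by (simp add: involutions_def)
    qed
    have finS: "finite (Sigma S (\<lambda>y. involutions (S - {z, y})))"
      using less.prems by (intro finite_SigmaI finite_involutions) auto
    have "card (involutions S) \<le> card (Sigma S (\<lambda>y. involutions (S - {z, y})))"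
      by (rule card_inj_on_le[OF inj into finS])
    also have "\<dots> = (\<Sum>y\<in>S. card (involutions (S - {z, y})))"
      using less.prems by (intro card_SigmaI) (auto intro: finite_involutions)
    also have "\<dots> = card (involutions (S - {z})) + (\<Sum>y\<in>S - {z}. card (involutions (S - {z, y})))"
      using less.prems z by (simp add: sum.remove)
    finally have "real (card (involutions S)) \<le>
        real (card (involutions (S - {z}))) + (\<Sum>y\<in>S - {z}. real (card (involutions (S - {z, y}))))"
      by (simp flip: of_nat_sum of_nat_add)
    also have "real (card (involutions (S - {z}))) \<le> fact (n - 1) / fact ((n - 1) div 2)"
      using less.hyps[of "S - {z}"] less.prems z n by (simp add: n_def)
    also have "(\<Sum>y\<in>S - {z}. real (card (involutions (S - {z, y})))) \<le>
        (\<Sum>y\<in>S - {z}. fact (n - 2) / fact ((n - 2) div 2))"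
    proof (rule sum_mono)
      fix y assume y: "y \<in> S - {z}"
      have "card (S - {z, y}) = n - 2"
        using less.prems z y by (subst card_Diff_subset) (auto simp: n_def)
      moreover have "n - 2 < card S" using n by (simp add: n_def)
      ultimately show "real (card (involutions (S - {z, y}))) \<le> fact (n - 2) / fact ((n - 2) div 2)"
        using less.hyps[of "S - {z, y}"] less.prems by simp
    qed
    also have "\<dots> = real (n - 1) * (fact (n - 2) / fact ((n - 2) div 2))"
      using less.prems z by (simp add: n_def)
    also have "fact (n - 1) / fact ((n - 1) div 2) + real (n - 1) * (fact (n - 2) / fact ((n - 2) div 2))
        \<le> (fact n / fact (n div 2) :: real)"
    proof (cases "n = 1")
      case False
      then have "n - 1 \<noteq> 0" using n by simp
      then obtain m where "n - 1 = Suc m" using not0_implies_Suc by blast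
      then have m: "n = Suc (Suc m)" using n by simp
      define W where "W = (fact (n - 1) :: real)"
      define V where "V = (fact (m div 2) :: real)"
      have pos: "0 < W" "0 < V" by (simp_all add: W_def V_def)
      have "W / fact ((n - 1) div 2) \<le> W / V"
        using pos unfolding V_def by (intro divide_left_mono fact_mono) (auto simp: m)
      moreover have "real (n - 1) * (fact (n - 2) / fact ((n - 2) div 2)) = W / V"
        by (simp add: m W_def V_def)
      \<comment> \<open>Each summand is at most \<open>W / V\<close>, and passing from it to size
        \<open>n\<close> multiplies by \<open>n / (n div 2)\<close>, which is at least 2.\<close>
      moreover have "2 * (W / V) \<le> fact n / fact (n div 2)"
      proof -
        have eqs: "fact n = real n * W" "fact (n div 2) = (real (m div 2) + 1) * V"
          by (simp_all add: m W_def V_def)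
        have "2 * (m div 2 + 1) \<le> n" by (simp add: m)
        then have "real (2 * (m div 2 + 1)) \<le> real n" by (simp only: of_nat_le_iff)
        then have "2 \<le> real n / (real (m div 2) + 1)"
          by (subst pos_le_divide_eq) simp_all
        then have "2 * (W / V) \<le> real n / (real (m div 2) + 1) * (W / V)"
          using pos by (intro mult_right_mono) auto
        then show ?thesis unfolding eqs by (simp only: times_divide_times_eq)
      qed
      ultimately show ?thesis unfolding W_def by linarith
    qed simp
    finally show ?thesis by (simp add: n_def)
  qed
qed

lemma card_permutes_prescribed:
  assumes "finite S" "D \<subseteq> S"
  shows "card {s. s permutes S \<and> (\<forall>a\<in>D. s a = f a)} \<le> fact (card S - card D)"
proof (cases "{s. s permutes S \<and> (\<forall>a\<in>D. s a = f a)} = {}")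
  case False
  then obtain s0 where s0: "s0 permutes S" "\<forall>a\<in>D. s0 a = f a" by blast
  let ?\<phi> = "\<lambda>s. inv' s0 \<circ> s"
  have "card {s. s permutes S \<and> (\<forall>a\<in>D. s a = f a)} \<le> card {s. s permutes S - D}"
  proof (rule card_inj_on_le)
    show "inj_on ?\<phi> {s. s permutes S \<and> (\<forall>a\<in>D. s a = f a)}"
    proof (rule inj_onI)
      fix s t assume "?\<phi> s = ?\<phi> t"
      then have "s0 \<circ> inv' s0 \<circ> s = s0 \<circ> inv' s0 \<circ> t" by (simp add: comp_assoc)
      then show "s = t" by (simp add: permutes_inv_o[OF s0(1)])
    qed
    show "?\<phi> ` {s. s permutes S \<and> (\<forall>a\<in>D. s a = f a)} \<subseteq> {s. s permutes S - D}"
    proof safe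
      fix s assume s: "s permutes S" "\<forall>a\<in>D. s a = f a"
      have "inv' s0 \<circ> s permutes S" by (rule permutes_compose[OF s(1) permutes_inv[OF s0(1)]])
      then show "inv' s0 \<circ> s permutes S - D"
        by (rule permutes_superset)
          (use s(2) s0(2) permutes_inverses(2)[OF s0(1)] assms(2) in \<open>auto, metis\<close>)
    qed
    show "finite {s. s permutes S - D}" using assms by (intro finite_permutations) simp
  qed
  also have "\<dots> = fact (card S - card D)"
    using assms by (intro card_permutations) (auto simp: card_Diff_subset finite_subset)
  finally show ?thesis .
next
  case True
  show ?thesis unfolding True by simp
qed

text \<open>A union bound over \<open>k\<close> points of the first \<open>p\<close> that stay among
  them, with at most \<open>2 ^ p\<close> choices, and over their images, with \<open>p ^ k\<close>
  choices; the remaining \<open>n - k\<close> points contribute at most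
  \<open>(n - k)!\<close>.\<close>

lemma card_permutes_large_overlap:
  assumes "p \<le> n"
  shows "card {s. s permutes {1..n} \<and> k \<le> card (s ` {1..p} \<inter> {1..p})} \<le> 2 ^ p * p ^ k * fact (n - k)"
proof -
  let ?P = "{1..p}"
  let ?\<D> = "{D. D \<subseteq> ?P \<and> card D = k}"
  let ?B = "\<lambda>D f. {s. s permutes {1..n} \<and> (\<forall>a\<in>D. s a = f a)}"
  have fin: "finite (?B D f)" for D and f :: "nat \<Rightarrow> nat"
    by (rule finite_subset[OF _ finite_permutations[of "{1..n}"]]) auto
  have fin\<D>: "finite ?\<D>" by simp
  have finE: "finite (D \<rightarrow>\<^sub>E ?P)" if "D \<in> ?\<D>" for D
    using that finite_subset[of D ?P] by (intro finite_PiE) auto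
  have "{s. s permutes {1..n} \<and> k \<le> card (s ` ?P \<inter> ?P)} \<subseteq> (\<Union>D\<in>?\<D>. \<Union>f\<in>D \<rightarrow>\<^sub>E ?P. ?B D f)"
  proof clarify
    fix s assume s: "s permutes {1..n}" "k \<le> card (s ` ?P \<inter> ?P)"
    let ?D0 = "{a \<in> ?P. s a \<in> ?P}"
    have "s ` ?P \<inter> ?P = s ` ?D0" by auto
    then have "k \<le> card ?D0"
      using s(2) card_image_le[of ?D0 s] by simp
    then obtain D where D: "D \<subseteq> ?D0" "card D = k" "finite D"
      by (rule obtain_subset_with_card_n)
    then have "D \<in> ?\<D>" by blast
    moreover have "restrict s D \<in> D \<rightarrow>\<^sub>E ?P" using D by auto
    moreover have "s \<in> ?B D (restrict s D)" using s(1) by simp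
    ultimately show "s \<in> (\<Union>D\<in>?\<D>. \<Union>f\<in>D \<rightarrow>\<^sub>E ?P. ?B D f)" by (intro UN_I)
  qed
  then have "card {s. s permutes {1..n} \<and> k \<le> card (s ` ?P \<inter> ?P)} \<le>
      card (\<Union>D\<in>?\<D>. \<Union>f\<in>D \<rightarrow>\<^sub>E ?P. ?B D f)"
  proof (rule card_mono[rotated])
    show "finite (\<Union>D\<in>?\<D>. \<Union>f\<in>D \<rightarrow>\<^sub>E ?P. ?B D f)"
      by (rule finite_UN_I[OF fin\<D>], rule finite_UN_I[OF finE], assumption, rule fin)
  qed
  also have "\<dots> \<le> (\<Sum>D\<in>?\<D>. \<Sum>f\<in>D \<rightarrow>\<^sub>E ?P. card (?B D f))"
    by (rule order_trans[OF card_UN_le[OF fin\<D>] sum_mono]) (rule card_UN_le[OF finE])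
  also have "\<dots> \<le> (\<Sum>D\<in>?\<D>. \<Sum>f\<in>D \<rightarrow>\<^sub>E ?P. fact (n - k))"
  proof (intro sum_mono)
    fix D f assume "D \<in> ?\<D>"
    then have "D \<subseteq> {1..n}" "card D = k" using assms by auto
    then show "card (?B D f) \<le> fact (n - k)"
      using card_permutes_prescribed[of "{1..n}" D f] by simp
  qed
  also have "\<dots> = (\<Sum>D\<in>?\<D>. p ^ k * fact (n - k))"
  proof (rule sum.cong[OF refl])
    fix D assume "D \<in> ?\<D>"
    then have "card (D \<rightarrow>\<^sub>E ?P) = p ^ k"
      using finite_subset[of D ?P] by (subst card_PiE) auto
    then show "(\<Sum>f\<in>D \<rightarrow>\<^sub>E ?P. fact (n - k)) = p ^ k * (fact (n - k) :: nat)" by simp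
  qed
  also have "\<dots> = card ?\<D> * (p ^ k * fact (n - k))" by simp
  also have "\<dots> \<le> 2 ^ p * (p ^ k * fact (n - k))"
  proof (rule mult_right_mono)
    have "card ?\<D> \<le> card (Pow ?P)" by (rule card_mono) auto
    then show "card ?\<D> \<le> 2 ^ p" by (simp add: card_Pow)
  qed simp
  finally show ?thesis by (simp add: mult.assoc)
qed

section \<open>Point stabilizers in alternating groups\<close>

lemma finite_alt_group [simp]: "finite (carrier (alt_group n))"
  by (rule finite_subset[OF _ finite_permutations[of "{1..n}"]]) (auto simp: alt_group_carrier)

definition alt_stabilizer :: "nat \<Rightarrow> (nat \<Rightarrow> nat) set" where
  "alt_stabilizer n = {s \<in> carrier (alt_group n). s 1 = 1}"

lemma alt_stabilizer_subgroup: "subgroup (alt_stabilizer n) (alt_group n)"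
proof -
  interpret group "alt_group n" by (rule alt_group_is_group)
  show ?thesis
  proof (rule subgroupI)
    show "alt_stabilizer n \<noteq> {}"
      using one_closed by (auto simp: alt_stabilizer_def alt_group_one)
    fix a assume a: "a \<in> alt_stabilizer n"
    then have "a permutes {1..n}" by (simp add: alt_stabilizer_def alt_group_carrier)
    then have "inv' a 1 = 1" using a permutes_inverses(2)[of a "{1..n}" 1] by (simp add: alt_stabilizer_def)
    then show "inv\<^bsub>alt_group n\<^esub> a \<in> alt_stabilizer n"
      using a inv_closed[of a] by (simp add: alt_stabilizer_def alt_group_inv_equality)
    fix b assume "b \<in> alt_stabilizer n"
    with a show "a \<otimes>\<^bsub>alt_group n\<^esub> b \<in> alt_stabilizer n"
      using m_closed[of a b] by (simp add: alt_stabilizer_def alt_group_mult)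
  qed (auto simp: alt_stabilizer_def)
qed

lemma alt_stabilizer_proper:
  assumes "3 \<le> n"
  shows "alt_stabilizer n \<noteq> carrier (alt_group n)"
proof
  assume "alt_stabilizer n = carrier (alt_group n)"
  moreover have "three_cycle 1 2 3 \<in> carrier (alt_group n)"
    by (rule three_cycle_alt) (use assms in auto)
  ultimately have "three_cycle 1 2 3 1 = (1::nat)" by (auto simp: alt_stabilizer_def)
  then show False using three_cycle_apply(1)[of 1 2 "3::nat"] by simp
qed

lemma card_alt_stabilizer:
  assumes "1 \<le> n"
  shows "card (carrier (alt_group n)) \<le> n * card (alt_stabilizer n)"
proof -
  let ?A = "carrier (alt_group n)"
  interpret group "alt_group n" by (rule alt_group_is_group)
  have fin: "finite (alt_stabilizer n)"
    by (rule finite_subset[OF _ finite_alt_group[of n]]) (auto simp: alt_stabilizer_def)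
  have "?A \<subseteq> (\<Union>b\<in>{1..n}. {s \<in> ?A. s 1 = b})"
    using assms permutes_in_image[of _ "{1..n}" 1] by (auto simp: alt_group_carrier)
  then have "card ?A \<le> card (\<Union>b\<in>{1..n}. {s \<in> ?A. s 1 = b})"
    by (rule card_mono[rotated]) auto
  also have "\<dots> \<le> (\<Sum>b\<in>{1..n}. card {s \<in> ?A. s 1 = b})"
    by (rule card_UN_le) simp
  also have "\<dots> \<le> (\<Sum>b\<in>{1..n}. card (alt_stabilizer n))"
  proof (rule sum_mono)
    fix b
    show "card {s \<in> ?A. s 1 = b} \<le> card (alt_stabilizer n)"
    proof (cases "{s \<in> ?A. s 1 = b} = {}")
      case False
      then obtain s0 where s0: "s0 \<in> ?A" "s0 1 = b" by blast
      then have perm: "s0 permutes {1..n}" by (simp add: alt_group_carrier)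
      show ?thesis
      proof (rule card_inj_on_le[OF _ _ fin])
        show "inj_on (\<lambda>s. inv' s0 \<circ> s) {s \<in> ?A. s 1 = b}"
        proof (rule inj_onI)
          fix s t assume "inv' s0 \<circ> s = inv' s0 \<circ> t"
          then have "s0 \<circ> inv' s0 \<circ> s = s0 \<circ> inv' s0 \<circ> t" by (simp add: comp_assoc)
          then show "s = t" by (simp add: permutes_inv_o[OF perm])
        qed
        show "(\<lambda>s. inv' s0 \<circ> s) ` {s \<in> ?A. s 1 = b} \<subseteq> alt_stabilizer n"
        proof safe
          fix s assume s: "s \<in> ?A" "b = s 1"
          have "inv' s0 \<circ> s \<in> ?A"
            using m_closed[OF inv_closed[OF s0(1)] s(1)] s0(1)
            by (simp add: alt_group_mult alt_group_inv_equality)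
          then show "inv' s0 \<circ> s \<in> alt_stabilizer n"
            using s0 s permutes_inverses(2)[OF perm, of 1] by (simp add: alt_stabilizer_def)
        qed
      qed
    next
      case True
      show ?thesis unfolding True by simp
    qed
  qed
  finally show ?thesis by simp
qed

section \<open>Pairs of generating coordinates\<close>

text \<open>The \<open>k\<close> largest factors of \<open>n!\<close> are each at least
  \<open>n / 2\<close>.\<close>

lemma half_power_times_fact_le:
  assumes "2 * k \<le> n"
  shows "(real n / 2) ^ k * fact (n - k) \<le> (fact n :: real)"
  using assms
proof (induction k)
  case (Suc k)
  have "n - k = Suc (n - Suc k)" using Suc.prems by simp
  then have "(fact (n - k) :: real) = real (n - k) * fact (n - Suc k)"
    by (metis fact_Suc)
  moreover have "n \<le> 2 * (n - k)" using Suc.prems by arith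
  then have "real n \<le> real (2 * (n - k))" by (simp only: of_nat_le_iff)
  then have "real n / 2 \<le> real (n - k)" by simp
  ultimately have "real n / 2 * fact (n - Suc k) \<le> (fact (n - k) :: real)"
    by (simp only: mult_right_mono fact_ge_zero)
  then have "(real n / 2) ^ k * (real n / 2 * fact (n - Suc k)) \<le> (real n / 2) ^ k * fact (n - k)"
    by (intro mult_left_mono) auto
  also have "\<dots> \<le> fact n" using Suc by simp
  finally show ?case by (simp add: mult_ac)
qed simp

context two_cycle_generator begin

text \<open>The first transposition joins the two cycles of \<open>g\<close>, the second one makes
  the permutation even. It is an involution so that its image under a linking homomorphism is one
  too and can be counted.\<close>

definition mixing :: "nat \<Rightarrow> nat" where
  "mixing = Transposition.transpose 1 (Suc p) \<circ> Transposition.transpose (Suc (Suc p)) (Suc (Suc (Suc p)))"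

lemma mixing_involution: "mixing \<circ> mixing = id"
  using p_bounds by (auto simp: mixing_def fun_eq_iff Transposition.transpose_def)

lemma moved_mixing: "mixing z \<noteq> z \<longleftrightarrow> z \<in> {1, Suc p, Suc (p + 1), Suc (p + 2)}"
  using p_bounds by (auto simp: mixing_def Transposition.transpose_def)

lemma mixing_alt: "mixing \<in> carrier (alt_group n)"
proof -
  have "mixing permutes {1..n}"
    unfolding mixing_def using p_bounds by (intro permutes_compose permutes_swap_id) auto
  moreover have "evenperm mixing"
    unfolding mixing_def using p_bounds
    by (subst evenperm_comp) (auto simp: evenperm_swap permutation_swap_id)
  ultimately show ?thesis by (simp add: alt_group_carrier)
qed

lemma generates_of_mixing:
  assumes H: "subgroup H (alt_group n)" and g: "g \<in> H" and m: "mixing \<in> H"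
  shows "H = carrier (alt_group n)"
proof -
  note closed = alt_subgroup_closed[OF H]
  \<comment> \<open>This power of \<open>g\<close> fixes 1 and moves the three other points of the
    support of \<open>mixing\<close> to the next three of the second cycle, without wrapping around
    since \<open>n - p > 6\<close>. The two supports then share only 1.\<close>
  obtain s where s: "[s = 0] (mod p)" "[s = 3] (mod (n - p))" using crt by blast
  define d where "d = two_cycles p n s"
  have d: "d \<in> H" unfolding d_def by (rule two_cycles_mem[OF H g])
  have "5 * 5 \<le> p * p" using p_bounds(1) by (intro mult_mono) auto
  then have N: "6 < n - p" using p_bounds(4) by (simp add: power2_eq_square)
  have d1: "d 1 = 1"
    using two_cycles_left[of 0 p n s] s(1) p_bounds by (simp add: d_def cong_def)
  have dQ: "d (Suc (p + u)) = Suc (p + (u + 3))" if "u < 3" for u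
  proof -
    have "(u + s) mod (n - p) = (u + 3) mod (n - p)"
      using cong_add_lcancel_nat[of u s 3 "n - p"] s(2) by (simp add: cong_def)
    then show ?thesis using that N two_cycles_right[of u n p s] by (simp add: d_def)
  qed
  define v where "v = d \<circ> mixing \<circ> inv' d"
  have v: "v \<in> H" unfolding v_def using d m closed by simp
  have moved_set: "{z. mixing z \<noteq> z} = {1, Suc p, Suc (p + 1), Suc (p + 2)}"
    using moved_mixing by blast
  have moved_v: "v z \<noteq> z \<longleftrightarrow> z \<in> {1, Suc (p + 3), Suc (p + 4), Suc (p + 5)}" for z
  proof -
    have "v z \<noteq> z \<longleftrightarrow> z \<in> d ` {1, Suc p, Suc (p + 1), Suc (p + 2)}"
      unfolding v_def moved_conj[OF closed(5)[OF d]] moved_set ..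
    also have "d ` {1, Suc p, Suc (p + 1), Suc (p + 2)} = {1, Suc (p + 3), Suc (p + 4), Suc (p + 5)}"
      using dQ[of 0] dQ[of 1] dQ[of 2] d1 by simp
    finally show ?thesis .
  qed
  have fixed: "mixing z = z \<or> v z = z" if "z \<noteq> 1" for z
    using moved_mixing[of z] moved_v[of z] that by auto
  have mv: "mixing 1 \<noteq> 1" "v 1 \<noteq> 1" using moved_mixing moved_v by simp_all
  note comm = commutator_three_cycle[OF closed(5)[OF m] closed(5)[OF v] mv fixed]
  have "mixing \<circ> v \<circ> inv' mixing \<circ> inv' v \<in> H" using m v closed by simp
  then have "three_cycle 1 (mixing 1) (v 1) \<in> H" using comm(1) by simp
  then have "linked H 1 (mixing 1)"
    unfolding linked_def using comm(2) by blast
  moreover have "mixing 1 = Suc p" using p_bounds by (simp add: mixing_def)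
  ultimately show ?thesis
    using linked_all_of_mixed[OF H g, of 1 "Suc p"] p_bounds by simp
qed

definition graph_group :: "(nat \<Rightarrow> nat) \<Rightarrow> ((nat \<Rightarrow> nat) \<times> (nat \<Rightarrow> nat)) set" where
  "graph_group u = generate (alt_group n \<times>\<times> alt_group n) {(g, g), (u, mixing)}"

text \<open>If a proper subdirect subgroup contains \<open>(g, g)\<close> and \<open>(x, y)\<close>, it is the graph of a map from the
  second factor to the first one. With \<open>u\<close> the image of \<open>mixing\<close>, it contains \<open>graph_group u\<close>, which is then the
  whole graph; so \<open>x\<close> can be recovered from \<open>u\<close> and \<open>y\<close>.\<close>

definition bad_pairs :: "((nat \<Rightarrow> nat) \<times> (nat \<Rightarrow> nat)) set" where
  "bad_pairs = (\<lambda>(u, y). (SOME x. (x, y) \<in> graph_group u, y)) ` (involutions {1..n} \<times> carrier (alt_group n))"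

lemma finite_bad_pairs: "finite bad_pairs"
  unfolding bad_pairs_def by (intro finite_imageI finite_cartesian_product finite_involutions) auto

lemma card_bad_pairs: "card bad_pairs \<le> card (involutions {1..n}) * card (carrier (alt_group n))"
proof -
  have "card bad_pairs \<le> card (involutions {1..n} \<times> carrier (alt_group n))"
    unfolding bad_pairs_def by (rule card_image_le) (intro finite_cartesian_product finite_involutions, auto)
  then show ?thesis by (simp add: card_cartesian_product)
qed

theorem pair_full:
  assumes K: "subgroup K (alt_group n \<times>\<times> alt_group n)"
    and surj: "fst ` K = carrier (alt_group n)" "snd ` K = carrier (alt_group n)"
    and gg: "(g, g) \<in> K" and xy: "(x, y) \<in> K" and good: "(x, y) \<notin> bad_pairs"
  shows "K = carrier (alt_group n) \<times> carrier (alt_group n)"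
proof (rule ccontr)
  assume no: "K \<noteq> carrier (alt_group n) \<times> carrier (alt_group n)"
  have n8: "8 \<le> n" using p_bounds by simp
  note det = subdirect_alt_determined[OF K n8 surj no]
  interpret K: subgroup K "alt_group n \<times>\<times> alt_group n" by fact
  have grp: "group (alt_group n \<times>\<times> alt_group n)"
    by (rule DirProd_group) (rule alt_group_is_group)+
  have ycar: "y \<in> carrier (alt_group n)" using K.mem_carrier[OF xy] by simp
  obtain u where u: "(u, mixing) \<in> K" using surj(2) mixing_alt by force
  have ucar: "u \<in> carrier (alt_group n)" using K.mem_carrier[OF u] by simp
  \<comment> \<open>Since \<open>K\<close> is a graph over the second factor, the relation satisfied
    by \<open>mixing\<close> passes to \<open>u\<close>.\<close>
  have "(u \<circ> u, mixing \<circ> mixing) \<in> K" using K.m_closed[OF u u] by (simp add: alt_group_mult)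
  then have "(u \<circ> u, id) \<in> K" by (simp only: mixing_involution)
  moreover have "(id, id) \<in> K" using K.one_closed by (simp add: alt_group_one)
  ultimately have "u \<circ> u = id" by (rule det)
  then have uI: "u \<in> involutions {1..n}" using ucar by (simp add: involutions_def alt_group_carrier)
  let ?L = "graph_group u"
  have gen: "{(g, g), (u, mixing)} \<subseteq> carrier (alt_group n \<times>\<times> alt_group n)"
    using two_cycles_alt mixing_alt ucar by simp
  have L: "subgroup ?L (alt_group n \<times>\<times> alt_group n)"
    unfolding graph_group_def by (rule group.generate_is_subgroup[OF grp gen])
  have "?L \<subseteq> K"
    unfolding graph_group_def by (rule group.generate_subgroup_incl[OF grp _ K]) (use gg u in simp)
  have inL: "(g, g) \<in> ?L" "(u, mixing) \<in> ?L"
    unfolding graph_group_def by (auto intro: generate.incl)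
  \<comment> \<open>The second projection contains \<open>g\<close> and \<open>mixing\<close>, so
    the part of the graph generated by them lies over every \<open>y\<close> and its first
    coordinate there must agree with \<open>x\<close>.\<close>
  have "snd ` ?L = carrier (alt_group n)"
    using subgroup_image_DirProd(2)[OF alt_group_is_group alt_group_is_group L]
    by (rule generates_of_mixing) (use inL in force)+
  then obtain x' where "(x', y) \<in> ?L" using ycar by force
  then have "(SOME x. (x, y) \<in> ?L, y) \<in> ?L"
    by (rule someI[of "\<lambda>x. (x, y) \<in> ?L"])
  then have "x = (SOME x. (x, y) \<in> ?L)" using det xy \<open>?L \<subseteq> K\<close> by blast
  then have "(x, y) \<in> bad_pairs"
    unfolding bad_pairs_def using uI ycar by (intro image_eqI[of _ _ "(u, y)"]) auto
  then show False using good by contradiction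
qed

text \<open>The count runs over all permutations while the even ones number \<open>n! / 2\<close>,
  hence the extra factor 2.\<close>

lemma probability_large_overlap:
  assumes "2 * Suc r \<le> n"
  shows "real (card {s \<in> carrier (alt_group n). r < card (s ` {1..p} \<inter> {1..p})}) / real (card (carrier (alt_group n)))
    \<le> 2 * 2 ^ p * (2 * real p / real n) ^ Suc r"
proof -
  have le: "p \<le> n" using p_bounds by simp
  let ?A = "card (carrier (alt_group n))"
  have "2 \<le> n" using p_bounds by simp
  then have "real (2 * ?A) = real (fact n)" by (simp only: alt_group_card_carrier)
  then have A: "2 * real ?A = fact n" by simp
  have "card {s \<in> carrier (alt_group n). r < card (s ` {1..p} \<inter> {1..p})} \<le>
      card {s. s permutes {1..n} \<and> Suc r \<le> card (s ` {1..p} \<inter> {1..p})}"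
    by (rule card_mono[OF finite_subset[OF _ finite_permutations[of "{1..n}"]]]) (auto simp: alt_group_carrier)
  also have "\<dots> \<le> 2 ^ p * p ^ Suc r * fact (n - Suc r)"
    by (rule card_permutes_large_overlap[OF le])
  finally have "real (card {s \<in> carrier (alt_group n). r < card (s ` {1..p} \<inter> {1..p})})
      \<le> real (2 ^ p * p ^ Suc r * fact (n - Suc r))"
    by (rule of_nat_mono)
  also have "\<dots> = 2 ^ p * real p ^ Suc r * fact (n - Suc r)" by simp
  finally have c: "real (card {s \<in> carrier (alt_group n). r < card (s ` {1..p} \<inter> {1..p})})
      \<le> 2 ^ p * real p ^ Suc r * fact (n - Suc r)" .
  have "(real n / 2) ^ Suc r * fact (n - Suc r) \<le> (fact n :: real)"
    by (rule half_power_times_fact_le[OF assms])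
  moreover have pos: "0 < (real n / 2) ^ Suc r"
    by (rule zero_less_power) (use p_bounds in simp)
  ultimately have "fact (n - Suc r) \<le> (fact n :: real) / (real n / 2) ^ Suc r"
    by (simp only: pos_le_divide_eq mult.commute)
  then have "2 ^ p * real p ^ Suc r * fact (n - Suc r) \<le> 2 ^ p * real p ^ Suc r * (fact n / (real n / 2) ^ Suc r)"
    by (rule mult_left_mono) simp
  also have "\<dots> = 2 ^ p * (real p / (real n / 2)) ^ Suc r * fact n"
    by (simp only: power_divide[of "real p" "real n / 2"] times_divide_eq_right times_divide_eq_left mult_ac)
  also have "real p / (real n / 2) = 2 * real p / real n" by simp
  also have "2 ^ p * (2 * real p / real n) ^ Suc r * fact n = 2 * 2 ^ p * (2 * real p / real n) ^ Suc r * real ?A"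
    unfolding A[symmetric] by (simp only: mult_ac)
  finally have "2 ^ p * real p ^ Suc r * fact (n - Suc r) \<le> 2 * 2 ^ p * (2 * real p / real n) ^ Suc r * real ?A" .
  with c have "real (card {s \<in> carrier (alt_group n). r < card (s ` {1..p} \<inter> {1..p})}) \<le>
      2 * 2 ^ p * (2 * real p / real n) ^ Suc r * real ?A" by linarith
  moreover have "0 < real ?A" using A fact_gt_zero[of n, where 'a = real] by linarith
  ultimately show ?thesis by (simp add: divide_le_eq)
qed

text \<open>One factor of the order cancels against the free choice of \<open>y\<close>; the other,
  \<open>n! / 2\<close>, is compared with the bound on involutions.\<close>

lemma probability_bad_pairs:
  "real (card bad_pairs) / (real (card (carrier (alt_group n))))\<^sup>2 \<le> 2 / fact (n div 2)"
proof -
  let ?A = "card (carrier (alt_group n))"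
  have "2 \<le> n" using p_bounds by simp
  then have "real (2 * ?A) = real (fact n)" by (simp only: alt_group_card_carrier)
  then have A: "2 * real ?A = fact n" by simp
  then have pos: "0 < real ?A" using fact_gt_zero[of n, where 'a = real] by linarith
  have "real (card bad_pairs) \<le> real (card (involutions {1..n})) * real ?A"
    using card_bad_pairs by (simp flip: of_nat_mult)
  also have "\<dots> \<le> (fact n / fact (n div 2)) * real ?A"
    using card_involutions[of "{1..n}"] by (intro mult_right_mono) auto
  also have "\<dots> = 2 / fact (n div 2) * (real ?A)\<^sup>2"
    unfolding A[symmetric] by (simp add: power2_eq_square)
  finally show ?thesis using pos by (simp add: divide_le_eq)
qed

end

section \<open>Choice of the parameters\<close>

lemma prime_above: "\<exists>q::nat. Factorial_Ring.prime q \<and> b < q"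
  using bigger_prime by blast

text \<open>The prime \<open>p\<close> depends only on \<open>m\<close>; the second prime is taken
  afterwards, so that everything depending on \<open>m\<close> and \<open>p\<close> is constant
  compared to \<open>n\<close>. The two estimates are union bounds over the factors and the pairs of
  factors of one degree, with a weight summable in \<open>m\<close>.\<close>

lemma parameters_exist:
  fixes m b :: nat
  shows "\<exists>p n. two_cycle_generator p n (Suc m) \<and> b < n \<and> 2 * Suc (Suc m) \<le> n \<and>
    real n ^ m * (2 * 2 ^ p * (2 * real p / real n) ^ Suc (Suc m)) \<le> (1 / 2) ^ m / 8 \<and>
    real n ^ m * real n ^ m * (2 / fact (n div 2)) \<le> (1 / 2) ^ m / 8"
proof -
  obtain p :: nat where p: "Factorial_Ring.prime p" "4 ^ Suc m < p"
    using prime_above by blast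
  \<comment> \<open>\<open>C1\<close> and \<open>C2\<close> are the constants left in the two
    estimates, multiplied by \<open>8 * 2 ^ m\<close>, after all but a negative power of
    \<open>n\<close> or \<open>n div 2\<close> has cancelled.\<close>
  define C1 where "C1 = 16 * 2 ^ m * 2 ^ p * (2 * p) ^ Suc (Suc m)"
  define C2 :: nat where "C2 = 32 * 2 ^ m * 6 ^ (2 * m)"
  obtain q :: nat where q: "Factorial_Ring.prime q"
    "4 ^ p + b + C1 + 2 * C2 + 8 * Suc (Suc m) < q"
    using prime_above by blast
  define n where "n = p + q"
  have n: "4 ^ p < n - p" "b < n" "C1 \<le> n" "2 * C2 \<le> n" "8 * Suc (Suc m) \<le> n"
    using q(2) by (auto simp: n_def)
  have npos: "0 < real n" using n(5) by simp
  have "two_cycle_generator p n (Suc m)"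
    by unfold_locales (use p q n in \<open>auto simp: n_def\<close>)
  moreover have "2 * Suc (Suc m) \<le> n" using n(5) by simp
  moreover have "real n ^ m * (2 * 2 ^ p * (2 * real p / real n) ^ Suc (Suc m)) \<le> (1 / 2) ^ m / 8"
  proof -
    have "real n ^ m * (2 * 2 ^ p * (2 * real p / real n) ^ Suc (Suc m)) =
        2 * 2 ^ p * (2 * real p) ^ Suc (Suc m) * (real n ^ m / real n ^ Suc (Suc m))"
      by (simp only: power_divide times_divide_eq_right mult_ac)
    also have "real n ^ m / real n ^ Suc (Suc m) = 1 / real n / real n"
      using npos by simp
    also have "2 * 2 ^ p * (2 * real p) ^ Suc (Suc m) * (1 / real n / real n) =
        (2 * 2 ^ p * (2 * real p) ^ Suc (Suc m) / real n) / real n" by simp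
    also have "\<dots> \<le> (2 * 2 ^ p * (2 * real p) ^ Suc (Suc m) / real n) / 1"
      using npos n(5) by (intro divide_left_mono) auto
    also have "2 * 2 ^ p * (2 * real p) ^ Suc (Suc m) = real C1 * ((1 / 2) ^ m / 8)"
      by (simp add: C1_def power_one_over del: power_Suc)
    also have "real C1 * ((1 / 2) ^ m / 8) / real n / 1 = (real C1 / real n) * ((1 / 2) ^ m / 8)" by simp
    also have "\<dots> \<le> 1 * ((1 / 2) ^ m / 8)"
      using npos n(3) by (intro mult_right_mono) (auto simp: divide_le_eq)
    finally show ?thesis by simp
  qed
  moreover have "real n ^ m * real n ^ m * (2 / fact (n div 2)) \<le> (1 / 2) ^ m / 8"
  proof -
    \<comment> \<open>From \<open>j!\<close> a factor \<open>(j / 2) ^ (2 * m + 1)\<close> is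
      extracted. With \<open>n \<le> 3 * j\<close> it absorbs \<open>n ^ (2 * m)\<close> and leaves
      one factor \<open>1 / j\<close> to beat \<open>C2\<close>.\<close>
    define j where "j = n div 2"
    have j: "2 * (2 * m + 1) \<le> j" "C2 \<le> j" "n \<le> 3 * j" using n(4,5) by (simp_all add: j_def)
    have jpos: "0 < real j" using j(1) by simp
    have "(real j / 2) ^ (2 * m + 1) * 1 \<le> (real j / 2) ^ (2 * m + 1) * fact (j - (2 * m + 1))"
      by (intro mult_left_mono) auto
    also have "\<dots> \<le> fact j" by (rule half_power_times_fact_le[OF j(1)])
    finally have fj: "(real j / 2) ^ (2 * m + 1) \<le> fact j" by simp
    have "real n ^ m * real n ^ m = real n ^ (2 * m)" by (simp add: power_add[symmetric] mult_2)
    also have "\<dots> \<le> (3 * real j) ^ (2 * m)" using j(3) by (intro power_mono) auto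
    also have "3 * real j = 6 * (real j / 2)" by simp
    also have "(6 * (real j / 2)) ^ (2 * m) = 6 ^ (2 * m) * (real j / 2) ^ (2 * m)"
      by (rule power_mult_distrib)
    finally have "real n ^ m * real n ^ m * (2 / fact j) \<le> 6 ^ (2 * m) * (real j / 2) ^ (2 * m) * (2 / fact j)"
      by (rule mult_right_mono) simp
    also have "\<dots> \<le> 6 ^ (2 * m) * (real j / 2) ^ (2 * m) * (2 / (real j / 2) ^ (2 * m + 1))"
      using jpos fj by (intro mult_left_mono divide_left_mono mult_pos_pos) auto
    also have "\<dots> = 6 ^ (2 * m) * 4 * ((real j / 2) ^ (2 * m) / ((real j / 2) ^ (2 * m) * real j))"
      by simp
    also have "(real j / 2) ^ (2 * m) / ((real j / 2) ^ (2 * m) * real j) = 1 / real j"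
      using jpos by simp
    also have "6 ^ (2 * m) * 4 * (1 / real j) = (real C2 / real j) * ((1 / 2) ^ m / 8)"
      by (simp add: C2_def power_one_over)
    also have "\<dots> \<le> 1 * ((1 / 2) ^ m / 8)"
      using jpos j(2) by (intro mult_right_mono) (auto simp: divide_le_eq)
    finally show ?thesis by (simp add: j_def)
  qed
  ultimately show ?thesis using n(2) by blast
qed

text \<open>Strict growth makes the degrees of distinct blocks different, which excludes linkage
  between them.\<close>

lemma parameter_sequences:
  "\<exists>pp nn :: nat \<Rightarrow> nat. strict_mono nn \<and> (\<forall>m. two_cycle_generator (pp m) (nn m) (Suc m) \<and>
    2 * Suc (Suc m) \<le> nn m \<and>
    real (nn m) ^ m * (2 * 2 ^ pp m * (2 * real (pp m) / real (nn m)) ^ Suc (Suc m)) \<le> (1 / 2) ^ m / 8 \<and>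
    real (nn m) ^ m * real (nn m) ^ m * (2 / fact (nn m div 2)) \<le> (1 / 2) ^ m / 8)"
proof -
  let ?Q = "\<lambda>m z. two_cycle_generator (fst z) (snd z) (Suc m) \<and> 2 * Suc (Suc m) \<le> snd z \<and>
    real (snd z) ^ m * (2 * 2 ^ fst z * (2 * real (fst z) / real (snd z)) ^ Suc (Suc m)) \<le> (1 / 2) ^ m / 8 \<and>
    real (snd z) ^ m * real (snd z) ^ m * (2 / fact (snd z div 2)) \<le> (1 / 2) ^ m / 8"
  have "\<exists>f :: nat \<Rightarrow> nat \<times> nat. \<forall>m. ?Q m (f m) \<and> snd (f m) < snd (f (Suc m))"
  proof (rule dependent_nat_choice)
    show "\<exists>z. ?Q 0 z" using parameters_exist[where m = 0 and b = 0]
      by (elim exE, rule_tac x = "(p, n)" in exI, simp only: fst_conv snd_conv)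
    show "\<exists>y. ?Q (Suc m) y \<and> snd z < snd y" for z m
      using parameters_exist[where m = "Suc m" and b = "snd z"]
      by (elim exE, rule_tac x = "(p, n)" in exI, simp only: fst_conv snd_conv)
  qed
  then obtain f :: "nat \<Rightarrow> nat \<times> nat" where "\<And>m. ?Q m (f m)" "\<And>m. snd (f m) < snd (f (Suc m))" by blast
  then show ?thesis
    by (intro exI[of _ "fst \<circ> f"] exI[of _ "snd \<circ> f"]) (auto simp: strict_mono_Suc_iff)
qed

lemma block_indexing:
  fixes k :: "nat \<Rightarrow> nat"
  assumes "\<And>m. 0 < k m"
  shows "\<exists>b :: nat \<Rightarrow> nat. \<forall>m. finite {i. b i = m} \<and> card {i. b i = m} = k m"
proof -
  let ?S = "Sigma UNIV (\<lambda>m. {..<k m})"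
  have "infinite ?S"
  proof
    assume "finite ?S"
    then have "finite (fst ` ?S)" by (rule finite_imageI)
    moreover have "fst ` ?S = UNIV"
      using assms by force
    ultimately show False by simp
  qed
  then have bij: "bij_betw (from_nat_into ?S) UNIV ?S"
    by (intro bij_betw_from_nat_into) auto
  have "bij_betw (from_nat_into ?S) {i. fst (from_nat_into ?S i) = m} ({m} \<times> {..<k m})" for m
  proof (rule bij_betw_subset[OF bij])
    show "from_nat_into ?S ` {i. fst (from_nat_into ?S i) = m} = {m} \<times> {..<k m}"
    proof (intro equalityI subsetI)
      fix z assume "z \<in> {m} \<times> {..<k m}"
      then have "z \<in> ?S" "fst z = m" by auto
      then obtain i where "z = from_nat_into ?S i" using bij by (metis bij_betw_imp_surj_on imageE)
      then show "z \<in> from_nat_into ?S ` {i. fst (from_nat_into ?S i) = m}" using \<open>fst z = m\<close> by auto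
    next
      fix z assume "z \<in> from_nat_into ?S ` {i. fst (from_nat_into ?S i) = m}"
      then have "fst z = m" "z \<in> ?S" using bij_betw_imp_surj_on[OF bij] by auto
      then show "z \<in> {m} \<times> {..<k m}" by auto
    qed
  qed simp
  then have "finite {i. fst (from_nat_into ?S i) = m} \<and> card {i. fst (from_nat_into ?S i) = m} = k m" for m
    using bij_betw_same_card bij_betw_finite by fastforce
  then show ?thesis by (intro exI[of _ "\<lambda>i. fst (from_nat_into ?S i)"]) blast
qed

section \<open>The profinite group\<close>

context finite_groups begin

lemma top_generate_eqI:
  assumes "Y \<subseteq> carrier G"
    and "\<And>H. subgroup H G \<Longrightarrow> closedin T H \<Longrightarrow> Y \<subseteq> H \<Longrightarrow> H = carrier G"
  shows "top_generate G T Y = carrier G"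
proof
  show "top_generate G T Y \<subseteq> carrier G"
    unfolding top_generate_def
    by (rule hull_minimal) (use assms(1) in \<open>auto intro: group.subgroup_self simp: T_def\<close>)
  show "carrier G \<subseteq> top_generate G T Y"
    unfolding top_generate_def hull_def using assms(2) by blast
qed

end

text \<open>The coordinate \<open>i\<close> carries the alternating group of degree
  \<open>nn (b i)\<close>, so \<open>b\<close> sorts the coordinates into blocks of equal degree.
  \<open>bound1\<close> and \<open>bound2\<close> are weighted by the size of a block and by its
  square, ready for union bounds.\<close>

locale alternating_tower =
  fixes pp nn b :: "nat \<Rightarrow> nat"
  assumes mono: "strict_mono nn"
    and gen: "\<And>m. two_cycle_generator (pp m) (nn m) (Suc m)"
    and large: "\<And>m. 2 * Suc (Suc m) \<le> nn m"
    and bound1: "\<And>m. real (nn m) ^ m * (2 * 2 ^ pp m * (2 * real (pp m) / real (nn m)) ^ Suc (Suc m)) \<le> (1 / 2) ^ m / 8"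
    and bound2: "\<And>m. real (nn m) ^ m * real (nn m) ^ m * (2 / fact (nn m div 2)) \<le> (1 / 2) ^ m / 8"
    and blocks: "\<And>m. finite {i. b i = m}" "\<And>m. card {i. b i = m} = nn m ^ m"
begin

abbreviation "Alt m \<equiv> alt_group (nn m)"

text \<open>Permutations are encoded as natural numbers so that the product group lives on sequences
  of naturals, whose product topology is the profinite one.\<close>

definition code :: "nat \<Rightarrow> (nat \<Rightarrow> nat) \<Rightarrow> nat" where
  "code m = (SOME f. inj_on f (carrier (Alt m)))"

definition decode :: "nat \<Rightarrow> nat \<Rightarrow> nat \<Rightarrow> nat" where
  "decode m = inv_into (carrier (Alt m)) (code m)"

definition coord :: "nat \<Rightarrow> nat monoid" where
  "coord i = image_group (code (b i)) (Alt (b i))"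

lemma inj_code: "inj_on (code m) (carrier (Alt m))"
proof -
  have "\<exists>f :: (nat \<Rightarrow> nat) \<Rightarrow> nat. \<exists>k. f ` carrier (Alt m) = {i. i < k} \<and> inj_on f (carrier (Alt m))"
    by (rule finite_imp_inj_to_nat_seg) simp
  then obtain f :: "(nat \<Rightarrow> nat) \<Rightarrow> nat" where "inj_on f (carrier (Alt m))" by (elim exE conjE)
  then show ?thesis unfolding code_def
    by (rule someI[of "\<lambda>f. inj_on f (carrier (Alt m))"])
qed

lemma carrier_coord: "carrier (coord i) = code (b i) ` carrier (Alt (b i))"
  by (simp add: coord_def image_group_carrier)

lemma code_iso: "code (b i) \<in> iso (Alt (b i)) (coord i)"
  unfolding coord_def by (rule inj_imp_image_group_iso[OF inj_code])

lemma decode_iso: "decode (b i) \<in> iso (coord i) (Alt (b i))"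
  unfolding decode_def by (rule group.iso_set_sym[OF alt_group_is_group code_iso])

lemma decode_code: "s \<in> carrier (Alt m) \<Longrightarrow> decode m (code m s) = s"
  unfolding decode_def by (rule inv_into_f_f[OF inj_code])

lemma code_decode: "a \<in> carrier (coord i) \<Longrightarrow> code (b i) (decode (b i) a) = a"
  by (simp add: decode_def carrier_coord f_inv_into_f)

lemma decode_mem: "a \<in> carrier (coord i) \<Longrightarrow> decode (b i) a \<in> carrier (Alt (b i))"
  unfolding decode_def carrier_coord by (rule inv_into_into)

lemma group_coord: "group (coord i)"
  unfolding coord_def by (rule group.inj_imp_image_group_is_group[OF alt_group_is_group inj_code])

sublocale finite_groups coord
  by (rule finite_groups.intro) (rule group_coord, simp add: carrier_coord)

sublocale gen: two_cycle_generator "pp m" "nn m" "Suc m" for m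
  by (rule gen)

lemma order_coord: "order (coord i) = card (carrier (Alt (b i)))"
  unfolding order_def carrier_coord by (rule card_image[OF inj_code])

lemma nn_ge: "8 \<le> nn m"
  using gen.p_bounds[of m] by simp

lemma derived_coord: "derived (coord i) (carrier (coord i)) = carrier (coord i)"
proof -
  interpret group_hom "Alt (b i)" "coord i" "code (b i)"
    using code_iso alt_group_is_group group_coord by (simp add: group_hom_def group_hom_axioms_def iso_def)
  have "derived (Alt (b i)) (carrier (Alt (b i))) = carrier (Alt (b i))"
    by (rule derived_alt_group_const) (use nn_ge[of "b i"] in simp)
  then show ?thesis
    using derived_img[of "carrier (Alt (b i))"] by (simp add: carrier_coord)
qed

definition generator :: "nat \<Rightarrow> nat" where
  "generator i = code (b i) (two_cycles (pp (b i)) (nn (b i)) (Suc 0))"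

lemma generator_mem: "generator \<in> carrier G"
  using gen.two_cycles_alt by (auto simp: carrier_G generator_def carrier_coord)

lemma generator_neq_one: "generator \<noteq> \<one>\<^bsub>G\<^esub>"
proof
  assume "generator = \<one>\<^bsub>G\<^esub>"
  then have "generator 0 = \<one>\<^bsub>coord 0\<^esub>" by simp
  then have "code (b 0) (two_cycles (pp (b 0)) (nn (b 0)) (Suc 0)) = code (b 0) id"
    by (simp add: generator_def coord_def image_group_one alt_group_one)
  moreover have "id \<in> carrier (Alt (b 0))"
    using group.is_monoid[OF alt_group_is_group] monoid.one_closed alt_group_one by metis
  ultimately have "two_cycles (pp (b 0)) (nn (b 0)) (Suc 0) = id"
    using inj_onD[OF inj_code] gen.two_cycles_alt by blast
  then have "two_cycles (pp (b 0)) (nn (b 0)) (Suc 0) (Suc 0) = Suc 0" by simp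
  then show False
    using two_cycles_left[of 0 "pp (b 0)" "nn (b 0)" "Suc 0"] gen.p_bounds[of "b 0"] by simp
qed

definition overlaps :: "nat \<Rightarrow> (nat \<Rightarrow> nat) set" where
  "overlaps m = {s \<in> carrier (Alt m). Suc m < card (s ` {1..pp m} \<inter> {1..pp m})}"

definition overlap_event :: "nat \<Rightarrow> (nat \<Rightarrow> nat) set" where
  "overlap_event i = {x \<in> carrier G. x i \<in> code (b i) ` overlaps (b i)}"

definition linkage_event :: "nat \<Rightarrow> nat \<Rightarrow> (nat \<Rightarrow> nat) set" where
  "linkage_event i j = (\<Union>(s, t)\<in>gen.bad_pairs (b i) \<inter> carrier (Alt (b i)) \<times> carrier (Alt (b i)).
    {x \<in> carrier G. x i = code (b i) s \<and> x j = code (b j) t})"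

text \<open>Only equal degrees need to be controlled by probability;
  \<open>subdirect_alt_different\<close> settles the other pairs.\<close>

definition block_pairs :: "nat \<Rightarrow> (nat \<times> nat) set" where
  "block_pairs m = {(i, j). i \<noteq> j \<and> b i = m \<and> b j = m}"

definition exceptional :: "nat \<Rightarrow> (nat \<Rightarrow> nat) set" where
  "exceptional m = (\<Union>i\<in>{i. b i = m}. overlap_event i) \<union> (\<Union>(i, j)\<in>block_pairs m. linkage_event i j)"

lemma generates:
  assumes x: "x \<in> carrier G - (\<Union>m. exceptional m)"
  shows "top_generate G T {x, generator} = carrier G"
proof (rule top_generate_eqI)
  show "{x, generator} \<subseteq> carrier G" using x generator_mem by simp
  fix H assume H: "subgroup H G" "closedin T H" "{x, generator} \<subseteq> H"
  interpret H: subgroup H G by (rule H(1))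
  let ?e = "\<lambda>i h. decode (b i) (h i)"
  have xi: "x i \<in> carrier (coord i)" for i using x by (simp add: carrier_G)
  have Hi: "h i \<in> carrier (coord i)" if "h \<in> H" for h i
    using H.mem_carrier[OF that] by (simp add: carrier_G)
  have e_gen: "?e i generator = two_cycles (pp (b i)) (nn (b i)) (Suc 0)" for i
    using gen.two_cycles_alt by (simp add: generator_def decode_code)
  have e_hom: "?e i (h \<otimes>\<^bsub>G\<^esub> k) = ?e i h \<otimes>\<^bsub>Alt (b i)\<^esub> ?e i k" "?e i h \<in> carrier (Alt (b i))"
    if "h \<in> carrier G" "k \<in> carrier G" for i h k
    using decode_iso[of i] decode_mem[of "h i" i] that by (auto simp: iso_def hom_def carrier_G)
  have ehom: "(\<lambda>h. (?e i h, ?e j h)) \<in> hom G (Alt (b i) \<times>\<times> Alt (b j))" for i j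
    using e_hom by (auto simp: hom_def)
  have K: "subgroup ((\<lambda>h. (?e i h, ?e j h)) ` H) (Alt (b i) \<times>\<times> Alt (b j))" for i j
  proof -
    have "group_hom G (Alt (b i) \<times>\<times> Alt (b j)) (\<lambda>h. (?e i h, ?e j h))"
      using ehom DirProd_group[OF alt_group_is_group alt_group_is_group]
      by (simp add: group_hom_def group_hom_axioms_def)
    then show ?thesis using H(1) by (rule group_hom.subgroup_img_is_subgroup)
  qed
  \<comment> \<open>The single projections are read off from the diagonal pair of coordinates
    \<open>i\<close>, \<open>i\<close>.\<close>
  have sub: "subgroup (?e i ` H) (Alt (b i))" for i
    using subgroup_image_DirProd(1)[OF alt_group_is_group alt_group_is_group K[of i i]]
    by (simp add: image_image)
  have full: "?e i ` H = carrier (Alt (b i))" for i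
  proof (rule gen.generates_of_small_overlap[OF sub])
    show "two_cycles (pp (b i)) (nn (b i)) (Suc 0) \<in> ?e i ` H"
      using H(3) e_gen[of i] by (metis image_eqI insert_subset)
    show "?e i x \<in> ?e i ` H" using H(3) by blast
    have "x \<notin> overlap_event i" using x by (auto simp: exceptional_def)
    then have "?e i x \<notin> overlaps (b i)"
      using x code_decode[OF xi[of i]] by (auto simp: overlap_event_def image_iff)
    then show "card (?e i x ` {1..pp (b i)} \<inter> {1..pp (b i)}) \<le> Suc (b i)"
      using decode_mem[OF xi[of i]] by (simp add: overlaps_def)
  qed
  \<comment> \<open>The larger degree comes first, as \<open>subdirect_alt_different\<close>
    demands; \<open>pairs\<close> below swaps the coordinates in the opposite case.\<close>
  have pairs_le: "(\<lambda>h. (?e i h, ?e j h)) ` H = carrier (Alt (b i)) \<times> carrier (Alt (b j))"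
    if "i \<noteq> j" "nn (b j) \<le> nn (b i)" for i j
  proof -
    have surj: "fst ` ((\<lambda>h. (?e i h, ?e j h)) ` H) = carrier (Alt (b i))"
      "snd ` ((\<lambda>h. (?e i h, ?e j h)) ` H) = carrier (Alt (b j))"
      using full by (simp_all add: image_image)
    show ?thesis
    proof (cases "b i = b j")
      case False
      then have "nn (b j) < nn (b i)"
        using that(2) strict_mono_eq[OF mono] by (metis le_neq_implies_less)
      then show ?thesis
        using nn_ge[of "b i"] nn_ge[of "b j"] by (intro subdirect_alt_different[OF K _ _ _ surj]) auto
    next
      case True
      have "x \<notin> linkage_event i j" using x that True by (auto simp: exceptional_def block_pairs_def)
      then have good: "(?e i x, ?e j x) \<notin> gen.bad_pairs (b i)"
        using x code_decode[OF xi[of i]] code_decode[OF xi[of j]] decode_mem[OF xi[of i]]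
          decode_mem[OF xi[of j]] True by (force simp: linkage_event_def)
      have gg: "(two_cycles (pp (b i)) (nn (b i)) (Suc 0), two_cycles (pp (b i)) (nn (b i)) (Suc 0))
          \<in> (\<lambda>h. (?e i h, ?e j h)) ` H"
        using H(3) e_gen[of i] e_gen[of j] True by (intro image_eqI[of _ _ generator]) auto
      have xx: "(?e i x, ?e j x) \<in> (\<lambda>h. (?e i h, ?e j h)) ` H" using H(3) by blast
      have "(\<lambda>h. (?e i h, ?e j h)) ` H = carrier (Alt (b i)) \<times> carrier (Alt (b i))"
        by (rule gen.pair_full[OF _ _ _ gg xx good]) (use K[of i j] surj True in simp_all)
      then show ?thesis using True by simp
    qed
  qed
  have pairs: "\<exists>h\<in>H. ?e i h = s \<and> ?e j h = t"
    if "i \<noteq> j" "s \<in> carrier (Alt (b i))" "t \<in> carrier (Alt (b j))" for i j s t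
  proof (cases "nn (b j) \<le> nn (b i)")
    case True
    have "(s, t) \<in> (\<lambda>h. (?e i h, ?e j h)) ` H" unfolding pairs_le[OF that(1) True] using that by simp
    then show ?thesis by auto
  next
    case False
    have "(t, s) \<in> (\<lambda>h. (?e j h, ?e i h)) ` H"
      using pairs_le[of j i] that False by simp
    then show ?thesis by auto
  qed
  show "H = carrier G"
  proof (rule eq_carrier_of_pairs[OF H(1,2) derived_coord])
    fix i j a c assume ij: "i \<noteq> j" and ac: "a \<in> carrier (coord i)" "c \<in> carrier (coord j)"
    obtain h where h: "h \<in> H" "?e i h = decode (b i) a" "?e j h = decode (b j) c"
      using pairs[OF ij decode_mem[OF ac(1)] decode_mem[OF ac(2)]] by blast
    have "h i = a" "h j = c"
      using code_decode[OF Hi[OF h(1)]] code_decode[OF ac(1)] code_decode[OF ac(2)] h(2,3) by metis+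
    then show "\<exists>h\<in>H. h i = a \<and> h j = c" using h(1) by blast
  qed
qed


section \<open>Measure of the exceptional set\<close>

lemma singleton_cylinder:
  assumes "i \<noteq> j" "s \<in> carrier (Alt (b i))" "t \<in> carrier (Alt (b j))"
  shows "{x \<in> carrier G. x i = code (b i) s \<and> x j = code (b j) t} \<in> sets M"
    "haar.prob {x \<in> carrier G. x i = code (b i) s \<and> x j = code (b j) t} =
      1 / real (card (carrier (Alt (b i)))) * (1 / real (card (carrier (Alt (b j)))))"
proof -
  let ?S = "{x \<in> carrier G. x i = code (b i) s \<and> x j = code (b j) t}"
  let ?B = "\<lambda>k. if k = i then {code (b i) s} else {code (b j) t}"
  have eq: "?S = {x \<in> carrier G. \<forall>k\<in>{i, j}. x k \<in> ?B k}"
    using assms(1) by auto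
  have "?S = {x \<in> carrier G. x i \<in> {code (b i) s}} \<inter> {x \<in> carrier G. x j \<in> {code (b j) t}}"
    by auto
  also have "\<dots> \<in> sets M" by (rule sets.Int[OF cylinder_sets cylinder_sets])
  finally show "?S \<in> sets M" .
  have "emeasure M ?S = (\<Prod>k\<in>{i, j}. ennreal (real (card (?B k)) / real (order (coord k))))"
    unfolding eq by (rule emeasure_cylinder) (use assms in \<open>auto simp: carrier_coord\<close>)
  also have "\<dots> = ennreal (1 / real (card (carrier (Alt (b i)))) * (1 / real (card (carrier (Alt (b j))))))"
    using assms(1) by (simp add: order_coord ennreal_mult'[symmetric])
  finally show "haar.prob ?S =
      1 / real (card (carrier (Alt (b i)))) * (1 / real (card (carrier (Alt (b j)))))"
    by (simp add: haar.emeasure_eq_measure)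
qed

lemma overlap_event: "overlap_event i \<in> sets M"
  "haar.prob (overlap_event i) \<le> 2 * 2 ^ pp (b i) * (2 * real (pp (b i)) / real (nn (b i))) ^ Suc (Suc (b i))"
proof -
  show "overlap_event i \<in> sets M" unfolding overlap_event_def by (rule cylinder_sets)
  have sub: "overlaps (b i) \<subseteq> carrier (Alt (b i))" by (auto simp: overlaps_def)
  have "emeasure M {x \<in> carrier G. \<forall>k\<in>{i}. x k \<in> code (b i) ` overlaps (b i)} =
      (\<Prod>k\<in>{i}. ennreal (real (card (code (b i) ` overlaps (b i))) / real (order (coord k))))"
    by (rule emeasure_cylinder) (use sub in \<open>auto simp: carrier_coord\<close>)
  moreover have "card (code (b i) ` overlaps (b i)) = card (overlaps (b i))"
    by (rule card_image[OF inj_on_subset[OF inj_code sub]])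
  ultimately have "haar.prob (overlap_event i) = real (card (overlaps (b i))) / real (card (carrier (Alt (b i))))"
    by (simp add: overlap_event_def haar.emeasure_eq_measure order_coord)
  also have "\<dots> \<le> 2 * 2 ^ pp (b i) * (2 * real (pp (b i)) / real (nn (b i))) ^ Suc (Suc (b i))"
    unfolding overlaps_def by (rule gen.probability_large_overlap[OF large])
  finally show "haar.prob (overlap_event i) \<le>
      2 * 2 ^ pp (b i) * (2 * real (pp (b i)) / real (nn (b i))) ^ Suc (Suc (b i))" .
qed

lemma linkage_event:
  assumes "(i, j) \<in> block_pairs m"
  shows "linkage_event i j \<in> sets M" "haar.prob (linkage_event i j) \<le> 2 / fact (nn m div 2)"
proof -
  let ?S = "\<lambda>(s, t). {x \<in> carrier G. x i = code (b i) s \<and> x j = code (b j) t}"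
  let ?Z = "gen.bad_pairs m \<inter> carrier (Alt m) \<times> carrier (Alt m)"
  let ?A = "real (card (carrier (Alt m)))"
  have ij: "i \<noteq> j" "b i = m" "b j = m" using assms by (auto simp: block_pairs_def)
  have fin: "finite ?Z" by (simp add: gen.finite_bad_pairs)
  have S: "?S z \<in> sets M" "haar.prob (?S z) = 1 / ?A * (1 / ?A)" if "z \<in> ?Z" for z
    using that ij singleton_cylinder[OF ij(1), of "fst z" "snd z"] by (auto simp: case_prod_beta)
  have eq: "linkage_event i j = (\<Union>z\<in>?Z. ?S z)"
    by (simp add: linkage_event_def ij)
  show "linkage_event i j \<in> sets M"
    unfolding eq using fin S(1) by (rule sets.finite_UN)
  have "haar.prob (linkage_event i j) \<le> (\<Sum>z\<in>?Z. haar.prob (?S z))"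
    unfolding eq by (rule measure_UNION_le[OF fin S(1)])
  also have "\<dots> = real (card ?Z) * (1 / ?A * (1 / ?A))"
    using S(2) by simp
  also have "\<dots> \<le> real (card (gen.bad_pairs m)) * (1 / ?A * (1 / ?A))"
    by (intro mult_right_mono of_nat_mono card_mono gen.finite_bad_pairs) auto
  also have "\<dots> = real (card (gen.bad_pairs m)) / ?A\<^sup>2"
    by (simp add: power2_eq_square)
  also have "\<dots> \<le> 2 / fact (nn m div 2)" by (rule gen.probability_bad_pairs)
  finally show "haar.prob (linkage_event i j) \<le> 2 / fact (nn m div 2)" .
qed

lemma exceptional:
  "exceptional m \<in> sets M" "haar.prob (exceptional m) \<le> (1 / 2) ^ m / 4"
proof -
  let ?J = "{i. b i = m}"
  let ?q1 = "2 * 2 ^ pp m * (2 * real (pp m) / real (nn m)) ^ Suc (Suc m)"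
  let ?q2 = "2 / fact (nn m div 2) :: real"
  have sub: "block_pairs m \<subseteq> ?J \<times> ?J" by (auto simp: block_pairs_def)
  have fin: "finite (block_pairs m)"
    by (rule finite_subset[OF sub]) (simp add: blocks)
  have "card (block_pairs m) \<le> card (?J \<times> ?J)"
    by (rule card_mono[OF _ sub]) (simp add: blocks)
  then have card: "card (block_pairs m) \<le> nn m ^ m * nn m ^ m"
    by (simp add: card_cartesian_product blocks)
  let ?B1 = "\<Union>i\<in>?J. overlap_event i" and ?B2 = "\<Union>z\<in>block_pairs m. linkage_event (fst z) (snd z)"
  have eq: "exceptional m = ?B1 \<union> ?B2" by (simp add: exceptional_def case_prod_beta)
  have s2: "linkage_event (fst z) (snd z) \<in> sets M" "haar.prob (linkage_event (fst z) (snd z)) \<le> ?q2"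
    if "z \<in> block_pairs m" for z
    using linkage_event[of "fst z" "snd z" m] that by simp_all
  have B1: "?B1 \<in> sets M" by (rule sets.finite_UN) (use blocks overlap_event in auto)
  have B2: "?B2 \<in> sets M" by (rule sets.finite_UN) (use fin s2 in auto)
  show "exceptional m \<in> sets M" unfolding eq using B1 B2 by (rule sets.Un)
  have "haar.prob ?B1 \<le> (\<Sum>i\<in>?J. haar.prob (overlap_event i))"
    by (rule measure_UNION_le) (use blocks overlap_event in auto)
  also have "\<dots> \<le> (\<Sum>i\<in>?J. ?q1)"
  proof (rule sum_mono)
    fix i assume "i \<in> ?J"
    then show "haar.prob (overlap_event i) \<le> ?q1" using overlap_event(2)[of i] by simp
  qed
  also have "\<dots> = real (nn m) ^ m * ?q1" by (simp only: sum_constant blocks of_nat_power)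
  also have "\<dots> \<le> (1 / 2) ^ m / 8" by (rule bound1)
  finally have le1: "haar.prob ?B1 \<le> (1 / 2) ^ m / 8" .
  have "haar.prob ?B2 \<le> (\<Sum>z\<in>block_pairs m. haar.prob (linkage_event (fst z) (snd z)))"
    by (rule measure_UNION_le[OF fin s2(1)])
  also have "\<dots> \<le> (\<Sum>z\<in>block_pairs m. ?q2)" by (rule sum_mono[OF s2(2)])
  also have "\<dots> = real (card (block_pairs m)) * ?q2" by (simp only: sum_constant)
  also have "\<dots> \<le> real (nn m ^ m * nn m ^ m) * ?q2"
    by (rule mult_right_mono[OF of_nat_mono[OF card]]) simp
  also have "\<dots> = real (nn m) ^ m * real (nn m) ^ m * ?q2" by simp
  also have "\<dots> \<le> (1 / 2) ^ m / 8" by (rule bound2)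
  finally have le2: "haar.prob ?B2 \<le> (1 / 2) ^ m / 8" .
  have "haar.prob (exceptional m) \<le> haar.prob ?B1 + haar.prob ?B2"
    unfolding eq by (rule measure_Un_le[OF B1 B2])
  with le1 le2 show "haar.prob (exceptional m) \<le> (1 / 2) ^ m / 4" by simp
qed

lemma exceptional_union: "(\<Union>m. exceptional m) \<in> sets M" "emeasure M (\<Union>m. exceptional m) \<le> ennreal (1 / 2)"
proof -
  show "(\<Union>m. exceptional m) \<in> sets M" using exceptional(1) by blast
  have "emeasure M (\<Union>m. exceptional m) \<le> suminf (\<lambda>m. emeasure M (exceptional m))"
    by (rule emeasure_subadditive_countably) (use exceptional(1) in auto)
  \<comment> \<open>Each block contributes at most 1/8 for overlaps and 1/8 for linkage, times
    \<open>(1 / 2) ^ m\<close>; the total is 1/2.\<close>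
  also have "\<dots> \<le> suminf (\<lambda>m. ennreal (1 / 4 * (1 / 2) ^ m))"
    using exceptional(2) by (intro suminf_le) (auto simp: haar.emeasure_eq_measure intro!: ennreal_leI)
  also have "\<dots> = ennreal (1 / 4 * (1 / (1 - 1 / 2)))"
    by (rule suminf_ennreal_eq[OF _ sums_mult[OF geometric_sums]]) simp_all
  finally show "emeasure M (\<Union>m. exceptional m) \<le> ennreal (1 / 2)" by simp
qed

text \<open>The exceptional set has measure at most 1/2 and so cannot cover the group; any element
  outside it is a partner for \<open>generator\<close>.\<close>

lemma two_generated:
  "\<exists>x\<in>carrier G. top_generate G T {x, generator} = carrier G"
proof -
  have "carrier G - (\<Union>m. exceptional m) \<noteq> {}"
  proof
    assume "carrier G - (\<Union>m. exceptional m) = {}"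
    then have "emeasure M (space M) \<le> emeasure M (\<Union>m. exceptional m)"
      by (intro emeasure_mono exceptional_union(1)) auto
    also have "\<dots> \<le> ennreal (1 / 2)" by (rule exceptional_union(2))
    finally have "ennreal 1 \<le> ennreal (1 / 2)" by (simp only: haar.emeasure_space_1 ennreal_1)
    then show False by (subst (asm) ennreal_le_iff) simp_all
  qed
  then show ?thesis using generates by blast
qed

lemma expected_generation_time_generator:
  "expected_generation_time G T M {generator} \<le> 5"
proof -
  \<comment> \<open>Each draw fails with probability at most 1/2, so the expected time is in fact at
    most 2.\<close>
  have "expected_generation_time G T M {generator} \<le> ennreal (1 / (1 - 1 / 2))"
    by (rule expected_generation_time_le[OF _ exceptional_union]) (use generator_mem generates in auto)
  also have "\<dots> \<le> ennreal 5" by (rule ennreal_leI) simp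
  also have "ennreal 5 = 5" by simp
  finally show ?thesis .
qed

lemma expected_generation_time_empty:
  "expected_generation_time G T M {} = \<infinity>"
proof (rule expected_generation_time_infinite)
  let ?S = "\<lambda>i. code (b i) ` alt_stabilizer (nn (b i))"
  fix i
  have hom: "group_hom (Alt (b i)) (coord i) (code (b i))"
    using code_iso alt_group_is_group group_coord by (simp add: group_hom_def group_hom_axioms_def iso_def)
  show "subgroup (?S i) (coord i)"
    by (rule group_hom.subgroup_img_is_subgroup[OF hom alt_stabilizer_subgroup])
  have sub: "alt_stabilizer (nn (b i)) \<subseteq> carrier (Alt (b i))" by (auto simp: alt_stabilizer_def)
  show "?S i \<noteq> carrier (coord i)"
    unfolding carrier_coord using inj_on_image_eq_iff[OF inj_code sub order_refl]
      alt_stabilizer_proper[of "nn (b i)"] nn_ge[of "b i"] by simp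
next
  fix m
  show "finite {i. b i = m}" by (rule blocks)
  have "card {i. b i = m} \<noteq> 0" using nn_ge[of m] by (simp add: blocks)
  then show "{i. b i = m} \<noteq> {}" by (metis card.empty)
next
  fix d
  let ?S = "\<lambda>i. code (b i) ` alt_stabilizer (nn (b i))"
  let ?r = "\<lambda>i. real (card (?S i)) / real (order (coord i))"
  have r: "1 / real (nn (b i)) \<le> ?r i" "?r i \<le> 1" for i
  proof -
    have sub: "alt_stabilizer (nn (b i)) \<subseteq> carrier (Alt (b i))" by (auto simp: alt_stabilizer_def)
    have c: "card (?S i) = card (alt_stabilizer (nn (b i)))"
      by (rule card_image[OF inj_on_subset[OF inj_code sub]])
    have pos: "0 < card (carrier (Alt (b i)))"
      using subgroup.one_closed[OF alt_stabilizer_subgroup, of "nn (b i)"] sub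
      by (auto simp: card_gt_0_iff)
    have "card (carrier (Alt (b i))) \<le> nn (b i) * card (alt_stabilizer (nn (b i)))"
      by (rule card_alt_stabilizer) (use nn_ge[of "b i"] in simp)
    then have "real (card (carrier (Alt (b i)))) \<le> real (nn (b i)) * real (card (alt_stabilizer (nn (b i))))"
      by (simp flip: of_nat_mult)
    then show "1 / real (nn (b i)) \<le> ?r i"
      using pos nn_ge[of "b i"] by (simp add: c order_coord field_simps)
    show "?r i \<le> 1"
      using pos card_mono[OF finite_alt_group sub] by (simp add: c order_coord)
  qed
  have nn_le: "m \<le> nn m" for m using strict_mono_imp_increasing[OF mono] by blast
  \<comment> \<open>Each of the \<open>nn m ^ m\<close> factors of the product is at most
    \<open>exp (- ?y)\<close>, where \<open>?y\<close> is \<open>nn m ^ -d\<close>. The exponents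
    add up to \<open>nn m ^ (m - d)\<close>, which is at least \<open>nn m \<ge> m\<close> because
    \<open>d < m\<close>.\<close>
  have le: "(\<Prod>i\<in>{i. b i = m}. 1 - ?r i ^ d) \<le> exp (- real m)" if "d < m" for m
  proof -
    let ?y = "(1 / real (nn m)) ^ d"
    have "(\<Prod>i\<in>{i. b i = m}. 1 - ?r i ^ d) \<le> (\<Prod>i\<in>{i. b i = m}. exp (- ?y))"
    proof (rule prod_mono)
      fix i assume "i \<in> {i. b i = m}"
      then have "?y \<le> ?r i ^ d"
        using r(1)[of i] by (intro power_mono) auto
      moreover have "1 - ?y \<le> exp (- ?y)" using exp_ge_add_one_self[of "- ?y"] by simp
      moreover have "?r i ^ d \<le> 1" using r(2)[of i] by (intro power_le_one) auto
      ultimately show "0 \<le> 1 - ?r i ^ d \<and> 1 - ?r i ^ d \<le> exp (- ?y)" by linarith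
    qed
    also have "\<dots> = exp (- (real (nn m) ^ m * ?y))"
      by (simp add: blocks exp_of_nat_mult[symmetric])
    also have "\<dots> \<le> exp (- real m)"
    proof -
      have "real (nn m) ^ m * ?y = real (nn m) ^ (m - d)"
        using that nn_ge[of m] by (simp add: power_one_over power_diff)
      moreover have "real (nn m) ^ 1 \<le> real (nn m) ^ (m - d)"
        using that nn_ge[of m] by (intro power_increasing) auto
      moreover have "real m \<le> real (nn m)" using nn_le by simp
      ultimately show ?thesis by simp
    qed
    finally show ?thesis .
  qed
  have lim: "(\<lambda>m. exp (- real m)) \<longlonglongrightarrow> 0"
    by (rule filterlim_compose[OF exp_at_bot])
      (simp add: filterlim_uminus_at_bot_at_top filterlim_real_sequentially filterlim_uminus_at_bot)
  show "(\<lambda>m. \<Prod>i\<in>{i. b i = m}. 1 - ?r i ^ d) \<longlonglongrightarrow> 0"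
  proof (rule tendsto_sandwich[OF _ _ tendsto_const lim])
    show "\<forall>\<^sub>F m in sequentially. 0 \<le> (\<Prod>i\<in>{i. b i = m}. 1 - ?r i ^ d)"
      using r(2) by (intro always_eventually allI prod_nonneg) (auto intro!: power_le_one)
    show "\<forall>\<^sub>F m in sequentially. (\<Prod>i\<in>{i. b i = m}. 1 - ?r i ^ d) \<le> exp (- real m)"
      using eventually_gt_at_top[of d] by eventually_elim (rule le)
  qed
qed

end

theorem corollary4:
  shows "\<exists>(G :: (nat \<Rightarrow> nat) monoid) T M.
           profinite_group G T \<and> carrier G \<noteq> {\<one>\<^bsub>G\<^esub>} \<and>
           (\<exists>a\<in>carrier G. \<exists>b\<in>carrier G. top_generate G T {a, b} = carrier G) \<and>
           normalized_haar_measure G T M \<and>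
           expected_generation_time G T M {} = \<infinity> \<and>
           (\<exists>g\<in>carrier G. expected_generation_time G T M {g} \<le> 5)"
proof -
  obtain pp nn :: "nat \<Rightarrow> nat" where par: "strict_mono nn"
    "\<And>m. two_cycle_generator (pp m) (nn m) (Suc m)" "\<And>m. 2 * Suc (Suc m) \<le> nn m"
    "\<And>m. real (nn m) ^ m * (2 * 2 ^ pp m * (2 * real (pp m) / real (nn m)) ^ Suc (Suc m)) \<le> (1 / 2) ^ m / 8"
    "\<And>m. real (nn m) ^ m * real (nn m) ^ m * (2 / fact (nn m div 2)) \<le> (1 / 2) ^ m / 8"
    using parameter_sequences by blast
  have "0 < nn m ^ m" for m using par(3)[of m] by simp
  then obtain b :: "nat \<Rightarrow> nat" where b: "\<And>m. finite {i. b i = m}" "\<And>m. card {i. b i = m} = nn m ^ m"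
    using block_indexing[of "\<lambda>m. nn m ^ m"] by blast
  interpret alternating_tower pp nn b
    by (rule alternating_tower.intro[OF par b])
  show ?thesis
  proof (rule exI[of _ G], rule exI[of _ T], rule exI[of _ M], intro conjI)
    show "profinite_group G T" by (rule profinite_G)
    show "carrier G \<noteq> {\<one>\<^bsub>G\<^esub>}" using generator_mem generator_neq_one by auto
    show "\<exists>a\<in>carrier G. \<exists>b\<in>carrier G. top_generate G T {a, b} = carrier G"
      using two_generated generator_mem by blast
    show "normalized_haar_measure G T M" by (rule haar_M)
    show "expected_generation_time G T M {} = \<infinity>" by (rule expected_generation_time_empty)
    show "\<exists>g\<in>carrier G. expected_generation_time G T M {g} \<le> 5"
      using expected_generation_time_generator generator_mem by blast
  qed
qed

end
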